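(* Let $n\ge 1$, let $p\in(0,n)$, and let $B=(\mathbb{R}^n,\|\cdot\|)$ be an $n$-dimensional homogeneous space. Then $B$ embeds in $L_{-p}$ if and only if the function $x\mapsto\|x\|^{-p}$ is a positive definite distribution on $\mathbb{R}^n$.
   Context: A homogeneous $n$-dimensional space $B=(\mathbb{R}^n,\|\cdot\|)$ is $\mathbb{R}^n$ together with a continuous function $x\mapsto\|x\|$ on $\mathbb{R}^n$ that is homogeneous of degree 1 ($\|tx\|=|t|\,\|x\|$ for all $t\in\mathbb{R}$, $x\in\mathbb{R}^n$) and positive outside the origin; no triangle inequality is assumed. For $p\in(0,n)$ the function $\|x\|^{-p}$ is locally integrable and is regarded as a tempered distribution. $\mathcal{S}(\mathbb{R}^n)$ is the (complex-valued) Schwartz space; its elements are called test functions, and $\mathcal{S}'(\mathbb{R}^n)$ is the space of distributions over it. The Fourier transform of a test function is $\hat\phi(\xi)=\int_{\mathbb{R}^n}\phi(x)e^{-i(x,\xi)}\,dx$. A distribution $f\in\mathcal{S}'(\mathbb{R}^n)$ is called positive definite if $\langle f,\ \phi*\overline{\phi(-x)}\rangle\ge 0$ for every test function $\phi$. Embedding in $L_{-p}$: let $\Omega$ be the Euclidean unit sphere in $\mathbb{R}^n$. For $p\in(0,n)$, the space $B$ embeds in $L_{-p}$ if there exists a finite (non-negative) symmetric Borel measure $\gamma$ on $\Omega$ such that for every test function $\phi$ $$\int_{\mathbb{R}^n}\|x\|^{-p}\phi(x)\,dx=\int_\Omega d\gamma(\xi)\int_{\mathbb{R}}|t|^{p-1}\hat\phi(t\xi)\,dt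 .$$ *)

theory Defs
  imports "HOL-Analysis.Analysis"
begin

definition homogeneous_space :: "(real^'n \<Rightarrow> real) \<Rightarrow> bool" where
  "homogeneous_space N \<longleftrightarrow>
     continuous_on UNIV N \<and>
     (\<forall>t x. N (t *\<^sub>R x) = \<bar>t\<bar> * N x) \<and>
     (\<forall>x. x \<noteq> 0 \<longrightarrow> N x > 0)"

definition partial_derivative :: "'n \<Rightarrow> (real^'n \<Rightarrow> complex) \<Rightarrow> real^'n \<Rightarrow> complex" where
  "partial_derivative i f x = frechet_derivative f (at x) (axis i 1)"

definition iterated_partial :: "'n list \<Rightarrow> (real^'n \<Rightarrow> complex) \<Rightarrow> real^'n \<Rightarrow> complex" where
  "iterated_partial is f = foldr partial_derivative is f"

text \<open>Frechet differentiability of all iterated partial derivatives amounts to infinite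
  differentiability; a list of coordinates plays the role of a multi-index.\<close>

definition schwartz :: "(real^'n \<Rightarrow> complex) \<Rightarrow> bool" where
  "schwartz \<phi> \<longleftrightarrow>
     (\<forall>is x. iterated_partial is \<phi> differentiable (at x)) \<and>
     (\<forall>is k. bounded (range (\<lambda>x. (1 + norm x) ^ k *\<^sub>R iterated_partial is \<phi> x)))"

definition schwartz_seminorm :: "nat \<Rightarrow> 'n list \<Rightarrow> (real^'n \<Rightarrow> complex) \<Rightarrow> real" where
  "schwartz_seminorm k is \<phi> = (SUP x. (1 + norm x) ^ k * cmod (iterated_partial is \<phi> x))"

text \<open>A distribution is represented by a functional on all functions, of which only the values
  on Schwartz functions matter. The last conjunct is continuity of a linear functional for the
  topology generated by the Schwartz seminorms.\<close>

definition tempered_distribution :: "((real^'n \<Rightarrow> complex) \<Rightarrow> complex) \<Rightarrow> bool" where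
  "tempered_distribution T \<longleftrightarrow>
     (\<forall>\<phi> \<psi>. schwartz \<phi> \<longrightarrow> schwartz \<psi> \<longrightarrow> T (\<lambda>x. \<phi> x + \<psi> x) = T \<phi> + T \<psi>) \<and>
     (\<forall>c \<phi>. schwartz \<phi> \<longrightarrow> T (\<lambda>x. c * \<phi> x) = c * T \<phi>) \<and>
     (\<exists>C m. \<forall>\<phi>. schwartz \<phi> \<longrightarrow>
        cmod (T \<phi>) \<le> C * (\<Sum>is | length is \<le> m. schwartz_seminorm m is \<phi>))"

definition function_distribution :: "(real^'n \<Rightarrow> real) \<Rightarrow> (real^'n \<Rightarrow> complex) \<Rightarrow> complex" where
  "function_distribution g \<phi> = (LINT x|lborel. complex_of_real (g x) * \<phi> x)"

definition fourier_transform :: "(real^'n \<Rightarrow> complex) \<Rightarrow> real^'n \<Rightarrow> complex" where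
  "fourier_transform \<phi> \<xi> = (LINT x|lborel. \<phi> x * exp (- \<i> * complex_of_real (x \<bullet> \<xi>)))"

definition convolution :: "(real^'n \<Rightarrow> complex) \<Rightarrow> (real^'n \<Rightarrow> complex) \<Rightarrow> real^'n \<Rightarrow> complex" where
  "convolution \<phi> \<psi> x = (LINT y|lborel. \<phi> y * \<psi> (x - y))"

definition positive_definite_distribution :: "((real^'n \<Rightarrow> complex) \<Rightarrow> complex) \<Rightarrow> bool" where
  "positive_definite_distribution T \<longleftrightarrow>
     tempered_distribution T \<and>
     (\<forall>\<phi>. schwartz \<phi> \<longrightarrow> T (convolution \<phi> (\<lambda>x. cnj (\<phi> (- x)))) \<in> \<real>\<^sub>\<ge>\<^sub>0)"

text \<open>The value of \<open>powr\<close> at base \<open>0\<close>, which is \<open>0\<close> by convention, only affects the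
  integrands below on null sets.\<close>

definition embeds_in_L_neg :: "(real^'n \<Rightarrow> real) \<Rightarrow> real \<Rightarrow> bool" where
  "embeds_in_L_neg N p \<longleftrightarrow>
     (\<exists>\<gamma> :: (real^'n) measure.
        sets \<gamma> = sets (restrict_space borel (sphere 0 1)) \<and>
        finite_measure \<gamma> \<and>
        (\<forall>A \<in> sets \<gamma>. emeasure \<gamma> (uminus ` A) = emeasure \<gamma> A) \<and>
        (\<forall>\<phi>. schwartz \<phi> \<longrightarrow>
           (LINT x|lborel. complex_of_real (N x powr (- p)) * \<phi> x) =
           (LINT \<xi>|\<gamma>. (LINT t|lborel.
              complex_of_real (\<bar>t\<bar> powr (p - 1)) * fourier_transform \<phi> (t *\<^sub>R \<xi>)))))"

end

(* The measure is a limit of explicit ones. Write w = N powr (-p) and let f be the Fourier transform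
   of w times a Gaussian. Testing positive definiteness on modulated Gaussians alone gives f >= 0.
   Fourier inversion and the homogeneity of w express the integral of w(x) gauss(s x) phi(x) by the
   integral of f(xi) times the transform of phi at s xi. Averaging over s against |s|^(e-1) turns the
   left side into the pairing of w |x|^(-e) with phi and, by one-dimensional substitutions (no polar
   coordinates are needed), the right side into a ray integral of exponent p + e against the image
   of f |xi|^(-p-e) on the sphere. So w |x|^(-e) embeds in L_{-(p+e)}, and e tends to 0
   by weak compactness of probability measures on the sphere. That compactness is reduced to Helly's
   theorem on the line by a space-filling curve and a Borel section of it.
   Conversely, the embedding turns the value on phi * cnj phi(-x) into an integral of the
   squared modulus of the transform of phi. *)

theory Submission
  imports "HOL-Probability.Probability" Defs
begin

subsection \<open>Lebesgue integration on Euclidean space\<close>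

text \<open>Since w decays only like |x|^(-p) with p < n, it is not integrable and its transform has
  no pointwise values to test; the Gaussian factor makes the transform a bounded function f whose
  sign can be read off at each frequency. The dilations need no new functions: w(s x) = |s|^(-p)
  w(x) turns the transform of w(x) gauss(s x) into a rescaled copy of the same f. The loss e is
  forced. With e = 0 the average of gauss(s x) against ds/|s| diverges at s = 0, and f |xi|^(-p)
  fails to be integrable; any e > 0 cures this, while p + e < n keeps w |x|^(-e) locally integrable.
  The e-th Gaussian moment blows up as e tends to 0, so the behaviour of the total masses cannot be
  read off their definition. It is found by testing with the Gaussian itself, whose ray integral is
  constant on the sphere: the masses converge, and compactness is needed for probability measures
  only. Symmetry is imposed at the end by averaging with the antipodal map, which ray integrals do
  not notice.\<close>

lemma Basis_real_vec: "(Basis :: (real^'n) set) = range (\<lambda>i. axis i 1)"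
  by (auto simp: Basis_vec_def)

lemma AE_lborel_nonzeroI:
  fixes P :: "'a::euclidean_space \<Rightarrow> bool"
  assumes "\<And>x. x \<noteq> 0 \<Longrightarrow> P x"
  shows "AE x in lborel. P x"
  using AE_lborel_singleton[of 0] by eventually_elim (rule assms)

text \<open>\<open>lborel_eq\<close> presents Lebesgue measure as the image of a product measure
  indexed by basis vectors, so Fubini for finite products applies once each coordinate i is matched
  with \<open>axis i 1\<close>.\<close>

lemma has_bochner_integral_lborel_prod:
  fixes f :: "'n::finite \<Rightarrow> real \<Rightarrow> 'b::{real_normed_field,banach,second_countable_topology}"
  assumes f: "\<And>i. integrable lborel (f i)"
  shows "has_bochner_integral lborel (\<lambda>x::real^'n. \<Prod>i\<in>UNIV. f i (x $ i))
           (\<Prod>i\<in>UNIV. integral\<^sup>L lborel (f i))"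
proof -
  interpret product_sigma_finite "\<lambda>_::real^'n. lborel :: real measure" ..
  define g where "g b = f (axis_index b)" for b :: "real^'n"
  have [measurable]: "f i \<in> borel_measurable borel" for i
    using borel_measurable_integrable[OF f[of i]] by simp
  have inj: "inj_on (\<lambda>i::'n. axis i (1::real)) UNIV"
    by (auto simp: inj_on_def axis_eq_axis)
  have re: "(\<Prod>b\<in>Basis. h b) = (\<Prod>i\<in>UNIV. h (axis i 1))" for h :: "real^'n \<Rightarrow> 'b"
    unfolding Basis_real_vec by (subst prod.reindex[OF inj]) simp
  have co: "(\<Sum>b\<in>Basis. x b *\<^sub>R b) $ i = x (axis i 1)" for x :: "real^'n \<Rightarrow> real" and i
  proof -
    have "(\<Sum>b\<in>Basis. x b *\<^sub>R b) $ i = (\<Sum>b\<in>Basis. x b *\<^sub>R b) \<bullet> axis i 1"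
      by (simp add: cart_eq_inner_axis)
    also have "\<dots> = x (axis i 1)"
      by (subst inner_sum_left_Basis) auto
    finally show ?thesis .
  qed
  have gi: "integrable lborel (g b)" for b unfolding g_def by (rule f)
  have 1: "integrable (\<Pi>\<^sub>M b\<in>Basis. lborel) (\<lambda>x::(real^'n)\<Rightarrow>real. \<Prod>b\<in>Basis. g b (x b))"
    by (rule product_integrable_prod) (auto intro: gi)
  have 2: "(\<integral>x. (\<Prod>b\<in>Basis. g b (x b)) \<partial>(\<Pi>\<^sub>M b\<in>Basis. lborel)) = (\<Prod>b\<in>Basis. integral\<^sup>L lborel (g b))"
    by (rule product_integral_prod) (auto intro: gi)
  have eq: "(\<lambda>x::(real^'n)\<Rightarrow>real. \<Prod>i\<in>UNIV. f i ((\<Sum>b\<in>Basis. x b *\<^sub>R b) $ i)) = (\<lambda>x. \<Prod>b\<in>Basis. g b (x b))"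
    by (rule ext) (simp only: re co g_def axis_index_axis)
  have 3: "(\<Prod>i\<in>UNIV. integral\<^sup>L lborel (f i)) = (\<Prod>b\<in>Basis. integral\<^sup>L lborel (g b))"
    by (simp only: re, simp add: g_def axis_index_axis)
  have m: "(\<lambda>x. \<Sum>b\<in>Basis. x b *\<^sub>R b) \<in> (\<Pi>\<^sub>M b\<in>Basis. lborel) \<rightarrow>\<^sub>M (borel :: (real^'n) measure)"
    by measurable
  have "has_bochner_integral (distr (\<Pi>\<^sub>M b\<in>Basis. lborel) borel (\<lambda>x. \<Sum>b\<in>Basis. x b *\<^sub>R b)) (\<lambda>x::real^'n. \<Prod>i\<in>UNIV. f i (x $ i))
           (\<Prod>i\<in>UNIV. integral\<^sup>L lborel (f i))"
    unfolding has_bochner_integral_iff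
    using 1 2 by (auto simp: integrable_distr_eq[OF m] integral_distr[OF m] eq 3 simp del: sum_component)
  then show ?thesis
    by (subst lborel_eq)
qed

lemma lborel_integral_affine:
  fixes g :: "'a::euclidean_space \<Rightarrow> 'b::{banach, second_countable_topology}"
  assumes "c \<noteq> 0" and [measurable]: "g \<in> borel_measurable borel"
  shows "integrable lborel (\<lambda>x. g (t + c *\<^sub>R x)) \<longleftrightarrow> integrable lborel g"
    and "(LINT x|lborel. g (t + c *\<^sub>R x)) = (LINT x|lborel. g x) /\<^sub>R \<bar>c\<bar> ^ DIM('a)"
proof -
  have L: "lborel = density (distr lborel borel (\<lambda>x::'a. t + c *\<^sub>R x)) (\<lambda>_. ennreal (\<bar>c\<bar>^DIM('a)))"
    using lborel_affine[OF assms(1), of t] by (simp add: ennreal_power)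
  have "integrable lborel g \<longleftrightarrow> integrable lborel (\<lambda>x. \<bar>c\<bar>^DIM('a) *\<^sub>R g (t + c *\<^sub>R x))"
    by (subst L) (simp add: integrable_density integrable_distr_eq)
  also have "\<dots> \<longleftrightarrow> integrable lborel (\<lambda>x. g (t + c *\<^sub>R x))"
    using assms(1) integrable_scaleR_right[of "inverse (\<bar>c\<bar>^DIM('a))" lborel "\<lambda>x. \<bar>c\<bar>^DIM('a) *\<^sub>R g (t + c *\<^sub>R x)"]
      integrable_scaleR_right[of "\<bar>c\<bar>^DIM('a)" lborel "\<lambda>x. g (t + c *\<^sub>R x)"] by auto
  finally show "integrable lborel (\<lambda>x. g (t + c *\<^sub>R x)) \<longleftrightarrow> integrable lborel g" ..
  have "(LINT x|lborel. g x) = (LINT x|lborel. \<bar>c\<bar>^DIM('a) *\<^sub>R g (t + c *\<^sub>R x))"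
    by (subst L) (simp add: integral_density integral_distr)
  then show "(LINT x|lborel. g (t + c *\<^sub>R x)) = (LINT x|lborel. g x) /\<^sub>R \<bar>c\<bar> ^ DIM('a)"
    using assms(1) by simp
qed

lemma lborel_nn_integral_affine:
  fixes g :: "'a::euclidean_space \<Rightarrow> ennreal"
  assumes "c \<noteq> 0" and [measurable]: "g \<in> borel_measurable borel"
  shows "(\<integral>\<^sup>+x. g x \<partial>lborel) = ennreal (\<bar>c\<bar> ^ DIM('a)) * (\<integral>\<^sup>+x. g (t + c *\<^sub>R x) \<partial>lborel)"
proof -
  have L: "lborel = density (distr lborel borel (\<lambda>x::'a. t + c *\<^sub>R x)) (\<lambda>_. ennreal (\<bar>c\<bar>^DIM('a)))"
    using lborel_affine[OF assms(1), of t] by (simp add: ennreal_power)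
  show ?thesis
    by (subst L) (simp add: nn_integral_density nn_integral_distr nn_integral_cmult)
qed

lemma lborel_swap_integrals:
  fixes g :: "'a::euclidean_space \<Rightarrow> 'c::euclidean_space \<Rightarrow> 'b::{banach, second_countable_topology}"
  assumes [measurable]: "(\<lambda>(x,y). g x y) \<in> borel_measurable (borel \<Otimes>\<^sub>M borel)"
    and "(\<integral>\<^sup>+x. \<integral>\<^sup>+y. ennreal (norm (g x y)) \<partial>lborel \<partial>lborel) < \<infinity>"
  shows "(LINT x|lborel. LINT y|lborel. g x y) = (LINT y|lborel. LINT x|lborel. g x y)"
    and "integrable lborel (\<lambda>x. LINT y|lborel. g x y)"
    and "integrable lborel (\<lambda>y. LINT x|lborel. g x y)"
proof -
  have i: "integrable (lborel \<Otimes>\<^sub>M lborel) (\<lambda>(x,y). g x y)"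
  proof (rule integrableI_bounded)
    show "(\<lambda>(x, y). g x y) \<in> borel_measurable (lborel \<Otimes>\<^sub>M lborel)" by measurable
    have "(\<integral>\<^sup>+ p. ennreal (norm (case p of (x, y) \<Rightarrow> g x y)) \<partial>(lborel \<Otimes>\<^sub>M lborel))
       = (\<integral>\<^sup>+x. \<integral>\<^sup>+y. ennreal (norm (g x y)) \<partial>lborel \<partial>lborel)"
      by (subst lborel.nn_integral_fst[symmetric]) auto
    then show "(\<integral>\<^sup>+ p. ennreal (norm (case p of (x, y) \<Rightarrow> g x y)) \<partial>(lborel \<Otimes>\<^sub>M lborel)) < \<infinity>"
      using assms(2) by simp
  qed
  show "(LINT x|lborel. LINT y|lborel. g x y) = (LINT y|lborel. LINT x|lborel. g x y)"
    by (rule lborel_pair.Fubini_integral[OF i, symmetric])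
  show "integrable lborel (\<lambda>x. LINT y|lborel. g x y)"
    by (rule lborel_pair.integrable_fst[OF i])
  show "integrable lborel (\<lambda>y. LINT x|lborel. g x y)"
    by (rule lborel_pair.integrable_snd[OF i])
qed

lemma lborel_swap_integrals_dominated:
  fixes g :: "'a::euclidean_space \<Rightarrow> 'c::euclidean_space \<Rightarrow> 'b::{banach, second_countable_topology}"
  assumes m: "(\<lambda>(x,y). g x y) \<in> borel_measurable (borel \<Otimes>\<^sub>M borel)"
    and a: "integrable lborel a" and b: "integrable lborel b"
    and le: "\<And>x y. norm (g x y) \<le> a x * b y"
  shows "(LINT x|lborel. LINT y|lborel. g x y) = (LINT y|lborel. LINT x|lborel. g x y)"
    and "integrable lborel (\<lambda>x. LINT y|lborel. g x y)"
    and "integrable lborel (\<lambda>y. LINT x|lborel. g x y)"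
proof -
  have [measurable]: "a \<in> borel_measurable borel" "b \<in> borel_measurable borel"
    using a b by auto
  have fin: "(\<integral>\<^sup>+x. ennreal \<bar>a x\<bar> \<partial>lborel) < \<infinity>" "(\<integral>\<^sup>+x. ennreal \<bar>b x\<bar> \<partial>lborel) < \<infinity>"
    using a b by (auto simp: integrable_iff_bounded)
  have "(\<integral>\<^sup>+x. \<integral>\<^sup>+y. ennreal (norm (g x y)) \<partial>lborel \<partial>lborel) \<le>
     (\<integral>\<^sup>+x. \<integral>\<^sup>+y. ennreal \<bar>a x\<bar> * ennreal \<bar>b y\<bar> \<partial>lborel \<partial>lborel)"
    by (intro nn_integral_mono)
      (metis abs_ge_self abs_ge_zero abs_mult ennreal_leI ennreal_mult le order_trans)
  also have "\<dots> = (\<integral>\<^sup>+x. ennreal \<bar>a x\<bar> \<partial>lborel) * (\<integral>\<^sup>+x. ennreal \<bar>b x\<bar> \<partial>lborel)"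
    by (simp add: nn_integral_cmult nn_integral_multc)
  also have "\<dots> < \<infinity>" using fin by (simp add: ennreal_mult_less_top)
  finally have "(\<integral>\<^sup>+x. \<integral>\<^sup>+y. ennreal (norm (g x y)) \<partial>lborel \<partial>lborel) < \<infinity>" .
  from lborel_swap_integrals[OF m this]
  show "(LINT x|lborel. LINT y|lborel. g x y) = (LINT y|lborel. LINT x|lborel. g x y)"
    "integrable lborel (\<lambda>x. LINT y|lborel. g x y)"
    "integrable lborel (\<lambda>y. LINT x|lborel. g x y)" by auto
qed

lemma one_plus_norm_le_prod:
  fixes x :: "real^'n"
  shows "(\<Prod>i\<in>UNIV. 1 + (x $ i)\<^sup>2) \<le> (1 + norm x) ^ (2 * CARD('n))"
proof -
  have "1 + (x $ i)\<^sup>2 \<le> (1 + norm x)\<^sup>2" for i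
  proof -
    have "(x $ i)\<^sup>2 \<le> (norm x)\<^sup>2"
      using component_le_norm_cart[of x i] by (metis abs_le_square_iff abs_norm_cancel)
    then show ?thesis using norm_ge_zero[of x] by (auto simp: power2_sum intro: order_trans)
  qed
  then have "(\<Prod>i\<in>UNIV. 1 + (x $ i)\<^sup>2) \<le> (\<Prod>i\<in>(UNIV::'n set). (1 + norm x)\<^sup>2)"
    by (intro prod_mono) auto
  also have "\<dots> = (1 + norm x) ^ (2 * CARD('n))"
    by (simp add: power_mult)
  finally show ?thesis .
qed

text \<open>Comparison with a product of Cauchy kernels \<open>inverse (1 + t^2)\<close>, one per
  coordinate, replaces radial integration. Each factor costs two powers of
  \<open>1 + norm x\<close>, whence the exponent \<open>2 * CARD('n)\<close> that reappears in the
  majorants below.\<close>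

lemma integrable_inverse_power_norm:
  "integrable lborel (\<lambda>x::real^'n. 1 / (1 + norm x) ^ (2 * CARD('n)))"
proof (rule Bochner_Integration.integrable_bound)
  have "integrable lborel (\<lambda>x::real. inverse (1 + x^2))"
    using integrable_inverse_1_plus_square by (simp add: set_integrable_def einterval_def)
  then show "integrable lborel (\<lambda>x::real^'n. \<Prod>i\<in>UNIV. inverse (1 + (x $ i)\<^sup>2))"
    using has_bochner_integral_lborel_prod[of "\<lambda>_ x. inverse (1 + x^2)"]
    by (auto simp: has_bochner_integral_iff)
  show "AE x in lborel. norm (1 / (1 + norm x) ^ (2 * CARD('n))) \<le> norm (\<Prod>i\<in>UNIV. inverse (1 + ((x::real^'n) $ i)\<^sup>2))"
  proof (rule AE_I2)
    fix x :: "real^'n"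
    have "0 < (\<Prod>i\<in>UNIV. 1 + (x $ i)\<^sup>2)"
      by (intro prod_pos) (auto simp: add_pos_nonneg)
    then have "1 / (1 + norm x) ^ (2 * CARD('n)) \<le> 1 / (\<Prod>i\<in>UNIV. 1 + (x $ i)\<^sup>2)"
      by (intro divide_left_mono one_plus_norm_le_prod) (auto simp: add_pos_nonneg)
    then show "norm (1 / (1 + norm x) ^ (2 * CARD('n))) \<le> norm (\<Prod>i\<in>UNIV. inverse (1 + (x $ i)\<^sup>2))"
      using \<open>0 < (\<Prod>i\<in>UNIV. 1 + (x $ i)\<^sup>2)\<close> by (simp add: prod_inversef[symmetric] divide_inverse comp_def)
  qed
qed auto

lemma integrable_rapid_decay:
  fixes f :: "real^'n \<Rightarrow> 'b::{banach, second_countable_topology}"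
  assumes [measurable]: "f \<in> borel_measurable borel"
    and b: "\<And>x. (1 + norm x) ^ (2 * CARD('n)) * norm (f x) \<le> C"
  shows "integrable lborel f"
proof (rule Bochner_Integration.integrable_bound)
  show "integrable lborel (\<lambda>x::real^'n. C * (1 / (1 + norm x) ^ (2 * CARD('n))))"
    by (intro integrable_mult_right integrable_inverse_power_norm)
  show "AE x in lborel. norm (f x) \<le> norm (C * (1 / (1 + norm x) ^ (2 * CARD('n))))"
  proof (rule AE_I2)
    fix x :: "real^'n"
    have "0 < (1 + norm x) ^ (2 * CARD('n))" by (simp add: add_pos_nonneg)
    then have "norm (f x) \<le> C * (1 / (1 + norm x) ^ (2 * CARD('n)))"
      using b[of x] by (simp add: field_simps)
    then show "norm (f x) \<le> norm (C * (1 / (1 + norm x) ^ (2 * CARD('n))))"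
      by (metis abs_ge_self order_trans real_norm_def)
  qed
qed auto

subsection \<open>Gaussian functions and singular weights\<close>

text \<open>Unit variance makes the Fourier transform a constant multiple of the function itself, so
  the same Gaussian appears on both sides of the Parseval identities.\<close>

definition gauss :: "real^'n \<Rightarrow> real" where
  "gauss x = exp (- (norm x)\<^sup>2 / 2)"

lemma gauss_measurable [measurable]: "gauss \<in> borel_measurable borel"
  unfolding gauss_def by measurable

lemma gauss_pos [simp]: "0 < gauss x" and gauss_le_1: "gauss x \<le> 1" and gauss_zero [simp]: "gauss 0 = 1"
  by (auto simp: gauss_def)

lemma abs_gauss [simp]: "\<bar>gauss x\<bar> = gauss x"
  by (simp add: gauss_def)

lemma norm_sq_vec: "(norm (x::real^'n))\<^sup>2 = (\<Sum>i\<in>UNIV. (x $ i)\<^sup>2)"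
  by (simp add: norm_vec_def L2_set_def sum_nonneg)

lemma fourier_std_normal:
  "(LINT x|lborel. complex_of_real (exp (- x\<^sup>2 / 2)) * exp (- \<i> * complex_of_real (x * t)))
     = complex_of_real (sqrt (2 * pi) * exp (- t\<^sup>2 / 2))"
  and integrable_std_normal: 
  "integrable lborel (\<lambda>x. complex_of_real (exp (- x\<^sup>2 / 2)) * exp (- \<i> * complex_of_real (x * t)))"
proof -
  have e: "std_normal_density x *\<^sub>R iexp (- t * x) = 
     (1 / complex_of_real (sqrt (2*pi))) * (complex_of_real (exp (- x\<^sup>2 / 2)) * exp (- \<i> * complex_of_real (x * t)))" for x
    by (simp add: std_normal_density_def scaleR_conv_of_real mult_ac)
  have "integrable lborel (\<lambda>x. complex_of_real (exp (- x\<^sup>2 / 2)))"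
    using integrable_normal_density[of 1 0] integrable_mult_right[of "sqrt (2*pi)" lborel std_normal_density]
    unfolding std_normal_density_def by (auto simp: complex_of_real_integrable_eq)
  then show "integrable lborel (\<lambda>x. complex_of_real (exp (- x\<^sup>2 / 2)) * exp (- \<i> * complex_of_real (x * t)))"
    by (rule Bochner_Integration.integrable_bound) (auto simp: norm_mult norm_exp_eq_Re)
  \<comment> \<open>The characteristic function has the kernel exp (i t x), so it is taken at -t;
    the factor 1 / sqrt (2 pi) of the normal density is carried to the other side.\<close>
  have "complex_of_real (exp (- (t\<^sup>2) / 2)) = char std_normal_distribution (- t)"
    by (simp add: char_std_normal_distribution)
  also have "\<dots> = (LINT x|lborel. std_normal_density x *\<^sub>R iexp (- t * x))"
    unfolding char_def by (subst integral_density) (auto simp: normal_density_nonneg)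
  also have "\<dots> = (1 / complex_of_real (sqrt (2*pi))) * 
     (LINT x|lborel. complex_of_real (exp (- x\<^sup>2 / 2)) * exp (- \<i> * complex_of_real (x * t)))"
    unfolding e by simp
  finally show "(LINT x|lborel. complex_of_real (exp (- x\<^sup>2 / 2)) * exp (- \<i> * complex_of_real (x * t)))
     = complex_of_real (sqrt (2 * pi) * exp (- t\<^sup>2 / 2))"
    by (simp add: field_simps)
qed

lemma has_bochner_integral_fourier_gauss:
  fixes \<xi> :: "real^'n"
  shows "has_bochner_integral lborel (\<lambda>x. complex_of_real (gauss x) * exp (- \<i> * complex_of_real (x \<bullet> \<xi>)))
           (complex_of_real (sqrt (2 * pi) ^ CARD('n) * gauss \<xi>))"
proof -
  have 1: "complex_of_real (gauss x) * exp (- \<i> * complex_of_real (x \<bullet> \<xi>)) =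
     (\<Prod>i\<in>UNIV. complex_of_real (exp (- (x$i)\<^sup>2 / 2)) * exp (- \<i> * complex_of_real (x$i * \<xi>$i)))" for x
  proof -
    have "complex_of_real (gauss x) * exp (- \<i> * complex_of_real (x \<bullet> \<xi>)) =
      exp (\<Sum>i\<in>UNIV. complex_of_real (- (x$i)\<^sup>2 / 2) + (- \<i> * complex_of_real (x$i * \<xi>$i)))"
      unfolding gauss_def norm_sq_vec inner_vec_def exp_of_real[symmetric] mult_exp_exp
      by (simp only: sum.distrib sum_distrib_left sum_negf sum_divide_distrib of_real_sum of_real_add inner_real_def real_inner_1_right of_real_minus minus_divide_left[symmetric] of_real_divide of_real_numeral)
    then show ?thesis by (simp only: exp_sum finite exp_add exp_of_real)
  qed
  have 2: "complex_of_real (sqrt (2 * pi) ^ CARD('n) * gauss \<xi>) = 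
     (\<Prod>i\<in>UNIV. complex_of_real (sqrt (2 * pi) * exp (- (\<xi>$i)\<^sup>2 / 2)))"
    unfolding gauss_def norm_sq_vec 
    by (simp only: sum_divide_distrib sum_negf[symmetric] exp_sum finite of_real_prod of_real_mult prod.distrib
      prod_constant of_real_power)
  show ?thesis
    unfolding 1 2 fourier_std_normal[symmetric]
    by (rule has_bochner_integral_lborel_prod) (rule integrable_std_normal)
qed

lemma fourier_gauss:
  "fourier_transform (\<lambda>x. complex_of_real (gauss x)) \<xi> = complex_of_real (sqrt (2 * pi) ^ CARD('n) * gauss (\<xi>::real^'n))"
  using has_bochner_integral_fourier_gauss[of \<xi>] by (simp add: fourier_transform_def has_bochner_integral_iff)

lemma integrable_gauss [simp]: "integrable lborel (gauss :: real^'n \<Rightarrow> real)"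
  and integral_gauss: "(LINT x|lborel. gauss (x::real^'n)) = sqrt (2 * pi) ^ CARD('n)"
proof -
  have "has_bochner_integral lborel (\<lambda>x. complex_of_real (gauss (x::real^'n))) (complex_of_real (sqrt (2 * pi) ^ CARD('n)))"
    using has_bochner_integral_fourier_gauss[of 0] by simp
  then show "integrable lborel (gauss :: real^'n \<Rightarrow> real)" "(LINT x|lborel. gauss (x::real^'n)) = sqrt (2 * pi) ^ CARD('n)"
    by (simp_all add: has_bochner_integral_iff complex_of_real_integrable_eq) (metis of_real_eq_iff of_real_power)
qed

section \<open>One-dimensional integrals against powers of |t|\<close>

lemma integrable_abs_powr_decay:
  fixes a m :: real
  assumes a: "0 < a" and m: "a < m"
  shows "integrable lborel (\<lambda>t::real. \<bar>t\<bar> powr (a - 1) * (1 + \<bar>t\<bar>) powr (- m))"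
proof -
  have i1: "set_integrable lborel {0..1} (\<lambda>t::real. t powr (a - 1))"
  proof -
    have "(\<lambda>t::real. t powr (a - 1)) absolutely_integrable_on {0..1}"
      by (intro nonnegative_absolutely_integrable_1 integrable_on_powr_from_0) (use a in auto)
    then show ?thesis unfolding set_integrable_def by (subst (asm) integrable_completion) auto
  qed
  have i2: "set_integrable lborel {1..} (\<lambda>t::real. t powr (a - 1 - m))"
  proof -
    have "(\<lambda>t::real. t powr (a - 1 - m)) absolutely_integrable_on {1..}"
      using has_integral_powr_to_inf[of "a - 1 - m" 1] m
      by (intro nonnegative_absolutely_integrable_1) (auto simp: integrable_on_def)
    then show ?thesis unfolding set_integrable_def by (subst (asm) integrable_completion) auto
  qed
  \<comment> \<open>\<open>h\<close> majorises the integrand on the half-line: t^(a-1) is integrable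
    at 0 because a > 0, and t^(a-1-m) at infinity because a < m. Adding its reflection covers the
    negative half-line.\<close>
  define h where "h t = indicator {0..1} t *\<^sub>R t powr (a - 1) + indicator {1..} t *\<^sub>R t powr (a - 1 - m)" for t :: real
  have h: "integrable lborel h"
    unfolding h_def using i1 i2 by (intro Bochner_Integration.integrable_add) (auto simp: set_integrable_def)
  have h': "integrable lborel (\<lambda>t. h (- t))"
    using lborel_integrable_real_affine[OF h, of "-1" 0] by simp
  show ?thesis
  proof (rule Bochner_Integration.integrable_bound)
    show "integrable lborel (\<lambda>t. h t + h (- t))" using h h' by simp
    have pos: "0 \<le> h t" for t by (simp add: h_def indicator_def)
    have le: "t powr (a - 1) * (1 + t) powr (- m) \<le> h t" if "0 \<le> t" for t
    proof (cases "t \<le> 1")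
      case True
      have "(1 + t) powr (- m) \<le> 1"
        using that a m by (simp add: powr_minus inverse_le_1_iff ge_one_powr_ge_zero)
      then have "t powr (a - 1) * (1 + t) powr (- m) \<le> t powr (a - 1)"
        by (simp add: mult_left_le)
      also have "\<dots> \<le> h t" using True that by (simp add: h_def indicator_def)
      finally show ?thesis .
    next
      case False
      have "(1 + t) powr (- m) \<le> t powr (- m)"
        using False a m by (intro powr_mono2') auto
      then have "t powr (a - 1) * (1 + t) powr (- m) \<le> t powr (a - 1) * t powr (- m)"
        by (simp add: mult_left_mono)
      then show ?thesis using False by (simp add: h_def indicator_def powr_add[symmetric])
    qed
    show "AE t in lborel. norm (\<bar>t\<bar> powr (a - 1) * (1 + \<bar>t\<bar>) powr (- m)) \<le> norm (h t + h (- t))"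
    proof (rule AE_I2)
      fix t :: real
      have "\<bar>t\<bar> powr (a - 1) * (1 + \<bar>t\<bar>) powr (- m) \<le> h \<bar>t\<bar>" by (rule le) simp
      also have "\<dots> \<le> h t + h (- t)" using pos[of t] pos[of "-t"] by (cases "t \<ge> 0") auto
      finally show "norm (\<bar>t\<bar> powr (a - 1) * (1 + \<bar>t\<bar>) powr (- m)) \<le> norm (h t + h (- t))"
        using pos[of t] pos[of "-t"] by simp
    qed
  qed auto
qed

text \<open>Substitution t = s r. The measure |s|^(a-1) ds is homogeneous of degree a, so
  integrating any profile over its dilations produces the power |r|^(-a).\<close>

lemma nn_integral_homogeneous_scale:
  fixes a r :: real and g :: "real \<Rightarrow> ennreal"
  assumes "r \<noteq> 0" and [measurable]: "g \<in> borel_measurable borel"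
  shows "(\<integral>\<^sup>+s. ennreal (\<bar>s\<bar> powr (a - 1)) * g (s * r) \<partial>lborel)
     = ennreal (\<bar>r\<bar> powr (- a)) * (\<integral>\<^sup>+t. ennreal (\<bar>t\<bar> powr (a - 1)) * g t \<partial>lborel)"
proof -
  have "\<bar>r\<bar> powr (- a) * \<bar>r\<bar> * (\<bar>r\<bar> powr (a - 1)) = \<bar>r\<bar> powr (- a + 1 + (a - 1))"
    using assms(1) by (simp only: powr_add powr_one abs_ge_zero)
  then have r: "\<bar>r\<bar> powr (- a) * \<bar>r\<bar> * (\<bar>r\<bar> powr (a - 1)) = 1"
    using assms(1) by simp
  have "(\<integral>\<^sup>+t. ennreal (\<bar>t\<bar> powr (a - 1)) * g t \<partial>lborel) = 
     ennreal \<bar>r\<bar> * (\<integral>\<^sup>+s. ennreal (\<bar>r * s\<bar> powr (a - 1)) * g (r * s) \<partial>lborel)"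
    using nn_integral_real_affine[of "\<lambda>t. ennreal (\<bar>t\<bar> powr (a - 1)) * g t" r 0] assms by simp
  also have "(\<integral>\<^sup>+s. ennreal (\<bar>r * s\<bar> powr (a - 1)) * g (r * s) \<partial>lborel) = 
    ennreal (\<bar>r\<bar> powr (a - 1)) * (\<integral>\<^sup>+s. ennreal (\<bar>s\<bar> powr (a - 1)) * g (s * r) \<partial>lborel)"
    by (subst nn_integral_cmult[symmetric]) (auto simp: abs_mult powr_mult ennreal_mult mult_ac)
  finally show ?thesis
    using r by (simp add: mult.assoc[symmetric] ennreal_mult[symmetric])
qed

lemma integral_homogeneous_scale:
  fixes a r :: real and g :: "real \<Rightarrow> complex"
  assumes "r \<noteq> 0"
  shows "(LINT s|lborel. complex_of_real (\<bar>s\<bar> powr (a - 1)) * g (s * r))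
     = complex_of_real (\<bar>r\<bar> powr (- a)) * (LINT t|lborel. complex_of_real (\<bar>t\<bar> powr (a - 1)) * g t)"
proof -
  have "\<bar>r\<bar> powr (- a) * \<bar>r\<bar> * (\<bar>r\<bar> powr (a - 1)) = \<bar>r\<bar> powr (- a + 1 + (a - 1))"
    using assms(1) by (simp only: powr_add powr_one abs_ge_zero)
  then have r: "\<bar>r\<bar> powr (- a) * \<bar>r\<bar> * (\<bar>r\<bar> powr (a - 1)) = 1"
    using assms(1) by simp
  have "(LINT t|lborel. complex_of_real (\<bar>t\<bar> powr (a - 1)) * g t) = 
     \<bar>r\<bar> *\<^sub>R (LINT s|lborel. complex_of_real (\<bar>r * s\<bar> powr (a - 1)) * g (r * s))"
    using lborel_integral_real_affine[of r "\<lambda>t. complex_of_real (\<bar>t\<bar> powr (a - 1)) * g t" 0] assms by simp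
  also have "(LINT s|lborel. complex_of_real (\<bar>r * s\<bar> powr (a - 1)) * g (r * s)) = 
    complex_of_real (\<bar>r\<bar> powr (a - 1)) * (LINT s|lborel. complex_of_real (\<bar>s\<bar> powr (a - 1)) * g (s * r))"
    by (subst integral_mult_right_zero[symmetric]) (auto simp: abs_mult powr_mult mult_ac)
  finally show ?thesis
    using r by (simp add: scaleR_conv_of_real mult.assoc[symmetric] flip: of_real_mult)
qed

lemma exp_square_le_powr_decay:
  assumes "0 \<le> m"
  obtains C where "0 < C" "\<And>t::real. exp (- t\<^sup>2 / 2) \<le> C * (1 + \<bar>t\<bar>) powr (- m)"
proof -
  have "((\<lambda>t::real. (1 + t) powr m * exp (- t\<^sup>2 / 2)) \<longlongrightarrow> 0) at_top"
    by real_asymp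
  then have "\<forall>\<^sub>F t in at_top. (1 + t) powr m * exp (- t\<^sup>2 / 2) < 1"
    by (rule order_tendstoD(2)) simp
  then obtain T where T: "\<And>t. t \<ge> T \<Longrightarrow> (1 + t) powr m * exp (- t\<^sup>2 / 2) < 1"
    unfolding eventually_at_top_linorder by blast
  define C where "C = max 1 ((1 + \<bar>T\<bar>) powr m)"
  have "exp (- t\<^sup>2 / 2) \<le> C * (1 + \<bar>t\<bar>) powr (- m)" for t :: real
  proof -
    have "(1 + \<bar>t\<bar>) powr m * exp (- \<bar>t\<bar>\<^sup>2 / 2) \<le> C"
    proof (cases "\<bar>t\<bar> \<ge> T")
      case True then show ?thesis using T[of "\<bar>t\<bar>"] by (simp add: C_def)
    next
      case False
      then have "(1 + \<bar>t\<bar>) powr m \<le> (1 + \<bar>T\<bar>) powr m" using assms by (intro powr_mono2) auto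
      moreover have "(1 + \<bar>t\<bar>) powr m * exp (- \<bar>t\<bar>\<^sup>2 / 2) \<le> (1 + \<bar>t\<bar>) powr m * 1"
        by (intro mult_left_mono) auto
      ultimately show ?thesis by (simp add: C_def)
    qed
    then show ?thesis by (simp add: powr_minus field_simps)
  qed
  then show ?thesis by (intro that[of C]) (auto simp: C_def)
qed

lemma integrable_abs_powr_gauss:
  assumes "0 < a"
  shows "integrable lborel (\<lambda>t::real. \<bar>t\<bar> powr (a - 1) * exp (- t\<^sup>2 / 2))"
proof -
  obtain C where C: "0 < C" "\<And>t::real. exp (- t\<^sup>2 / 2) \<le> C * (1 + \<bar>t\<bar>) powr (- (a + 1))"
    using exp_square_le_powr_decay[of "a + 1"] assms by auto
  show ?thesis
  proof (rule Bochner_Integration.integrable_bound)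
    show "integrable lborel (\<lambda>t::real. C * (\<bar>t\<bar> powr (a - 1) * (1 + \<bar>t\<bar>) powr (- (a + 1))))"
      by (intro integrable_mult_right integrable_abs_powr_decay) (use assms in auto)
    show "AE t in lborel. norm (\<bar>t\<bar> powr (a - 1) * exp (- t\<^sup>2 / 2)) \<le> 
        norm (C * (\<bar>t\<bar> powr (a - 1) * (1 + \<bar>t\<bar>) powr (- (a + 1))))"
      using C(1) mult_left_mono[OF C(2), of "\<bar>t\<bar> powr (a - 1)" for t]
      by (intro AE_I2) (simp add: mult_ac abs_mult)
  qed auto
qed

text \<open>This is 2^(a/2) Gamma(a/2) for a > 0, the constant left behind when Gaussians are
  averaged over dilations.\<close>

definition gauss_moment :: "real \<Rightarrow> real" where
  "gauss_moment a = (LINT t|lborel. \<bar>t\<bar> powr (a - 1) * exp (- t\<^sup>2 / 2))"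

lemma gauss_moment_pos:
  assumes "0 < a" shows "0 < gauss_moment a"
proof -
  have "gauss_moment a \<noteq> 0"
  proof
    assume "gauss_moment a = 0"
    then have "AE t in lborel. \<bar>t\<bar> powr (a - 1) * exp (- t\<^sup>2 / 2) = (0::real)"
      using integrable_abs_powr_gauss[OF assms] unfolding gauss_moment_def
      by (subst (asm) integral_nonneg_eq_0_iff_AE) auto
    moreover have "AE t in lborel. t \<noteq> (0::real)" by (rule AE_lborel_singleton)
    ultimately have "AE t in (lborel::real measure). False"
      by eventually_elim auto
    then show False
      using emeasure_eq_0_AE[of "\<lambda>_. True" "lborel :: real measure"] by simp
  qed
  moreover have "0 \<le> gauss_moment a" unfolding gauss_moment_def by simp
  ultimately show ?thesis by simp
qed

lemma nn_integral_gauss_moment: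
  assumes "0 < a"
  shows "(\<integral>\<^sup>+t. ennreal (\<bar>t\<bar> powr (a - 1)) * ennreal (exp (- t\<^sup>2 / 2)) \<partial>lborel) = ennreal (gauss_moment a)"
  unfolding gauss_moment_def
  by (subst nn_integral_eq_integral[symmetric, OF integrable_abs_powr_gauss[OF assms]])
     (use integrable_abs_powr_gauss[OF assms] in \<open>auto simp: ennreal_mult\<close>)

lemma nn_integral_gauss_dilation:
  assumes "r \<noteq> 0"
  shows "(\<integral>\<^sup>+x. ennreal (gauss (r *\<^sub>R (x::real^'n))) \<partial>lborel) = ennreal (sqrt (2 * pi) ^ CARD('n) / \<bar>r\<bar> ^ CARD('n))"
proof -
  have "ennreal (\<bar>r\<bar> ^ CARD('n)) * (\<integral>\<^sup>+x. ennreal (gauss (r *\<^sub>R (x::real^'n))) \<partial>lborel) = ennreal (sqrt (2 * pi) ^ CARD('n))"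
    using lborel_nn_integral_affine[OF assms, of "\<lambda>x::real^'n. ennreal (gauss x)" 0]
    by (simp add: nn_integral_eq_integral less_imp_le integral_gauss)
  then have "ennreal (1 / \<bar>r\<bar> ^ CARD('n)) * (ennreal (\<bar>r\<bar> ^ CARD('n)) * (\<integral>\<^sup>+x. ennreal (gauss (r *\<^sub>R (x::real^'n))) \<partial>lborel))
      = ennreal (1 / \<bar>r\<bar> ^ CARD('n)) * ennreal (sqrt (2 * pi) ^ CARD('n))" by simp
  then show ?thesis
    using assms by (simp add: mult.assoc[symmetric] ennreal_mult[symmetric])
qed

text \<open>Since \<open>norm x powr (- q)\<close> is a constant times the integral over \<open>s\<close> of
  \<open>\<bar>s\<bar> powr (q - 1) * gauss (s *\<^sub>R x)\<close>, Tonelli reduces the claim to one-dimensional integrals.\<close>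

lemma integrable_norm_powr_gauss:
  fixes q :: real
  assumes q: "0 < q" "q < real CARD('n)"
  shows "integrable lborel (\<lambda>x::real^'n. norm x powr (- q) * gauss x)"
proof (rule integrableI_bounded)
  let ?n = "CARD('n)"
  have "ennreal (gauss_moment q) * (\<integral>\<^sup>+x. ennreal (norm (x::real^'n) powr (- q) * gauss x) \<partial>lborel) =
     (\<integral>\<^sup>+x. ennreal (gauss_moment q) * ennreal (norm (x::real^'n) powr (- q) * gauss x) \<partial>lborel)"
    by (subst nn_integral_cmult) auto
  also have "\<dots> = (\<integral>\<^sup>+x. \<integral>\<^sup>+s. ennreal (\<bar>s\<bar> powr (q - 1)) * ennreal (gauss (sqrt (1 + s\<^sup>2) *\<^sub>R (x::real^'n))) \<partial>lborel \<partial>lborel)"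
  proof (rule nn_integral_cong_AE, rule AE_lborel_nonzeroI)
    fix x :: "real^'n" assume "x \<noteq> 0"
    have "(\<integral>\<^sup>+s. ennreal (\<bar>s\<bar> powr (q - 1)) * ennreal (gauss (sqrt (1 + s\<^sup>2) *\<^sub>R x)) \<partial>lborel)
       = (\<integral>\<^sup>+s. ennreal (gauss x) * (ennreal (\<bar>s\<bar> powr (q - 1)) * ennreal (exp (- (s * norm x)\<^sup>2 / 2))) \<partial>lborel)"
    proof (rule nn_integral_cong)
      fix s
      \<comment> \<open>The Gaussian times its dilate is again a single dilated Gaussian, so the
        integral over x becomes explicit after the exchange.\<close>
      have "gauss (sqrt (1 + s\<^sup>2) *\<^sub>R x) = gauss x * exp (- (s * norm x)\<^sup>2 / 2)"
        by (simp add: gauss_def power_mult_distrib exp_add[symmetric] field_simps)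
      then show "ennreal (\<bar>s\<bar> powr (q - 1)) * ennreal (gauss (sqrt (1 + s\<^sup>2) *\<^sub>R x)) = 
        ennreal (gauss x) * (ennreal (\<bar>s\<bar> powr (q - 1)) * ennreal (exp (- (s * norm x)\<^sup>2 / 2)))"
        by (simp add: ennreal_mult less_imp_le mult_ac)
    qed
    also have "\<dots> = ennreal (gauss x) * (ennreal (norm x powr (- q)) * ennreal (gauss_moment q))"
      using \<open>x \<noteq> 0\<close> q nn_integral_homogeneous_scale[of "norm x" "\<lambda>t. ennreal (exp (- t\<^sup>2 / 2))" q]
      by (simp add: nn_integral_cmult nn_integral_gauss_moment[OF q(1), simplified])
    finally show "ennreal (gauss_moment q) * ennreal (norm x powr (- q) * gauss x) = 
      (\<integral>\<^sup>+s. ennreal (\<bar>s\<bar> powr (q - 1)) * ennreal (gauss (sqrt (1 + s\<^sup>2) *\<^sub>R x)) \<partial>lborel)"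
      by (simp add: ennreal_mult less_imp_le mult_ac)
  qed
  also have "\<dots> = (\<integral>\<^sup>+s. \<integral>\<^sup>+x. ennreal (\<bar>s\<bar> powr (q - 1)) * ennreal (gauss (sqrt (1 + s\<^sup>2) *\<^sub>R (x::real^'n))) \<partial>lborel \<partial>lborel)"
    by (rule lborel_pair.Fubini'[symmetric]) measurable
  also have "\<dots> = (\<integral>\<^sup>+s. ennreal (\<bar>s\<bar> powr (q - 1)) * ennreal (sqrt (2 * pi) ^ ?n / (sqrt (1 + s\<^sup>2)) ^ ?n) \<partial>lborel)"
  proof (rule nn_integral_cong)
    fix s :: real
    have "0 < 1 + s\<^sup>2" by (simp add: add_pos_nonneg)
    then show "(\<integral>\<^sup>+x. ennreal (\<bar>s\<bar> powr (q - 1)) * ennreal (gauss (sqrt (1 + s\<^sup>2) *\<^sub>R (x::real^'n))) \<partial>lborel) = 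
      ennreal (\<bar>s\<bar> powr (q - 1)) * ennreal (sqrt (2 * pi) ^ ?n / (sqrt (1 + s\<^sup>2)) ^ ?n)"
      using nn_integral_gauss_dilation[of "sqrt (1 + s\<^sup>2)", where 'n='n] by (subst nn_integral_cmult) auto
  qed
  \<comment> \<open>The integrand behaves like |s|^(q-1-n) at infinity: q < n gives convergence
    there, and q > 0 at the origin.\<close>
  also have "\<dots> \<le> (\<integral>\<^sup>+s. ennreal (sqrt (2 * pi) ^ ?n * sqrt 2 ^ ?n * (\<bar>s\<bar> powr (q - 1) * (1 + \<bar>s\<bar>) powr (- real ?n))) \<partial>lborel)"
  proof (rule nn_integral_mono)
    fix s :: real
    have "(1 + \<bar>s\<bar>)\<^sup>2 \<le> 2 * (1 + s\<^sup>2)"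
      using sum_squares_ge_zero[of "1 - \<bar>s\<bar>" 0] by (simp add: power2_eq_square algebra_simps)
    then have "1 + \<bar>s\<bar> \<le> sqrt 2 * sqrt (1 + s\<^sup>2)"
      by (metis real_le_rsqrt real_sqrt_mult)
    then have "(1 + \<bar>s\<bar>) ^ ?n \<le> sqrt 2 ^ ?n * sqrt (1 + s\<^sup>2) ^ ?n"
      by (metis power_mono power_mult_distrib abs_ge_zero add_nonneg_nonneg zero_le_one)
    moreover have "0 < sqrt (1 + s\<^sup>2) ^ ?n" by (simp add: add_pos_nonneg)
    ultimately have "1 / sqrt (1 + s\<^sup>2) ^ ?n \<le> sqrt 2 ^ ?n * (1 + \<bar>s\<bar>) powr (- real ?n)"
      by (simp add: powr_minus powr_realpow add_pos_nonneg field_simps)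
    then have "\<bar>s\<bar> powr (q - 1) * sqrt (2 * pi) ^ ?n * (1 / sqrt (1 + s\<^sup>2) ^ ?n) \<le> 
       \<bar>s\<bar> powr (q - 1) * sqrt (2 * pi) ^ ?n * (sqrt 2 ^ ?n * (1 + \<bar>s\<bar>) powr (- real ?n))"
      by (intro mult_left_mono) auto
    then show "ennreal (\<bar>s\<bar> powr (q - 1)) * ennreal (sqrt (2 * pi) ^ ?n / (sqrt (1 + s\<^sup>2)) ^ ?n)
      \<le> ennreal (sqrt (2 * pi) ^ ?n * sqrt 2 ^ ?n * (\<bar>s\<bar> powr (q - 1) * (1 + \<bar>s\<bar>) powr (- real ?n)))"
      by (subst ennreal_mult[symmetric]) (auto simp: mult_ac intro!: ennreal_leI)
  qed
  also have "\<dots> < \<infinity>"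
    by (subst nn_integral_eq_integral[OF integrable_mult_right[OF integrable_abs_powr_decay[OF q]]]) auto
  finally have "(\<integral>\<^sup>+x. ennreal (norm (x::real^'n) powr (- q) * gauss x) \<partial>lborel) < \<infinity>"
    using gauss_moment_pos[OF q(1)] by (auto simp: ennreal_mult_less_top)
  then show "(\<integral>\<^sup>+x. ennreal (norm (norm (x::real^'n) powr (- q) * gauss x)) \<partial>lborel) < \<infinity>"
    by (simp add: abs_mult)
qed auto

text \<open>On the unit ball the Gaussian is at least exp (-1/2), so the singularity is controlled
  by the Gaussian case; outside the ball the singular factor is at most 1.\<close>

lemma integrable_norm_powr_decay:
  fixes q :: real
  assumes q: "0 < q" "q < real CARD('n)"
  shows "integrable lborel (\<lambda>x::real^'n. norm x powr (- q) * (1 / (1 + norm x) ^ (2 * CARD('n))))"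
proof (rule Bochner_Integration.integrable_bound)
  show "integrable lborel (\<lambda>x::real^'n. exp (1/2) * (norm x powr (- q) * gauss x) + 1 / (1 + norm x) ^ (2 * CARD('n)))"
    by (intro Bochner_Integration.integrable_add integrable_mult_right integrable_norm_powr_gauss integrable_inverse_power_norm q)
  show "AE x in lborel. norm (norm (x::real^'n) powr (- q) * (1 / (1 + norm x) ^ (2 * CARD('n)))) \<le> 
    norm (exp (1/2) * (norm x powr (- q) * gauss x) + 1 / (1 + norm x) ^ (2 * CARD('n)))"
  proof (rule AE_I2)
    fix x :: "real^'n"
    have "norm x powr (- q) * (1 / (1 + norm x) ^ (2 * CARD('n))) \<le> exp (1/2) * (norm x powr (- q) * gauss x) + 1 / (1 + norm x) ^ (2 * CARD('n))"
    proof (cases "norm x \<le> 1")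
      case True
      then have "(norm x)\<^sup>2 \<le> 1" by (simp add: power_le_one)
      then have "1 \<le> exp (1/2) * gauss x" by (simp add: gauss_def exp_add[symmetric])
      then have "norm x powr (- q) * 1 \<le> norm x powr (- q) * (exp (1/2) * gauss x)" by (intro mult_left_mono) auto
      moreover have "1 / (1 + norm x) ^ (2 * CARD('n)) \<le> 1"
        using one_le_power[of "1 + norm x" "2 * CARD('n)"]
        by (subst divide_le_eq_1) (auto simp del: one_le_power)
      then have "norm x powr (- q) * (1 / (1 + norm x) ^ (2 * CARD('n))) \<le> norm x powr (- q) * 1"
        by (intro mult_left_mono) auto
      moreover have "0 \<le> 1 / (1 + norm x) ^ (2 * CARD('n))" by simp
      moreover have "norm x powr (- q) * (exp (1/2) * gauss x) = exp (1/2) * (norm x powr (- q) * gauss x)"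
        by simp
      ultimately show ?thesis by linarith
    next
      case False
      then have "norm x powr (- q) \<le> 1" using q by (simp add: powr_minus inverse_le_1_iff ge_one_powr_ge_zero)
      then have "norm x powr (- q) * (1 / (1 + norm x) ^ (2 * CARD('n))) \<le> 1 * (1 / (1 + norm x) ^ (2 * CARD('n)))"
        by (intro mult_right_mono) auto
      moreover have "0 \<le> exp (1/2) * (norm x powr (- q) * gauss x)" by (simp add: less_imp_le)
      ultimately show ?thesis by simp
    qed
    then show "norm (norm x powr (- q) * (1 / (1 + norm x) ^ (2 * CARD('n)))) \<le> 
    norm (exp (1/2) * (norm x powr (- q) * gauss x) + 1 / (1 + norm x) ^ (2 * CARD('n)))"
      by (simp add: abs_mult)
  qed
qed auto

subsection \<open>Schwartz functions\<close>

lemma iterated_partial_Nil [simp]: "iterated_partial [] f = f"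
  and iterated_partial_Cons: "iterated_partial (i # is) f = partial_derivative i (iterated_partial is f)"
  and iterated_partial_append: "iterated_partial (is @ js) f = iterated_partial is (iterated_partial js f)"
  by (simp_all add: iterated_partial_def)

lemma partial_derivative_eq:
  "(f has_derivative D) (at x) \<Longrightarrow> partial_derivative i f x = D (axis i 1)"
  unfolding partial_derivative_def by (metis frechet_derivative_at)

text \<open>No formula for higher derivatives is needed: if S is stable under one partial
  derivative, every iterated partial of f lies in S, and decay of the members of S is decay of all
  derivatives. Each application only has to exhibit such a class.\<close>

lemma schwartz_coinduct:
  assumes "f \<in> S"
    and "\<And>g x. g \<in> S \<Longrightarrow> g differentiable (at x)"
    and "\<And>g i. g \<in> S \<Longrightarrow> partial_derivative i g \<in> S"
    and "\<And>g k. g \<in> S \<Longrightarrow> \<exists>C. \<forall>x. (1 + norm x) ^ k * norm (g x) \<le> C"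
  shows "schwartz f"
proof -
  have S: "iterated_partial is f \<in> S" for "is"
    by (induction "is") (auto simp: assms iterated_partial_Cons)
  have "bounded (range (\<lambda>x. (1 + norm x) ^ k *\<^sub>R iterated_partial is f x))" for k "is"
  proof -
    obtain C where "\<forall>x. (1 + norm x) ^ k * norm (iterated_partial is f x) \<le> C"
      using assms(4)[OF S] by blast
    then show ?thesis
      by (auto simp: bounded_iff intro!: exI[of _ C])
  qed
  then show ?thesis
    using assms(2)[OF S] by (auto simp: schwartz_def)
qed

context
  fixes \<phi> :: "real^'n \<Rightarrow> complex"
  assumes \<phi>: "schwartz \<phi>"
begin

lemma schwartz_iterated: "schwartz (iterated_partial is \<phi>)"
  using \<phi> unfolding schwartz_def by (auto simp: iterated_partial_append[symmetric])

lemma schwartz_partial: "schwartz (partial_derivative i \<phi>)"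
  using schwartz_iterated[of "[i]"] by (simp add: iterated_partial_Cons)

lemma schwartz_bound:
  obtains C where "0 \<le> C" "\<And>x. (1 + norm x) ^ k * norm (iterated_partial is \<phi> x) \<le> C"
proof -
  have "bounded (range (\<lambda>x. (1 + norm x) ^ k *\<^sub>R iterated_partial is \<phi> x))"
    using \<phi> by (simp add: schwartz_def)
  then obtain C where C: "\<And>x. norm ((1 + norm x) ^ k *\<^sub>R iterated_partial is \<phi> x) \<le> C"
    unfolding bounded_iff by auto
  have "0 \<le> C" using C[of 0] norm_ge_zero order_trans by blast
  with C that show ?thesis by (simp add: norm_scaleR)
qed

lemma schwartz_decay:
  obtains C where "0 \<le> C" "\<And>x. (1 + norm x) ^ k * norm (\<phi> x) \<le> C"
  using schwartz_bound[of k "[]"] by auto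

lemma schwartz_has_derivative:
  "(\<phi> has_derivative (\<lambda>v. \<Sum>i\<in>UNIV. of_real (v $ i) * partial_derivative i \<phi> x)) (at x)"
proof -
  have "\<phi> differentiable (at x)"
    using \<phi> unfolding schwartz_def by (metis iterated_partial_Nil)
  then have d: "(\<phi> has_derivative frechet_derivative \<phi> (at x)) (at x)"
    by (simp add: frechet_derivative_works)
  then interpret bounded_linear "frechet_derivative \<phi> (at x)" by (rule has_derivative_bounded_linear)
  have "frechet_derivative \<phi> (at x) v = (\<Sum>i\<in>UNIV. of_real (v $ i) * partial_derivative i \<phi> x)" for v
  proof -
    have "frechet_derivative \<phi> (at x) v = frechet_derivative \<phi> (at x) (\<Sum>i\<in>UNIV. (v $ i) *\<^sub>R axis i 1)"
      using basis_expansion[of v] by (simp add: scalar_mult_eq_scaleR)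
    also have "\<dots> = (\<Sum>i\<in>UNIV. (v $ i) *\<^sub>R frechet_derivative \<phi> (at x) (axis i 1))"
      by (simp only: sum scaleR)
    also have "\<dots> = (\<Sum>i\<in>UNIV. of_real (v $ i) * partial_derivative i \<phi> x)"
      by (simp add: partial_derivative_def scaleR_conv_of_real)
    finally show ?thesis .
  qed
  then have "frechet_derivative \<phi> (at x) = (\<lambda>v. \<Sum>i\<in>UNIV. of_real (v $ i) * partial_derivative i \<phi> x)"
    by (rule ext)
  then show ?thesis using d by simp
qed

lemma schwartz_isCont: "isCont \<phi> x"
  using schwartz_has_derivative by (rule has_derivative_continuous)

lemma schwartz_continuous_on: "continuous_on A \<phi>"
  by (simp add: schwartz_isCont continuous_at_imp_continuous_on)

lemma schwartz_measurable: "\<phi> \<in> borel_measurable borel"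
  by (intro borel_measurable_continuous_onI schwartz_continuous_on)

lemma schwartz_weighted_integrable: "integrable lborel (\<lambda>x. (1 + norm x) ^ k * norm (\<phi> x))"
proof -
  obtain C where C: "\<And>x. (1 + norm x) ^ (2 * CARD('n) + k) * norm (\<phi> x) \<le> C"
    using schwartz_decay by blast
  show ?thesis
    by (rule integrable_rapid_decay[where C=C])
       (use schwartz_measurable C in \<open>auto simp: power_add abs_mult mult_ac\<close>)
qed

lemma schwartz_integrable: "integrable lborel \<phi>"
proof (rule integrable_norm_cancel)
  show "integrable lborel (\<lambda>x. norm (\<phi> x))"
    using schwartz_weighted_integrable[of 0] by simp
qed (use schwartz_measurable in simp)

text \<open>The partial derivatives are bounded on the whole convex space, so the mean value theorem
  applies. One constant bounds increments and differentials alike; together they dominate the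
  first-order remainder when a convolution is differentiated.\<close>

lemma schwartz_lipschitz:
  obtains L where "0 \<le> L" "\<And>x y. norm (\<phi> x - \<phi> y) \<le> L * norm (x - y)"
    "\<And>x v. norm (\<Sum>i\<in>UNIV. of_real (v $ i) * partial_derivative i \<phi> x) \<le> L * norm v"
proof -
  have "\<forall>i. \<exists>C. 0 \<le> C \<and> (\<forall>x. norm (partial_derivative i \<phi> x) \<le> C)"
  proof
    fix i
    obtain C where "0 \<le> C" "\<And>x. (1 + norm x) ^ 0 * norm (iterated_partial [i] \<phi> x) \<le> C"
      using schwartz_bound[of 0 "[i]"] by metis
    then show "\<exists>C. 0 \<le> C \<and> (\<forall>x. norm (partial_derivative i \<phi> x) \<le> C)"
      by (auto simp: iterated_partial_Cons)
  qed
  from choice[OF this]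
  obtain C where C: "\<And>i. 0 \<le> C i" "\<And>i x. norm (partial_derivative i \<phi> x) \<le> C i" by blast
  define L where "L = (\<Sum>i\<in>UNIV. C i)"
  have L0: "0 \<le> L" by (simp add: L_def sum_nonneg C)
  have D: "norm (\<Sum>i\<in>UNIV. of_real (v $ i) * partial_derivative i \<phi> x) \<le> L * norm v" for x v
  proof -
    have "norm (\<Sum>i\<in>UNIV. of_real (v $ i) * partial_derivative i \<phi> x) \<le> (\<Sum>i\<in>UNIV. norm v * C i)"
      by (rule sum_norm_le) (auto simp: norm_mult intro!: mult_mono C component_le_norm_cart)
    also have "\<dots> = L * norm v" by (simp add: L_def sum_distrib_right mult.commute[of "norm v"])
    finally show ?thesis .
  qed
  have "norm (\<phi> x - \<phi> y) \<le> L * norm (x - y)" for x y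
    by (rule differentiable_bound[OF convex_UNIV])
       (use schwartz_has_derivative D in \<open>auto intro!: onorm_bound L0\<close>)
  with L0 D that show ?thesis by blast
qed

end

lemma schwartz_cnj_uminus:
  assumes "schwartz \<phi>"
  shows "schwartz (\<lambda>x. cnj (\<phi> (- x)))"
proof (rule schwartz_coinduct[where S = "{\<lambda>x. c * cnj (g (- x)) | c g. schwartz g}"])
  \<comment> \<open>The scalar c in the class absorbs the sign that every differentiation of the
    reflection produces.\<close>
  show "(\<lambda>x. cnj (\<phi> (- x))) \<in> {\<lambda>x. c * cnj (g (- x)) | c g. schwartz g}"
    using assms by (auto intro!: exI[of _ 1])
next
  fix h :: "real^'n \<Rightarrow> complex" assume "h \<in> {\<lambda>x. c * cnj (g (- x)) | c g. schwartz g}"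
  then obtain c g where h: "h = (\<lambda>x. c * cnj (g (- x)))" and g: "schwartz g" by auto
  have d: "(h has_derivative (\<lambda>v. c * cnj (\<Sum>i\<in>UNIV. of_real ((- v) $ i) * partial_derivative i g (- x)))) (at x)" for x
    unfolding h
    by (intro has_derivative_mult_right has_derivative_cnj
        has_derivative_compose[of uminus uminus x UNIV g, OF _ schwartz_has_derivative[OF g]] derivative_intros)
  show "h differentiable at x" for x
    using d unfolding differentiable_def by blast
  have "partial_derivative i h = (\<lambda>x. (- c) * cnj (partial_derivative i g (- x)))" for i
    using partial_derivative_eq[OF d] by (auto simp: axis_def if_distrib if_distribR cong: if_cong)
  then show "partial_derivative i h \<in> {\<lambda>x. c * cnj (g (- x)) | c g. schwartz g}" for i
    using schwartz_partial[OF g] by blast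
  show "\<exists>C. \<forall>x. (1 + norm x) ^ k * norm (h x) \<le> C" for k
  proof -
    obtain C where C: "\<And>x. (1 + norm x) ^ k * norm (g x) \<le> C"
      using schwartz_decay[OF g] by blast
    have "(1 + norm x) ^ k * norm (h x) \<le> norm c * C" for x
      using mult_left_mono[OF C[of "- x"], of "norm c"] by (simp add: h norm_mult mult_ac)
    then show ?thesis by blast
  qed
qed

subsection \<open>Convolution\<close>

context
  fixes \<phi> :: "real^'n \<Rightarrow> complex"
  assumes \<phi>: "schwartz \<phi>"
begin

lemma convolution_integrable:
  assumes g: "schwartz g"
  shows "integrable lborel (\<lambda>y. \<phi> y * g (x - y))"
proof -
  obtain C where C: "\<And>x. (1 + norm x) ^ 0 * norm (g x) \<le> C"
    using schwartz_decay[OF g] by blast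
  have [measurable]: "\<phi> \<in> borel_measurable borel" "g \<in> borel_measurable borel"
    by (intro schwartz_measurable \<phi> g)+
  show ?thesis
  proof (rule Bochner_Integration.integrable_bound)
    show "integrable lborel (\<lambda>y. C * \<phi> y)" using schwartz_integrable[OF \<phi>] by simp
    show "AE y in lborel. norm (\<phi> y * g (x - y)) \<le> norm (C * \<phi> y)"
    proof (rule AE_I2)
      fix y
      have "norm (g (x - y)) \<le> \<bar>C\<bar>" using C[of "x - y"] by simp
      then show "norm (\<phi> y * g (x - y)) \<le> norm (C * \<phi> y)"
        by (simp add: norm_mult mult_left_mono mult.commute[of "\<bar>C\<bar>"])
    qed
  qed measurable
qed

text \<open>All derivatives are put on the second factor. The first-order remainder of g, divided by
  the length of the increment, is bounded by 2 L and tends to 0 pointwise, so dominated convergence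
  with majorant 2 L |\<phi>| applies.\<close>

lemma convolution_has_derivative:
  assumes g: "schwartz g"
  shows "(convolution \<phi> g has_derivative
          (\<lambda>v. \<Sum>i\<in>UNIV. of_real (v $ i) * convolution \<phi> (partial_derivative i g) x)) (at x)"
proof -
  have [measurable]: "\<phi> \<in> borel_measurable borel" "g \<in> borel_measurable borel"
    "partial_derivative i g \<in> borel_measurable borel" for i
    by (intro schwartz_measurable \<phi> g schwartz_partial)+
  obtain L where L: "0 \<le> L" "\<And>x y. norm (g x - g y) \<le> L * norm (x - y)"
    "\<And>x v. norm (\<Sum>i\<in>UNIV. of_real (v $ i) * partial_derivative i g x) \<le> L * norm v"
    using schwartz_lipschitz[OF g] by blast
  define D where "D v = (\<Sum>i\<in>UNIV. of_real (v $ i) * convolution \<phi> (partial_derivative i g) x)" for v :: "real^'n"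
  define Dg where "Dg z v = (\<Sum>i\<in>UNIV. of_real (v $ i) * partial_derivative i g z)" for z v :: "real^'n"
  have bl: "bounded_linear D"
    unfolding D_def by (intro bounded_linear_sum bounded_linear_mult_const
        bounded_linear_compose[OF bounded_linear_of_real] bounded_linear_vec_nth)
  have Dint: "D v = (LINT y|lborel. \<phi> y * Dg (x - y) v)"
    and Dintb: "integrable lborel (\<lambda>y. \<phi> y * Dg (x - y) v)" for v
  proof -
    have "(\<lambda>y. \<phi> y * Dg (x - y) v) = (\<lambda>y. \<Sum>i\<in>UNIV. of_real (v $ i) * (\<phi> y * partial_derivative i g (x - y)))"
      by (simp add: Dg_def sum_distrib_left mult_ac)
    then show "D v = (LINT y|lborel. \<phi> y * Dg (x - y) v)" "integrable lborel (\<lambda>y. \<phi> y * Dg (x - y) v)"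
      using convolution_integrable[OF schwartz_partial[OF g]]
      by (simp_all add: D_def convolution_def)
  qed
  have "(\<lambda>h. norm (convolution \<phi> g (x + h) - convolution \<phi> g x - D h) / norm h) \<midarrow>0\<rightarrow> 0"
    unfolding tendsto_at_iff_sequentially
  proof (intro allI impI)
    fix X :: "nat \<Rightarrow> real^'n" assume X: "\<forall>i. X i \<in> UNIV - {0}" "X \<longlonglongrightarrow> 0"
    define r where "r k y = (g (x + X k - y) - g (x - y) - Dg (x - y) (X k)) /\<^sub>R norm (X k)" for k y
    have [measurable]: "r k \<in> borel_measurable borel" for k
      unfolding r_def Dg_def by measurable
    have eq: "norm (convolution \<phi> g (x + X k) - convolution \<phi> g x - D (X k)) / norm (X k) = 
        norm (LINT y|lborel. \<phi> y * r k y)" for k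
    proof -
      have "(LINT y|lborel. \<phi> y * r k y) = (LINT y|lborel. 
         (\<phi> y * g (x + X k - y) - \<phi> y * g (x - y) - \<phi> y * Dg (x - y) (X k)) /\<^sub>R norm (X k))"
        by (simp add: r_def algebra_simps)
      also have "\<dots> = (convolution \<phi> g (x + X k) - convolution \<phi> g x - D (X k)) /\<^sub>R norm (X k)"
        unfolding convolution_def Dint using Dintb convolution_integrable[OF g] by simp
      finally show ?thesis by (simp add: divide_inverse mult.commute)
    qed
    have "(\<lambda>k. LINT y|lborel. \<phi> y * r k y) \<longlonglongrightarrow> (LINT y|(lborel :: (real^'n) measure). 0)"
    proof (rule integral_dominated_convergence[where w = "\<lambda>y. norm (\<phi> y) * (2 * L)"])
      show "integrable lborel (\<lambda>y. norm (\<phi> y) * (2 * L))"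
        using schwartz_integrable[OF \<phi>] by simp
      show "AE y in lborel. norm (\<phi> y * r k y) \<le> norm (\<phi> y) * (2 * L)" for k
      proof (rule AE_I2)
        fix y
        have "norm (g (x + X k - y) - g (x - y) - Dg (x - y) (X k)) \<le> norm (g (x + X k - y) - g (x - y)) + norm (Dg (x - y) (X k))"
          by (rule norm_triangle_ineq4)
        also have "\<dots> \<le> 2 * L * norm (X k)"
          using L(2)[of "x + X k - y" "x - y"] L(3)[of "X k" "x - y"] by (simp add: Dg_def)
        finally have *: "norm (g (x + X k - y) - g (x - y) - Dg (x - y) (X k)) \<le> 2 * L * norm (X k)" .
        have "norm (r k y) = norm (g (x + X k - y) - g (x - y) - Dg (x - y) (X k)) / norm (X k)"
          by (simp add: r_def divide_inverse mult.commute)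
        also have "\<dots> \<le> 2 * L"
          using * X(1) by (subst pos_divide_le_eq) auto
        finally have "norm (r k y) \<le> 2 * L" .
        then show "norm (\<phi> y * r k y) \<le> norm (\<phi> y) * (2 * L)"
          by (simp add: norm_mult mult_left_mono)
      qed
      show "AE y in lborel. (\<lambda>k. \<phi> y * r k y) \<longlonglongrightarrow> 0"
      proof (rule AE_I2)
        fix y
        have "(g has_derivative Dg (x - y)) (at (x - y))"
          unfolding Dg_def by (rule schwartz_has_derivative[OF g])
        then have "(\<lambda>h. norm (g (x - y + h) - g (x - y) - Dg (x - y) h) / norm h) \<midarrow>0\<rightarrow> 0"
          by (simp add: has_derivative_at)
        then have "(\<lambda>k. norm (g (x - y + X k) - g (x - y) - Dg (x - y) (X k)) / norm (X k)) \<longlonglongrightarrow> 0"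
          using X unfolding tendsto_at_iff_sequentially by (auto simp: comp_def)
        then have "(\<lambda>k. norm (r k y)) \<longlonglongrightarrow> 0"
          by (simp add: r_def divide_inverse mult.commute add_diff_eq diff_add_eq)
        then show "(\<lambda>k. \<phi> y * r k y) \<longlonglongrightarrow> 0"
          by (auto intro: tendsto_mult_right_zero simp: tendsto_norm_zero_iff)
      qed
    qed auto
    then show "((\<lambda>h. norm (convolution \<phi> g (x + h) - convolution \<phi> g x - D h) / norm h) \<circ> X) \<longlonglongrightarrow> 0"
      unfolding comp_def eq by (auto intro: tendsto_norm_zero)
  qed
  then show ?thesis
    using bl unfolding has_derivative_at D_def by auto
qed

lemma schwartz_convolution:
  assumes "schwartz \<psi>"
  shows "schwartz (convolution \<phi> \<psi>)"
proof (rule schwartz_coinduct[where S = "{convolution \<phi> g | g. schwartz g}"])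
  show "convolution \<phi> \<psi> \<in> {convolution \<phi> g | g. schwartz g}" using assms by blast
next
  fix h assume "h \<in> {convolution \<phi> g | g. schwartz g}"
  then obtain g where h: "h = convolution \<phi> g" and g: "schwartz g" by auto
  show "h differentiable at x" for x
    using convolution_has_derivative[OF g] unfolding differentiable_def h by blast
  have "partial_derivative i h x = convolution \<phi> (partial_derivative i g) x" for i x
    unfolding h using partial_derivative_eq[OF convolution_has_derivative[OF g]]
    by (auto simp: axis_def if_distrib if_distribR cong: if_cong)
  then have "partial_derivative i h = convolution \<phi> (partial_derivative i g)" for i by blast
  then show "partial_derivative i h \<in> {convolution \<phi> g | g. schwartz g}" for i
    using schwartz_partial[OF g] by blast
  show "\<exists>C. \<forall>x. (1 + norm x) ^ k * norm (h x) \<le> C" for k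
  proof -
    obtain C where C: "\<And>x. (1 + norm x) ^ k * norm (g x) \<le> C"
      using schwartz_decay[OF g] by blast
    have "(1 + norm x) ^ k * norm (h x) \<le> (LINT y|lborel. C * ((1 + norm y) ^ k * norm (\<phi> y)))" for x
    proof -
      have "norm ((1 + norm x) ^ k *\<^sub>R (\<phi> y * g (x - y))) \<le> C * ((1 + norm y) ^ k * norm (\<phi> y))" for y
      proof -
        have "norm x \<le> norm y + norm (x - y)" using norm_triangle_ineq[of y "x - y"] by simp
        \<comment> \<open>A Peetre-type inequality: the weight at x is at most the product of the
          weights at y and at x - y, so each factor of the convolution absorbs its own
          power.\<close>
        then have "1 + norm x \<le> (1 + norm y + norm (x - y)) + norm y * norm (x - y)"
          by (simp add: add_increasing2)
        also have "\<dots> = (1 + norm y) * (1 + norm (x - y))" by (simp add: algebra_simps)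
        finally have "(1 + norm x) ^ k \<le> ((1 + norm y) * (1 + norm (x - y))) ^ k"
          by (intro power_mono) auto
        then have "(1 + norm x) ^ k * (norm (\<phi> y) * norm (g (x - y))) \<le> 
          (1 + norm y) ^ k * (1 + norm (x - y)) ^ k * (norm (\<phi> y) * norm (g (x - y)))"
          by (intro mult_right_mono) (auto simp: power_mult_distrib)
        also have "\<dots> = (1 + norm y) ^ k * norm (\<phi> y) * ((1 + norm (x - y)) ^ k * norm (g (x - y)))"
          by simp
        also have "\<dots> \<le> (1 + norm y) ^ k * norm (\<phi> y) * C"
          by (intro mult_left_mono C) auto
        finally show ?thesis by (simp add: norm_mult mult_ac)
      qed
      then have "norm (LINT y|lborel. (1 + norm x) ^ k *\<^sub>R (\<phi> y * g (x - y))) \<le> 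
         (LINT y|lborel. C * ((1 + norm y) ^ k * norm (\<phi> y)))"
        by (intro Bochner_Integration.integral_norm_bound_integral)
          (use convolution_integrable[OF g] schwartz_weighted_integrable[OF \<phi>] in auto)
      then show ?thesis by (simp add: h convolution_def)
    qed
    then show ?thesis by blast
  qed
qed

lemma fourier_convolution:
  assumes \<psi>: "schwartz \<psi>"
  shows "fourier_transform (convolution \<phi> \<psi>) \<xi> = fourier_transform \<phi> \<xi> * fourier_transform \<psi> \<xi>"
proof -
  have [measurable]: "\<phi> \<in> borel_measurable borel" "\<psi> \<in> borel_measurable borel"
    by (intro schwartz_measurable \<phi> \<psi>)+
  let ?e = "\<lambda>x. exp (- \<i> * complex_of_real (x \<bullet> \<xi>))"
  define g where "g y x = \<phi> y * \<psi> (x - y) * ?e x" for y x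
  have m: "(\<lambda>(y,x). g y x) \<in> borel_measurable (borel \<Otimes>\<^sub>M borel)"
    unfolding g_def by measurable
  have tr: "(\<integral>\<^sup>+x. ennreal (norm (\<psi> (x - y))) \<partial>lborel) = (\<integral>\<^sup>+x. ennreal (norm (\<psi> x)) \<partial>lborel)" for y
    using lborel_nn_integral_affine[of 1 "\<lambda>x. ennreal (norm (\<psi> x))" "- y"] by simp
  have "(\<integral>\<^sup>+y. \<integral>\<^sup>+x. ennreal (norm (g y x)) \<partial>lborel \<partial>lborel) = 
     (\<integral>\<^sup>+y. ennreal (norm (\<phi> y)) \<partial>lborel) * (\<integral>\<^sup>+x. ennreal (norm (\<psi> x)) \<partial>lborel)"
    by (simp add: g_def norm_mult ennreal_mult nn_integral_cmult nn_integral_multc tr)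
  also have "\<dots> < \<infinity>"
    using schwartz_integrable[OF \<phi>] schwartz_integrable[OF \<psi>]
    by (simp add: integrable_iff_bounded ennreal_mult_less_top)
  finally have b: "(\<integral>\<^sup>+y. \<integral>\<^sup>+x. ennreal (norm (g y x)) \<partial>lborel \<partial>lborel) < \<infinity>" .
  have inner: "(LINT x|lborel. g y x) = \<phi> y * ?e y * fourier_transform \<psi> \<xi>" for y
  proof -
    have "(LINT x|lborel. g y x) = (LINT x|lborel. g y (y + 1 *\<^sub>R x))"
    proof -
      have "g y \<in> borel_measurable borel" unfolding g_def by measurable
      then show ?thesis using lborel_integral_affine(2)[of 1 "g y" y] by simp
    qed
    also have "\<dots> = (LINT x|lborel. (\<phi> y * ?e y) * (\<psi> x * ?e x))"
      by (intro Bochner_Integration.integral_cong) (auto simp: g_def inner_add_left distrib_left exp_add exp_diff exp_minus field_simps)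
    also have "\<dots> = \<phi> y * ?e y * fourier_transform \<psi> \<xi>"
      unfolding fourier_transform_def by (rule integral_mult_right_zero)
    finally show ?thesis .
  qed
  have "fourier_transform (convolution \<phi> \<psi>) \<xi> = (LINT x|lborel. LINT y|lborel. g y x)"
    by (simp add: fourier_transform_def convolution_def g_def)
  also have "\<dots> = (LINT y|lborel. LINT x|lborel. g y x)"
    by (rule lborel_swap_integrals(1)[OF m b, symmetric])
  also have "\<dots> = fourier_transform \<phi> \<xi> * fourier_transform \<psi> \<xi>"
    unfolding inner fourier_transform_def[of \<phi>] by simp
  finally show ?thesis .
qed

lemma fourier_cnj_uminus:
  "fourier_transform (\<lambda>x. cnj (\<phi> (- x))) \<xi> = cnj (fourier_transform \<phi> \<xi>)"
proof -
  have [measurable]: "(\<lambda>x. cnj (\<phi> x)) \<in> borel_measurable borel"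
    by (intro borel_measurable_continuous_onI continuous_on_cnj schwartz_continuous_on \<phi>)
  have "cnj (fourier_transform \<phi> \<xi>) = (LINT x|lborel. cnj (\<phi> x) * exp (\<i> * complex_of_real (x \<bullet> \<xi>)))"
  proof -
    have h: "(LINT x|lborel. cnj (\<phi> x) * exp (\<i> * complex_of_real (x \<bullet> \<xi>))) =
      (LINT x|lborel. cnj (\<phi> x * exp (- \<i> * complex_of_real (x \<bullet> \<xi>))))"
      by (intro Bochner_Integration.integral_cong) (auto simp: exp_cnj)
    show ?thesis
      unfolding fourier_transform_def h by (rule Bochner_Integration.integral_cnj[symmetric])
  qed
  also have "\<dots> = (LINT x|lborel. cnj (\<phi> (0 + (-1) *\<^sub>R x)) * exp (\<i> * complex_of_real ((0 + (-1) *\<^sub>R x) \<bullet> \<xi>)))"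
    by (subst lborel_integral_affine(2)[where g = "\<lambda>x. cnj (\<phi> x) * exp (\<i> * complex_of_real (x \<bullet> \<xi>))"]) auto
  finally show ?thesis by (simp add: fourier_transform_def)
qed

end

subsection \<open>The Fourier transform\<close>

lemma fourier_measurable [measurable]:
  assumes [measurable]: "\<phi> \<in> borel_measurable borel"
  shows "fourier_transform \<phi> \<in> borel_measurable borel"
  unfolding fourier_transform_def by measurable

lemma fourier_integrable:
  assumes "integrable lborel \<phi>"
  shows "integrable lborel (\<lambda>x. \<phi> x * exp (- \<i> * complex_of_real (x \<bullet> \<xi>)))"
  by (rule Bochner_Integration.integrable_bound[OF assms])
     (use borel_measurable_integrable[OF assms] in \<open>auto simp: norm_mult norm_exp_eq_Re\<close>)

lemma norm_fourier_le: "norm (fourier_transform \<phi> \<xi>) \<le> (LINT x|lborel. norm (\<phi> x))"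
proof -
  have "norm (fourier_transform \<phi> \<xi>) \<le> (LINT x|lborel. norm (\<phi> x * exp (- \<i> * complex_of_real (x \<bullet> \<xi>))))"
    unfolding fourier_transform_def by (rule integral_norm_bound)
  then show ?thesis by (simp add: norm_mult norm_exp_eq_Re)
qed

lemma fourier_continuous:
  fixes \<phi> :: "real^'n \<Rightarrow> complex"
  assumes \<phi>: "integrable lborel \<phi>"
  shows "continuous_on UNIV (fourier_transform \<phi>)"
proof -
  have [measurable]: "\<phi> \<in> borel_measurable borel" using \<phi> by auto
  have "isCont (fourier_transform \<phi>) \<xi>" for \<xi>
    unfolding continuous_at_sequentially
  proof (intro allI impI)
    fix X assume X: "X \<longlonglongrightarrow> \<xi>"
    have "(\<lambda>k. LINT x|lborel. \<phi> x * exp (- \<i> * complex_of_real (x \<bullet> X k))) \<longlonglongrightarrow> (LINT x|lborel. \<phi> x * exp (- \<i> * complex_of_real (x \<bullet> \<xi>)))"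
    proof (rule integral_dominated_convergence[where w = "\<lambda>x. norm (\<phi> x)"])
      show "AE x in lborel. (\<lambda>k. \<phi> x * exp (- \<i> * complex_of_real (x \<bullet> X k))) \<longlonglongrightarrow> \<phi> x * exp (- \<i> * complex_of_real (x \<bullet> \<xi>))"
        by (intro AE_I2 tendsto_intros X)
    qed (use \<phi> in \<open>auto simp: norm_mult norm_exp_eq_Re\<close>)
    then show "(fourier_transform \<phi> \<circ> X) \<longlonglongrightarrow> fourier_transform \<phi> \<xi>"
      by (simp add: comp_def fourier_transform_def)
  qed
  then show ?thesis by (simp add: continuous_on_eq_continuous_at)
qed

lemma fourier_translate:
  fixes \<phi> :: "real^'n \<Rightarrow> complex"
  assumes [measurable]: "\<phi> \<in> borel_measurable borel"
  shows "fourier_transform (\<lambda>x. \<phi> (v + x)) \<xi> = exp (\<i> * complex_of_real (v \<bullet> \<xi>)) * fourier_transform \<phi> \<xi>"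
proof -
  let ?G = "\<lambda>x. exp (\<i> * complex_of_real (v \<bullet> \<xi>)) * (\<phi> x * exp (- \<i> * complex_of_real (x \<bullet> \<xi>)))"
  have "(LINT x|lborel. \<phi> (v + x) * exp (- \<i> * complex_of_real (x \<bullet> \<xi>))) = (LINT x|lborel. ?G (v + 1 *\<^sub>R x))"
    by (intro Bochner_Integration.integral_cong)
      (auto simp: inner_add_left distrib_left exp_add exp_diff exp_minus field_simps)
  also have "\<dots> = (LINT x|lborel. ?G x)"
    by (subst lborel_integral_affine(2)) auto
  finally show ?thesis
    by (simp add: fourier_transform_def)
qed

section \<open>Derivatives, decay and inversion of the Fourier transform\<close>

lemma schwartz_difference_quotient:
  fixes \<phi> :: "real^'n \<Rightarrow> complex"
  assumes \<phi>: "schwartz \<phi>"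
  obtains C where "\<And>x h. 0 < h \<Longrightarrow> h \<le> 1 \<Longrightarrow>
      norm ((\<phi> (h *\<^sub>R axis i 1 + x) - \<phi> x) / of_real h) \<le> C * (1 / (1 + norm x) ^ (2 * CARD('n)))"
proof -
  let ?m = "2 * CARD('n)" and ?e = "axis i 1 :: real^'n"
  obtain C where C: "0 \<le> C" "\<And>x. (1 + norm x) ^ ?m * norm (partial_derivative i \<phi> x) \<le> C"
    using schwartz_decay[OF schwartz_partial[OF \<phi>]] by metis
  have "norm ((\<phi> (h *\<^sub>R ?e + x) - \<phi> x) / of_real h) \<le> (C * 2 ^ ?m) * (1 / (1 + norm x) ^ ?m)"
    if h: "0 < h" "h \<le> 1" for x and h :: real
  proof -
    let ?B = "(C * 2 ^ ?m) * (1 / (1 + norm x) ^ ?m)"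
    have B0: "0 \<le> ?B" using C(1) by simp
    have D: "((\<lambda>s. \<phi> (s *\<^sub>R ?e + x)) has_derivative (\<lambda>s. of_real s * partial_derivative i \<phi> (s0 *\<^sub>R ?e + x))) (at s0 within S)" for s0 S
    proof -
      have "((\<lambda>s. \<phi> (s *\<^sub>R ?e + x)) has_derivative (\<lambda>s. \<Sum>j\<in>UNIV. of_real ((s *\<^sub>R ?e) $ j) * partial_derivative j \<phi> (s0 *\<^sub>R ?e + x))) (at s0 within S)"
        by (rule has_derivative_compose[of "\<lambda>s. s *\<^sub>R ?e + x" "\<lambda>s. s *\<^sub>R ?e" s0 S \<phi>, OF _ schwartz_has_derivative[OF \<phi>]])
          (auto intro!: derivative_eq_intros)
      moreover have "(\<Sum>j\<in>UNIV. of_real ((s *\<^sub>R ?e) $ j) * partial_derivative j \<phi> z) = of_real s * partial_derivative i \<phi> z" for s z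
        by (simp add: axis_def if_distrib if_distribR cong: if_cong)
      ultimately show ?thesis by simp
    qed
    \<comment> \<open>A shift of length at most 1 changes \<open>1 + norm x\<close> by a factor of
      at most 2, the origin of \<open>2 ^ ?m\<close>; this makes the bound uniform in h.\<close>
    have bd: "norm (partial_derivative i \<phi> (s *\<^sub>R ?e + x)) \<le> ?B" if s: "0 \<le> s" "s \<le> h" for s
    proof -
      let ?z = "s *\<^sub>R ?e + x"
      have aux: "a \<le> b + c \<Longrightarrow> c \<le> 1 \<Longrightarrow> 0 \<le> b \<Longrightarrow> 1 + a \<le> 2 * (1 + b)" for a b c :: real
        by simp
      have "norm x \<le> norm ?z + norm (s *\<^sub>R ?e)"
        using norm_triangle_ineq4[of ?z "s *\<^sub>R ?e"] by simp
      moreover have "norm (s *\<^sub>R ?e) \<le> 1" using s h by simp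
      ultimately have "1 + norm x \<le> 2 * (1 + norm ?z)" 
        using aux[OF _ _ norm_ge_zero] by blast
      then have "(1 + norm x) ^ ?m \<le> 2 ^ ?m * (1 + norm ?z) ^ ?m"
        by (metis power_mono power_mult_distrib add_nonneg_nonneg norm_ge_zero zero_le_one)
      then have "(1 + norm x) ^ ?m * norm (partial_derivative i \<phi> ?z) \<le> 2 ^ ?m * ((1 + norm ?z) ^ ?m * norm (partial_derivative i \<phi> ?z))"
        using mult_right_mono[OF _ norm_ge_zero] by (simp only: mult.assoc[symmetric])
      also have "\<dots> \<le> 2 ^ ?m * C" by (intro mult_left_mono C) auto
      finally have "norm (partial_derivative i \<phi> ?z) * (1 + norm x) ^ ?m \<le> C * 2 ^ ?m" by (simp add: mult.commute)
      then have "norm (partial_derivative i \<phi> ?z) \<le> C * 2 ^ ?m / (1 + norm x) ^ ?m"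
        by (subst pos_le_divide_eq) (auto intro!: zero_less_power add_pos_nonneg)
      then show ?thesis by simp
    qed
    have "norm (\<phi> (h *\<^sub>R ?e + x) - \<phi> (0 *\<^sub>R ?e + x)) \<le> ?B * norm (h - 0)"
    proof (rule differentiable_bound[where S = "{0..h}", OF _ D])
      show "onorm (\<lambda>s. complex_of_real s * partial_derivative i \<phi> (t *\<^sub>R ?e + x)) \<le> ?B" if "t \<in> {0..h}" for t
      proof (rule onorm_bound[OF B0])
        fix s :: real
        have "norm (partial_derivative i \<phi> (t *\<^sub>R ?e + x)) \<le> ?B" using bd that by auto
        then have "\<bar>s\<bar> * norm (partial_derivative i \<phi> (t *\<^sub>R ?e + x)) \<le> \<bar>s\<bar> * ?B" by (intro mult_left_mono) auto
        then show "norm (complex_of_real s * partial_derivative i \<phi> (t *\<^sub>R ?e + x)) \<le> ?B * norm s"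
          by (simp add: norm_mult mult.commute)
      qed
    qed (use h in auto)
    then have "norm (\<phi> (h *\<^sub>R ?e + x) - \<phi> x) \<le> ?B * h" using h by simp
    then have "norm (\<phi> (h *\<^sub>R ?e + x) - \<phi> x) / h \<le> ?B" using h by (subst pos_divide_le_eq) auto
    then show ?thesis using h by (simp add: norm_divide)
  qed
  then show ?thesis using that by blast
qed

text \<open>Obtained without integration by parts: translation multiplies the transform by a phase,
  so the transform of a difference quotient is explicit, and the majorant of
  \<open>schwartz_difference_quotient\<close> permits the limit under the integral.\<close>

lemma fourier_partial:
  fixes \<phi> :: "real^'n \<Rightarrow> complex"
  assumes \<phi>: "schwartz \<phi>"
  shows "fourier_transform (partial_derivative i \<phi>) \<xi> = \<i> * complex_of_real (\<xi> $ i) * fourier_transform \<phi> \<xi>"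
proof -
  let ?e = "axis i 1 :: real^'n"
  have [measurable]: "\<phi> \<in> borel_measurable borel" "partial_derivative i \<phi> \<in> borel_measurable borel"
    by (intro schwartz_measurable \<phi> schwartz_partial)+
  define h where "h k = 1 / real (Suc k)" for k
  have h: "0 < h k" "h k \<le> 1" for k by (auto simp: h_def)
  have hlim: "h \<longlonglongrightarrow> 0" unfolding h_def by (rule lim_1_over_n[THEN LIMSEQ_Suc])
  define s where "s k x = (\<phi> (h k *\<^sub>R ?e + x) - \<phi> x) / of_real (h k) * exp (- \<i> * complex_of_real (x \<bullet> \<xi>))" for k x
  have [measurable]: "s k \<in> borel_measurable borel" for k unfolding s_def by measurable
  obtain C where C: "\<And>x h. 0 < h \<Longrightarrow> h \<le> 1 \<Longrightarrow>
      norm ((\<phi> (h *\<^sub>R ?e + x) - \<phi> x) / of_real h) \<le> C * (1 / (1 + norm x) ^ (2 * CARD('n)))"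
    using schwartz_difference_quotient[OF \<phi>] by blast
  have "(\<lambda>k. integral\<^sup>L lborel (s k)) \<longlonglongrightarrow> fourier_transform (partial_derivative i \<phi>) \<xi>"
    unfolding fourier_transform_def
  proof (rule integral_dominated_convergence[where w = "\<lambda>x. C * (1 / (1 + norm x) ^ (2 * CARD('n)))"])
    show "integrable lborel (\<lambda>x::real^'n. C * (1 / (1 + norm x) ^ (2 * CARD('n))))"
      by (intro integrable_mult_right integrable_inverse_power_norm)
    show "AE x in lborel. norm (s k x) \<le> C * (1 / (1 + norm x) ^ (2 * CARD('n)))" for k
    proof (rule AE_I2)
      fix x
      have "norm (s k x) = norm ((\<phi> (h k *\<^sub>R ?e + x) - \<phi> x) / of_real (h k))"
        by (simp add: s_def norm_mult norm_divide norm_exp_eq_Re)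
      then show "norm (s k x) \<le> C * (1 / (1 + norm x) ^ (2 * CARD('n)))"
        using C[OF h(1)[of k] h(2)[of k], of x] by (simp only:)
    qed
    show "AE x in lborel. (\<lambda>k. s k x) \<longlonglongrightarrow> partial_derivative i \<phi> x * exp (- \<i> * complex_of_real (x \<bullet> \<xi>))"
    proof (rule AE_I2)
      fix x
      have e: "(\<Sum>j\<in>UNIV. of_real ((h k *\<^sub>R ?e) $ j) * partial_derivative j \<phi> x) = of_real (h k) * partial_derivative i \<phi> x" for k
        by (simp add: axis_def if_distrib if_distribR cong: if_cong)
      have 1: "((\<lambda>v. norm (\<phi> (x + v) - \<phi> x - (\<Sum>j\<in>UNIV. of_real (v $ j) * partial_derivative j \<phi> x)) / norm v) \<longlongrightarrow> 0) (at 0)"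
        using schwartz_has_derivative[OF \<phi>, of x] by (simp add: has_derivative_at)
      have 2: "(\<lambda>k. h k *\<^sub>R ?e) \<longlonglongrightarrow> 0"
        using tendsto_scaleR[OF hlim tendsto_const, of ?e] by simp
      have 3: "\<forall>\<^sub>F k in sequentially. h k *\<^sub>R ?e \<noteq> 0" by (simp add: h_def)
      have "(\<lambda>k. norm (\<phi> (x + h k *\<^sub>R ?e) - \<phi> x - (\<Sum>j\<in>UNIV. of_real ((h k *\<^sub>R ?e) $ j) * partial_derivative j \<phi> x)) / norm (h k *\<^sub>R ?e)) \<longlonglongrightarrow> 0"
        by (rule filterlim_compose[OF 1 filterlim_atI[OF 2 3]])
      then have "(\<lambda>k. norm (\<phi> (x + h k *\<^sub>R ?e) - \<phi> x - of_real (h k) * partial_derivative i \<phi> x) / norm (h k *\<^sub>R ?e)) \<longlonglongrightarrow> 0"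
        unfolding e .
      moreover have "norm (\<phi> (x + h k *\<^sub>R ?e) - \<phi> x - of_real (h k) * partial_derivative i \<phi> x) / norm (h k *\<^sub>R ?e)
         = norm ((\<phi> (h k *\<^sub>R ?e + x) - \<phi> x) / of_real (h k) - partial_derivative i \<phi> x)" for k
      proof -
        have "(\<phi> (h k *\<^sub>R ?e + x) - \<phi> x) / of_real (h k) - partial_derivative i \<phi> x = 
           (\<phi> (x + h k *\<^sub>R ?e) - \<phi> x - of_real (h k) * partial_derivative i \<phi> x) / of_real (h k)"
          using h(1)[of k] by (simp add: field_simps)
        then show ?thesis using h(1)[of k] by (simp add: norm_divide)
      qed
      ultimately have "(\<lambda>k. norm ((\<phi> (h k *\<^sub>R ?e + x) - \<phi> x) / of_real (h k) - partial_derivative i \<phi> x)) \<longlonglongrightarrow> 0"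
        by (simp only:)
      then have "(\<lambda>k. (\<phi> (h k *\<^sub>R ?e + x) - \<phi> x) / of_real (h k)) \<longlonglongrightarrow> partial_derivative i \<phi> x"
        by (rule LIM_zero_cancel[OF tendsto_norm_zero_cancel])
      then show "(\<lambda>k. s k x) \<longlonglongrightarrow> partial_derivative i \<phi> x * exp (- \<i> * complex_of_real (x \<bullet> \<xi>))"
        unfolding s_def by (intro tendsto_mult tendsto_const)
    qed
  qed auto
  moreover have "integral\<^sup>L lborel (s k) = (exp (\<i> * complex_of_real (\<xi> $ i) * of_real (h k)) - 1) / of_real (h k) * fourier_transform \<phi> \<xi>" for k
  proof -
    have i1: "integrable lborel (\<lambda>x. \<phi> (h k *\<^sub>R ?e + x))"
      using lborel_integral_affine(1)[of 1 \<phi> "h k *\<^sub>R ?e"] schwartz_integrable[OF \<phi>] by simp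
    have "integral\<^sup>L lborel (s k) = (LINT x|lborel. (\<phi> (h k *\<^sub>R ?e + x) * exp (- \<i> * complex_of_real (x \<bullet> \<xi>))
        - \<phi> x * exp (- \<i> * complex_of_real (x \<bullet> \<xi>))) / of_real (h k))"
      by (intro Bochner_Integration.integral_cong) (auto simp: s_def diff_divide_distrib left_diff_distrib)
    also have "\<dots> = (fourier_transform (\<lambda>x. \<phi> (h k *\<^sub>R ?e + x)) \<xi> - fourier_transform \<phi> \<xi>) / of_real (h k)"
      unfolding fourier_transform_def
      using fourier_integrable[OF i1, of \<xi>] fourier_integrable[OF schwartz_integrable[OF \<phi>], of \<xi>] by simp
    also have "\<dots> = (exp (\<i> * complex_of_real (\<xi> $ i) * of_real (h k)) - 1) / of_real (h k) * fourier_transform \<phi> \<xi>"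
      by (subst fourier_translate) (auto simp: inner_axis' algebra_simps diff_divide_distrib)
    finally show ?thesis .
  qed
  moreover have "(\<lambda>k. (exp (\<i> * complex_of_real (\<xi> $ i) * of_real (h k)) - 1) / of_real (h k) * fourier_transform \<phi> \<xi>)
     \<longlonglongrightarrow> \<i> * complex_of_real (\<xi> $ i) * fourier_transform \<phi> \<xi>"
  proof (intro tendsto_mult tendsto_const)
    have "((\<lambda>z. exp (\<i> * complex_of_real (\<xi> $ i) * z)) has_field_derivative \<i> * complex_of_real (\<xi> $ i)) (at 0)"
      by (auto intro!: derivative_eq_intros)
    then have 1: "((\<lambda>z. (exp (\<i> * complex_of_real (\<xi> $ i) * z) - 1) / z) \<longlongrightarrow> \<i> * complex_of_real (\<xi> $ i)) (at 0)"
      by (simp add: has_field_derivative_iff)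
    have 2: "(\<lambda>k. complex_of_real (h k)) \<longlonglongrightarrow> 0"
      using tendsto_of_real[OF hlim] by simp
    have "complex_of_real (h k) \<noteq> 0" for k using h(1)[of k] by simp
    then have 3: "\<forall>\<^sub>F k in sequentially. complex_of_real (h k) \<noteq> 0" by simp
    show "(\<lambda>k. (exp (\<i> * complex_of_real (\<xi> $ i) * of_real (h k)) - 1) / of_real (h k)) \<longlonglongrightarrow> \<i> * complex_of_real (\<xi> $ i)"
      by (rule filterlim_compose[OF 1 filterlim_atI[OF 2 3]])
  qed
  ultimately show ?thesis by (intro LIMSEQ_unique) (simp_all only:)
qed

lemma fourier_iterated_partial:
  assumes \<phi>: "schwartz \<phi>"
  shows "fourier_transform (iterated_partial (replicate m i) \<phi>) \<xi> = (\<i> * complex_of_real (\<xi> $ i)) ^ m * fourier_transform \<phi> \<xi>"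
  by (induction m) (simp_all add: iterated_partial_Cons fourier_partial[OF schwartz_iterated[OF \<phi>]])

text \<open>Bounds the radial weight by pure powers of single coordinates, so that decay of the
  transform follows from repeated derivatives in one direction, without mixed ones.\<close>

lemma one_plus_norm_power_le:
  fixes \<xi> :: "real^'n"
  shows "(1 + norm \<xi>) ^ m \<le> (1 + real CARD('n)) ^ m * (1 + (\<Sum>i\<in>UNIV. \<bar>\<xi> $ i\<bar> ^ m))"
proof -
  define M where "M = Max (range (\<lambda>i. \<bar>\<xi> $ i\<bar>))"
  have "M \<in> range (\<lambda>i. \<bar>\<xi> $ i\<bar>)" unfolding M_def by (rule Max_in) auto
  then obtain j where j: "M = \<bar>\<xi> $ j\<bar>" by auto
  have le: "\<bar>\<xi> $ i\<bar> \<le> M" for i unfolding M_def by (rule Max_ge) auto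
  have "norm \<xi> \<le> (\<Sum>i\<in>UNIV. \<bar>\<xi> $ i\<bar>)" by (rule norm_le_l1_cart)
  also have "\<dots> \<le> (\<Sum>i\<in>(UNIV::'n set). M)" by (intro sum_mono le)
  finally have "1 + norm \<xi> \<le> 1 + real CARD('n) * M" by simp
  also have "\<dots> \<le> max 1 M + real CARD('n) * max 1 M"
    by (intro add_mono mult_left_mono) auto
  also have "\<dots> = (1 + real CARD('n)) * max 1 M" by (simp add: algebra_simps)
  finally have "(1 + norm \<xi>) ^ m \<le> (1 + real CARD('n)) ^ m * max 1 M ^ m"
    by (metis power_mono power_mult_distrib add_nonneg_nonneg norm_ge_zero zero_le_one)
  also have "max 1 M ^ m \<le> 1 + M ^ m" by (simp add: max_def j)
  also have "M ^ m \<le> (\<Sum>i\<in>UNIV. \<bar>\<xi> $ i\<bar> ^ m)" unfolding j by (rule member_le_sum) auto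
  finally show ?thesis by (simp add: mult_left_mono)
qed

lemma fourier_decay:
  fixes \<phi> :: "real^'n \<Rightarrow> complex"
  assumes \<phi>: "schwartz \<phi>"
  obtains C where "0 \<le> C" "\<And>\<xi>. (1 + norm \<xi>) ^ m * norm (fourier_transform \<phi> \<xi>) \<le> C"
proof -
  define A where "A i = (LINT x|lborel. norm (iterated_partial (replicate m i) \<phi> x))" for i
  define A0 where "A0 = (LINT x|lborel. norm (\<phi> x))"
  have A: "\<bar>\<xi> $ i\<bar> ^ m * norm (fourier_transform \<phi> \<xi>) \<le> A i" for \<xi> i
    using norm_fourier_le[of "iterated_partial (replicate m i) \<phi>" \<xi>]
    by (simp add: A_def fourier_iterated_partial[OF \<phi>] norm_mult norm_power)
  have "(1 + norm \<xi>) ^ m * norm (fourier_transform \<phi> \<xi>) \<le> (1 + real CARD('n)) ^ m * (A0 + (\<Sum>i\<in>UNIV. A i))" for \<xi>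
  proof -
    have "(1 + norm \<xi>) ^ m * norm (fourier_transform \<phi> \<xi>) \<le> 
      (1 + real CARD('n)) ^ m * (1 + (\<Sum>i\<in>UNIV. \<bar>\<xi> $ i\<bar> ^ m)) * norm (fourier_transform \<phi> \<xi>)"
      by (intro mult_right_mono one_plus_norm_power_le) auto
    also have "\<dots> = (1 + real CARD('n)) ^ m * (norm (fourier_transform \<phi> \<xi>) + (\<Sum>i\<in>UNIV. \<bar>\<xi> $ i\<bar> ^ m * norm (fourier_transform \<phi> \<xi>)))"
      by (simp add: distrib_right sum_distrib_right mult.assoc)
    also have "\<dots> \<le> (1 + real CARD('n)) ^ m * (A0 + (\<Sum>i\<in>UNIV. A i))"
      using norm_fourier_le[of \<phi> \<xi>] by (intro mult_left_mono add_mono sum_mono A) (auto simp: A0_def)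
    finally show ?thesis .
  qed
  moreover have "0 \<le> (1 + real CARD('n)) ^ m * (A0 + (\<Sum>i\<in>UNIV. A i))"
    by (auto simp: A0_def A_def intro!: mult_nonneg_nonneg add_nonneg_nonneg sum_nonneg)
  ultimately show ?thesis using that by blast
qed

lemma fourier_schwartz_measurable:
  "schwartz \<phi> \<Longrightarrow> fourier_transform \<phi> \<in> borel_measurable borel"
  by (intro fourier_measurable schwartz_measurable)

lemma fourier_schwartz_integrable:
  assumes \<phi>: "schwartz \<phi>"
  shows "integrable lborel (fourier_transform \<phi>)"
proof -
  obtain C where "\<And>\<xi>. (1 + norm \<xi>) ^ (2 * CARD('a)) * norm (fourier_transform \<phi> \<xi>) \<le> C"
    using fourier_decay[OF \<phi>] by blast
  then show ?thesis
    by (intro integrable_rapid_decay fourier_schwartz_measurable \<phi>)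
qed

text \<open>Gaussian regularisation: the transform is damped by \<open>gauss (\<delta> *\<^sub>R \<eta>)\<close> and \<open>\<delta>\<close> tends to zero.\<close>

lemma fourier_inversion:
  fixes \<phi> :: "real^'n \<Rightarrow> complex"
  assumes \<phi>: "schwartz \<phi>"
  shows "(LINT \<eta>|lborel. fourier_transform \<phi> \<eta> * exp (\<i> * complex_of_real (x \<bullet> \<eta>))) = complex_of_real ((2 * pi) ^ CARD('n)) * \<phi> x"
proof -
  let ?n = "CARD('n)"
  have [measurable]: "\<phi> \<in> borel_measurable borel" by (intro schwartz_measurable \<phi>)
  define \<delta> where "\<delta> k = 1 / real (Suc k)" for k
  have \<delta>: "0 < \<delta> k" "\<delta> k \<noteq> 0" for k by (auto simp: \<delta>_def)
  have \<delta>lim: "\<delta> \<longlonglongrightarrow> 0" unfolding \<delta>_def by (rule lim_1_over_n[THEN LIMSEQ_Suc])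
  define A where "A k = (LINT \<eta>|lborel. fourier_transform \<phi> \<eta> * exp (\<i> * complex_of_real (x \<bullet> \<eta>)) * complex_of_real (gauss (\<delta> k *\<^sub>R \<eta>)))" for k
  have gc: "isCont gauss z" for z :: "real^'n" unfolding gauss_def by (intro continuous_intros) auto
  have A1: "A \<longlonglongrightarrow> (LINT \<eta>|lborel. fourier_transform \<phi> \<eta> * exp (\<i> * complex_of_real (x \<bullet> \<eta>)))"
    unfolding A_def
  proof (rule integral_dominated_convergence[where w = "\<lambda>\<eta>. norm (fourier_transform \<phi> \<eta>)"])
    show "AE \<eta> in lborel. norm (fourier_transform \<phi> \<eta> * exp (\<i> * complex_of_real (x \<bullet> \<eta>)) * complex_of_real (gauss (\<delta> k *\<^sub>R \<eta>))) \<le> norm (fourier_transform \<phi> \<eta>)" for k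
      by (intro AE_I2) (simp add: norm_mult mult_left_le gauss_le_1)
    show "AE \<eta> in lborel. (\<lambda>k. fourier_transform \<phi> \<eta> * exp (\<i> * complex_of_real (x \<bullet> \<eta>)) * complex_of_real (gauss (\<delta> k *\<^sub>R \<eta>)))
       \<longlonglongrightarrow> fourier_transform \<phi> \<eta> * exp (\<i> * complex_of_real (x \<bullet> \<eta>))"
    proof (rule AE_I2)
      fix \<eta> :: "real^'n"
      have "(\<lambda>k. \<delta> k *\<^sub>R \<eta>) \<longlonglongrightarrow> 0" using tendsto_scaleR[OF \<delta>lim tendsto_const, of \<eta>] by simp
      then have "(\<lambda>k. gauss (\<delta> k *\<^sub>R \<eta>)) \<longlonglongrightarrow> gauss (0::real^'n)" by (rule isCont_tendsto_compose[OF gc])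
      then have "(\<lambda>k. complex_of_real (gauss (\<delta> k *\<^sub>R \<eta>))) \<longlonglongrightarrow> 1"
        using tendsto_of_real[of "\<lambda>k. gauss (\<delta> k *\<^sub>R \<eta>)" 1] by simp
      from tendsto_mult[OF tendsto_const this]
      show "(\<lambda>k. fourier_transform \<phi> \<eta> * exp (\<i> * complex_of_real (x \<bullet> \<eta>)) * complex_of_real (gauss (\<delta> k *\<^sub>R \<eta>)))
         \<longlonglongrightarrow> fourier_transform \<phi> \<eta> * exp (\<i> * complex_of_real (x \<bullet> \<eta>))" by simp
    qed
  qed (use fourier_schwartz_integrable[OF \<phi>] in auto)
  \<comment> \<open>Exchanging the integrals puts the transform on the damping Gaussian, which
    becomes a Gaussian of width \<open>\<delta> k\<close> centred at x. Rescaling moves the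
    shrinking width into the argument of \<phi>, where continuity at x gives the limit.\<close>
  have A2: "A = (\<lambda>k. complex_of_real (sqrt (2 * pi) ^ ?n) * (LINT z|lborel. \<phi> (x + \<delta> k *\<^sub>R z) * complex_of_real (gauss z)))"
  proof (rule ext)
    fix k
    define g where "g \<eta> y = \<phi> y * exp (- \<i> * complex_of_real (y \<bullet> \<eta>)) * (exp (\<i> * complex_of_real (x \<bullet> \<eta>)) * complex_of_real (gauss (\<delta> k *\<^sub>R \<eta>)))" for \<eta> y
    have inner: "(LINT \<eta>|lborel. g \<eta> y) = \<phi> y * (complex_of_real (sqrt (2 * pi) ^ ?n) * complex_of_real (gauss ((y - x) /\<^sub>R \<delta> k)) /\<^sub>R \<delta> k ^ ?n)" for y
    proof -
      let ?h = "\<lambda>\<zeta>. complex_of_real (gauss \<zeta>) * exp (- \<i> * complex_of_real (\<zeta> \<bullet> ((y - x) /\<^sub>R \<delta> k)))"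
      have "(LINT \<eta>|lborel. g \<eta> y) = (LINT \<eta>|lborel. \<phi> y * ?h (0 + \<delta> k *\<^sub>R \<eta>))"
      proof (intro Bochner_Integration.integral_cong refl)
        fix \<eta>
        have key: "(0 + \<delta> k *\<^sub>R \<eta>) \<bullet> ((y - x) /\<^sub>R \<delta> k) = y \<bullet> \<eta> - x \<bullet> \<eta>"
          using \<delta>[of k] by (simp add: inner_diff_right inner_commute)
        show "g \<eta> y = \<phi> y * ?h (0 + \<delta> k *\<^sub>R \<eta>)"
          unfolding g_def key by (simp add: right_diff_distrib exp_diff exp_minus field_simps)
      qed
      also have "\<dots> = \<phi> y * ((LINT \<zeta>|lborel. ?h \<zeta>) /\<^sub>R \<bar>\<delta> k\<bar> ^ ?n)"
        by (subst integral_mult_right_zero, subst lborel_integral_affine(2)[OF \<delta>(2)]) auto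
      also have "(LINT \<zeta>|lborel. ?h \<zeta>) = complex_of_real (sqrt (2 * pi) ^ ?n * gauss ((y - x) /\<^sub>R \<delta> k))"
        using has_bochner_integral_fourier_gauss[of "(y - x) /\<^sub>R \<delta> k"] by (simp add: has_bochner_integral_iff)
      finally show ?thesis using \<delta>(1)[of k] by simp
    qed
    have "(LINT y|lborel. g \<eta> y) = fourier_transform \<phi> \<eta> * (exp (\<i> * complex_of_real (x \<bullet> \<eta>)) * complex_of_real (gauss (\<delta> k *\<^sub>R \<eta>)))" for \<eta>
      unfolding g_def fourier_transform_def by (rule integral_mult_left_zero)
    then have "A k = (LINT \<eta>|lborel. LINT y|lborel. g \<eta> y)"
      by (simp add: A_def mult.assoc)
    also have "\<dots> = (LINT y|lborel. LINT \<eta>|lborel. g \<eta> y)"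
    proof (rule lborel_swap_integrals_dominated(1)[where a = "\<lambda>\<eta>. gauss (\<delta> k *\<^sub>R \<eta>)" and b = "\<lambda>y. norm (\<phi> y)"])
      show "integrable lborel (\<lambda>\<eta>. gauss (\<delta> k *\<^sub>R \<eta> :: real^'n))"
        using lborel_integral_affine(1)[OF \<delta>(2), of gauss 0] by simp
      show "norm (g \<eta> y) \<le> gauss (\<delta> k *\<^sub>R \<eta>) * norm (\<phi> y)" for \<eta> y
        by (simp add: g_def norm_mult norm_exp_eq_Re)
      show "(\<lambda>(x, y). g x y) \<in> borel_measurable (borel \<Otimes>\<^sub>M borel)" unfolding g_def by measurable
    qed (use schwartz_integrable[OF \<phi>] in auto)
    also have "\<dots> = (LINT y|lborel. complex_of_real (sqrt (2 * pi) ^ ?n) * (\<phi> y * complex_of_real (gauss ((y - x) /\<^sub>R \<delta> k))) /\<^sub>R \<delta> k ^ ?n)"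
      unfolding inner by (intro Bochner_Integration.integral_cong) auto
    also have "\<dots> = complex_of_real (sqrt (2 * pi) ^ ?n) * ((LINT y|lborel. \<phi> y * complex_of_real (gauss ((y - x) /\<^sub>R \<delta> k))) /\<^sub>R \<delta> k ^ ?n)"
      by simp
    also have "(LINT y|lborel. \<phi> y * complex_of_real (gauss ((y - x) /\<^sub>R \<delta> k))) /\<^sub>R \<delta> k ^ ?n = 
      (LINT z|lborel. \<phi> (x + \<delta> k *\<^sub>R z) * complex_of_real (gauss z))"
      using lborel_integral_affine(2)[OF \<delta>(2)[of k], of "\<lambda>y. \<phi> y * complex_of_real (gauss ((y - x) /\<^sub>R \<delta> k))" x] \<delta>[of k] by simp
    finally show "A k = complex_of_real (sqrt (2 * pi) ^ ?n) * (LINT z|lborel. \<phi> (x + \<delta> k *\<^sub>R z) * complex_of_real (gauss z))" .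
  qed
  have A3: "(\<lambda>k. complex_of_real (sqrt (2 * pi) ^ ?n) * (LINT z|lborel. \<phi> (x + \<delta> k *\<^sub>R z) * complex_of_real (gauss z))) \<longlonglongrightarrow>
     complex_of_real (sqrt (2 * pi) ^ ?n) * (LINT z|lborel. \<phi> x * complex_of_real (gauss (z::real^'n)))"
  proof (intro tendsto_mult tendsto_const)
    obtain C where C: "\<And>x. (1 + norm x) ^ 0 * norm (\<phi> x) \<le> C" using schwartz_decay[OF \<phi>] by blast
    show "(\<lambda>k. LINT z|lborel. \<phi> (x + \<delta> k *\<^sub>R z) * complex_of_real (gauss z)) \<longlonglongrightarrow> (LINT z|lborel. \<phi> x * complex_of_real (gauss (z::real^'n)))"
    proof (rule integral_dominated_convergence[where w = "\<lambda>z. C * gauss z"])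
      show "AE z in lborel. (\<lambda>k. \<phi> (x + \<delta> k *\<^sub>R z) * complex_of_real (gauss z)) \<longlonglongrightarrow> \<phi> x * complex_of_real (gauss z)"
      proof (intro AE_I2 tendsto_mult tendsto_const)
        fix z
        have "(\<lambda>k. x + \<delta> k *\<^sub>R z) \<longlonglongrightarrow> x"
          using tendsto_add[OF tendsto_const tendsto_scaleR[OF \<delta>lim tendsto_const], of x z] by simp
        then show "(\<lambda>k. \<phi> (x + \<delta> k *\<^sub>R z)) \<longlonglongrightarrow> \<phi> x"
          by (rule isCont_tendsto_compose[OF schwartz_isCont[OF \<phi>]])
      qed
      show "AE z in lborel. norm (\<phi> (x + \<delta> k *\<^sub>R z) * complex_of_real (gauss z)) \<le> C * gauss z" for k
        using C by (intro AE_I2) (simp add: norm_mult mult_right_mono less_imp_le)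
    qed auto
  qed
  have "(LINT \<eta>|lborel. fourier_transform \<phi> \<eta> * exp (\<i> * complex_of_real (x \<bullet> \<eta>))) = 
     complex_of_real (sqrt (2 * pi) ^ ?n) * (LINT z|lborel. \<phi> x * complex_of_real (gauss (z::real^'n)))"
    by (rule LIMSEQ_unique[OF A1 A3[folded A2]])
  \<comment> \<open>One factor sqrt (2 pi)^n comes from the transform of the Gaussian, the other
    from its total mass.\<close>
  also have "\<dots> = complex_of_real (sqrt (2 * pi) ^ ?n) * (\<phi> x * complex_of_real (sqrt (2 * pi) ^ ?n))"
    by (simp add: integral_gauss)
  also have "\<dots> = complex_of_real ((2 * pi) ^ ?n) * \<phi> x"
  proof -
    have "complex_of_real (sqrt (2 * pi) ^ ?n) * complex_of_real (sqrt (2 * pi) ^ ?n) = complex_of_real ((2 * pi) ^ ?n)"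
      unfolding of_real_mult[symmetric] power_mult_distrib[symmetric] by simp
    then show ?thesis by (metis mult.assoc mult.commute)
  qed
  finally show ?thesis .
qed

subsection \<open>Modulated Gaussians\<close>

text \<open>Two values of a occur: a = 1 for the test functions, whose autocorrelation then has the
  Gaussian part \<open>gauss\<close>, and a = 1/2 with zero frequency for \<open>gauss\<close>
  itself.\<close>

definition modulated_gauss :: "real \<Rightarrow> real^'n \<Rightarrow> real^'n \<Rightarrow> complex" where
  "modulated_gauss a \<xi> x = exp (complex_of_real (- a * (norm x)\<^sup>2) + \<i> * complex_of_real (x \<bullet> \<xi>))"

text \<open>Polynomials times one modulated Gaussian, given by closure rules instead of a normal
  form: a class stable under differentiation, as \<open>schwartz_coinduct\<close> asks for. The rule
  \<open>coord\<close> supplies the factors that the chain rule produces.\<close>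

inductive gauss_polynomial :: "real \<Rightarrow> real^'n \<Rightarrow> (real^'n \<Rightarrow> complex) \<Rightarrow> bool" for a \<xi> where
  base: "gauss_polynomial a \<xi> (modulated_gauss a \<xi>)"
| add: "gauss_polynomial a \<xi> f \<Longrightarrow> gauss_polynomial a \<xi> g \<Longrightarrow> gauss_polynomial a \<xi> (\<lambda>x. f x + g x)"
| scale: "gauss_polynomial a \<xi> f \<Longrightarrow> gauss_polynomial a \<xi> (\<lambda>x. c * f x)"
| coord: "gauss_polynomial a \<xi> f \<Longrightarrow> gauss_polynomial a \<xi> (\<lambda>x. of_real (x $ i) * f x)"

lemma modulated_gauss_has_derivative:
  "(modulated_gauss a \<xi> has_derivative (\<lambda>v. (of_real (- 2 * a * (x \<bullet> v)) + \<i> * of_real (v \<bullet> \<xi>)) * modulated_gauss a \<xi> x)) (at x)"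
proof -
  have e: "modulated_gauss a \<xi> = (\<lambda>x. exp (complex_of_real (- a * (x \<bullet> x)) + \<i> * complex_of_real (x \<bullet> \<xi>)))"
    by (rule ext) (simp add: modulated_gauss_def power2_norm_eq_inner)
  have q: "((\<lambda>x. complex_of_real (- a * (x \<bullet> x)) + \<i> * complex_of_real (x \<bullet> \<xi>)) has_derivative
      (\<lambda>v. of_real (- 2 * a * (x \<bullet> v)) + \<i> * of_real (v \<bullet> \<xi>))) (at x)"
    by (auto intro!: derivative_eq_intros simp: inner_commute algebra_simps)
  have "(exp has_derivative (\<lambda>z. z * exp y)) (at y)" for y :: complex
    using DERIV_exp[of y] unfolding has_field_derivative_def by (subst mult.commute)
  from has_derivative_compose[OF q this] show ?thesis unfolding e .
qed

lemma modulated_gauss_decay: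
  assumes "0 < a"
  shows "\<exists>C. \<forall>x. (1 + norm x) ^ k * norm (modulated_gauss a \<xi> x) \<le> C"
proof -
  obtain C where C: "0 < C" "\<And>t::real. exp (- t\<^sup>2 / 2) \<le> C * (1 + \<bar>t\<bar>) powr (- real k)"
    using exp_square_le_powr_decay[of "real k"] by auto
  define b where "b = sqrt (2 * a)"
  have b: "0 < b" using assms by (simp add: b_def)
  \<comment> \<open>K is chosen so that K and K b are both at least 1, which gives
    \<open>1 + norm x \<le> K * (1 + b * norm x)\<close>; b itself brings the exponent into the form
    (b |x|)^2 / 2.\<close>
  define K where "K = max 1 (1 / b)"
  have K: "1 \<le> K" "1 \<le> K * b" using b by (auto simp: K_def max_def field_simps)
  have "(1 + norm x) ^ k * norm (modulated_gauss a \<xi> x) \<le> K ^ k * C" for x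
  proof -
    have n: "norm (modulated_gauss a \<xi> x) = exp (- (b * norm x)\<^sup>2 / 2)"
      using assms by (simp add: modulated_gauss_def norm_exp_eq_Re b_def power_mult_distrib)
    have p: "0 < (1 + b * norm x) ^ k" using b by (simp add: add_pos_nonneg)
    have "1 + norm x \<le> K * (1 + b * norm x)"
      using K(1) mult_right_mono[OF K(2), of "norm x"] by (simp add: algebra_simps)
    then have "(1 + norm x) ^ k \<le> K ^ k * (1 + b * norm x) ^ k"
      by (metis power_mono power_mult_distrib add_nonneg_nonneg norm_ge_zero zero_le_one)
    then have "(1 + norm x) ^ k * norm (modulated_gauss a \<xi> x) \<le> (K ^ k * (1 + b * norm x) ^ k) * exp (- (b * norm x)\<^sup>2 / 2)"
      unfolding n by (rule mult_right_mono) simp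
    also have "\<dots> \<le> (K ^ k * (1 + b * norm x) ^ k) * (C / (1 + b * norm x) ^ k)"
    proof (rule mult_left_mono)
      have "exp (- (b * norm x)\<^sup>2 / 2) \<le> C * (1 + \<bar>b * norm x\<bar>) powr (- real k)" by (rule C)
      also have "\<dots> = C / (1 + b * norm x) ^ k"
        using b by (simp add: powr_minus powr_realpow add_pos_nonneg divide_inverse)
      finally show "exp (- (b * norm x)\<^sup>2 / 2) \<le> C / (1 + b * norm x) ^ k" .
    qed (use K(1) b in simp)
    also have "\<dots> = K ^ k * C" using less_imp_neq[OF p] by (simp del: power_eq_0_iff)
    finally show ?thesis .
  qed
  then show ?thesis by blast
qed

text \<open>The three claims share one rule induction, because the formula for the derivative of a
  compound function presupposes differentiability of its parts.\<close>

lemma gauss_polynomial_properties: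
  assumes "gauss_polynomial a \<xi> f" and a: "0 < a"
  shows "(\<forall>x. f differentiable (at x)) \<and> (\<forall>i. gauss_polynomial a \<xi> (partial_derivative i f)) \<and>
    (\<forall>k. \<exists>C. \<forall>x. (1 + norm x) ^ k * norm (f x) \<le> C)"
  using assms(1)
proof induction
  case base
  have "partial_derivative i (modulated_gauss a \<xi>) = 
     (\<lambda>x. complex_of_real (- 2 * a) * (of_real (x $ i) * modulated_gauss a \<xi> x) + (\<i> * of_real (\<xi> $ i)) * modulated_gauss a \<xi> x)" for i
    by (rule ext, subst partial_derivative_eq[OF modulated_gauss_has_derivative])
      (simp add: inner_axis inner_axis' algebra_simps)
  then have "gauss_polynomial a \<xi> (partial_derivative i (modulated_gauss a \<xi>))" for i
    by (simp only:) (intro gauss_polynomial.intros)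
  then show ?case
    using modulated_gauss_has_derivative[of a \<xi>] modulated_gauss_decay[OF a, of _ \<xi>] unfolding differentiable_def by blast
next
  case (add f g)
  have fd: "(f has_derivative frechet_derivative f (at x)) (at x)" "(g has_derivative frechet_derivative g (at x)) (at x)" for x
    using add by (simp_all add: frechet_derivative_works)
  have "partial_derivative i (\<lambda>x. f x + g x) = (\<lambda>x. partial_derivative i f x + partial_derivative i g x)" for i
    using partial_derivative_eq[OF has_derivative_add[OF fd]] by (auto simp: partial_derivative_def)
  moreover have "\<exists>C. \<forall>x. (1 + norm x) ^ k * norm (f x + g x) \<le> C" for k
  proof -
    obtain C D where C: "\<And>x. (1 + norm x) ^ k * norm (f x) \<le> C" and D: "\<And>x. (1 + norm x) ^ k * norm (g x) \<le> D"
      using add by metis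
    have "(1 + norm x) ^ k * norm (f x + g x) \<le> C + D" for x
    proof -
      have "(1 + norm x) ^ k * norm (f x + g x) \<le> (1 + norm x) ^ k * (norm (f x) + norm (g x))"
        by (intro mult_left_mono norm_triangle_ineq) auto
      then show ?thesis using C[of x] D[of x] by (simp add: distrib_left)
    qed
    then show ?thesis by blast
  qed
  ultimately show ?case using add by (auto intro!: gauss_polynomial.intros differentiable_add)
next
  case (scale f c)
  have fd: "(f has_derivative frechet_derivative f (at x)) (at x)" for x
    using scale by (simp add: frechet_derivative_works)
  have "partial_derivative i (\<lambda>x. c * f x) = (\<lambda>x. c * partial_derivative i f x)" for i
    using partial_derivative_eq[OF has_derivative_mult_right[OF fd]] by (auto simp: partial_derivative_def)
  moreover have "(\<lambda>x. c * f x) differentiable (at x)" for x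
    using has_derivative_mult_right[OF fd] unfolding differentiable_def by blast
  moreover have "\<exists>C. \<forall>x. (1 + norm x) ^ k * norm (c * f x) \<le> C" for k
  proof -
    obtain C where C: "\<And>x. (1 + norm x) ^ k * norm (f x) \<le> C"
      using scale by metis
    have "(1 + norm x) ^ k * norm (c * f x) \<le> norm c * C" for x
      using mult_left_mono[OF C[of x], of "norm c"] by (simp add: norm_mult mult_ac)
    then show ?thesis by blast
  qed
  ultimately show ?case using scale by (auto intro!: gauss_polynomial.intros)
next
  case (coord f j)
  have fd: "(f has_derivative frechet_derivative f (at x)) (at x)" for x
    using coord by (simp add: frechet_derivative_works)
  have d: "((\<lambda>x. of_real (x $ j) * f x) has_derivative (\<lambda>v. of_real (x $ j) * frechet_derivative f (at x) v + of_real (v $ j) * f x)) (at x)" for x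
    by (intro has_derivative_mult[OF _ fd] bounded_linear_imp_has_derivative
      bounded_linear_compose[OF bounded_linear_of_real bounded_linear_vec_nth])
  have "partial_derivative i (\<lambda>x. of_real (x $ j) * f x) = (\<lambda>x. of_real (x $ j) * partial_derivative i f x + (if i = j then 1 else 0) * f x)" for i
    using partial_derivative_eq[OF d] by (auto simp: partial_derivative_def axis_def)
  moreover have "(\<lambda>x. of_real (x $ j) * f x) differentiable (at x)" for x
    using d unfolding differentiable_def by blast
  moreover have "\<exists>C. \<forall>x. (1 + norm x) ^ k * norm (of_real (x $ j) * f x) \<le> C" for k
  proof -
    \<comment> \<open>The factor \<open>x $ j\<close> costs one power of the weight, so the decay of
      f is taken at \<open>Suc k\<close>.\<close>
    obtain C where C: "\<And>x. (1 + norm x) ^ Suc k * norm (f x) \<le> C"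
      using coord by metis
    have "(1 + norm x) ^ k * norm (of_real (x $ j) * f x) \<le> C" for x
    proof -
      have "\<bar>x $ j\<bar> \<le> 1 + norm x" using component_le_norm_cart[of x j] by linarith
      then have "\<bar>x $ j\<bar> * ((1 + norm x) ^ k * norm (f x)) \<le> (1 + norm x) * ((1 + norm x) ^ k * norm (f x))"
        by (rule mult_right_mono) auto
      then show ?thesis using C[of x] by (simp add: norm_mult mult_ac)
    qed
    then show ?thesis by blast
  qed
  ultimately show ?case using coord by (auto intro!: gauss_polynomial.intros)
qed

lemma schwartz_modulated_gauss:
  assumes "0 < a"
  shows "schwartz (modulated_gauss a \<xi>)"
proof (rule schwartz_coinduct[where S = "Collect (gauss_polynomial a \<xi>)"])
  show "modulated_gauss a \<xi> \<in> Collect (gauss_polynomial a \<xi>)" by (simp add: gauss_polynomial.base)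
next
  fix g assume "g \<in> Collect (gauss_polynomial a \<xi>)"
  from gauss_polynomial_properties[OF this[simplified] assms]
  show "g differentiable at x" "partial_derivative i g \<in> Collect (gauss_polynomial a \<xi>)"
    "\<exists>C. \<forall>x. (1 + norm x) ^ k * norm (g x) \<le> C" for x i k by simp_all
qed

lemma schwartz_gauss: "schwartz (\<lambda>x::real^'n. complex_of_real (gauss x))"
proof -
  have "(\<lambda>x. complex_of_real (gauss (x::real^'n))) = modulated_gauss (1/2) 0"
    by (rule ext) (simp add: modulated_gauss_def gauss_def flip: exp_of_real)
  then show ?thesis using schwartz_modulated_gauss[of "1/2" 0] by simp
qed

text \<open>The phases multiply to exp (i (x, \<xi>)), free of y, and |y|^2 + |y - x|^2 = |2 y -
  x|^2 / 2 + |x|^2 / 2 separates the variables; the substitution 2 y - x accounts for 2^n. Pairing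
  this autocorrelation with w evaluates a Fourier transform at a single frequency.\<close>

lemma convolution_modulated_gauss:
  fixes \<xi> :: "real^'n"
  shows "convolution (modulated_gauss 1 \<xi>) (\<lambda>x. cnj (modulated_gauss 1 \<xi> (- x))) x =
    complex_of_real (sqrt (2 * pi) ^ CARD('n) / 2 ^ CARD('n)) * (complex_of_real (gauss x) * exp (\<i> * complex_of_real (x \<bullet> \<xi>)))"
proof -
  let ?E = "complex_of_real (gauss x) * exp (\<i> * complex_of_real (x \<bullet> \<xi>))"
  have "convolution (modulated_gauss 1 \<xi>) (\<lambda>x. cnj (modulated_gauss 1 \<xi> (- x))) x =
    (LINT y|lborel. ?E * complex_of_real (gauss (- x + 2 *\<^sub>R y)))"
    unfolding convolution_def
  proof (intro Bochner_Integration.integral_cong refl)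
    fix y :: "real^'n"
    have "(norm y)\<^sup>2 + (norm (y - x))\<^sup>2 = (norm (- x + 2 *\<^sub>R y))\<^sup>2 / 2 + (norm x)\<^sup>2 / 2"
      by (simp add: power2_norm_eq_inner inner_diff_left inner_diff_right inner_add_left inner_add_right inner_commute field_simps)
    then have e: "- (norm y)\<^sup>2 + - (norm (y - x))\<^sup>2 = - (norm x)\<^sup>2 / 2 + - (norm (- x + 2 *\<^sub>R y))\<^sup>2 / 2"
      by simp
    have "modulated_gauss 1 \<xi> y * cnj (modulated_gauss 1 \<xi> (- (x - y))) = 
      exp (complex_of_real (- (norm y)\<^sup>2 + - (norm (y - x))\<^sup>2) + \<i> * complex_of_real (x \<bullet> \<xi>))"
      unfolding modulated_gauss_def by (simp add: exp_cnj mult_exp_exp inner_diff_left algebra_simps)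
    also have "\<dots> = ?E * complex_of_real (gauss (- x + 2 *\<^sub>R y))"
      unfolding e gauss_def by (simp only: of_real_add exp_add exp_of_real mult_ac)
    finally show "modulated_gauss 1 \<xi> y * cnj (modulated_gauss 1 \<xi> (- (x - y))) = ?E * complex_of_real (gauss (- x + 2 *\<^sub>R y))" .
  qed
  also have "\<dots> = ?E * (LINT y|lborel. complex_of_real (gauss (- x + 2 *\<^sub>R y)))"
    by (rule integral_mult_right_zero)
  also have "(LINT y|lborel. complex_of_real (gauss (- x + 2 *\<^sub>R y))) = complex_of_real (sqrt (2 * pi) ^ CARD('n) / 2 ^ CARD('n))"
    using lborel_integral_affine(2)[of 2 gauss "- x"]
    by (simp add: integral_gauss divide_inverse mult.commute)
  finally show ?thesis by (simp add: mult.commute)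
qed

subsection \<open>The weight of a homogeneous space\<close>

lemma nonneg_Reals_cancel:
  assumes "complex_of_real c * z \<in> \<real>\<^sub>\<ge>\<^sub>0" "0 < c"
  shows "z \<in> \<real>\<^sub>\<ge>\<^sub>0"
proof -
  have "complex_of_real (1 / c) * (complex_of_real c * z) \<in> \<real>\<^sub>\<ge>\<^sub>0"
    using assms(2) by (intro nonneg_Reals_mult_I[OF _ assms(1)]) (simp add: nonneg_Reals_of_real_iff del: of_real_divide)
  moreover have "complex_of_real (1 / c) * (complex_of_real c * z) = z" using assms(2) by simp
  ultimately show ?thesis by (simp only:)
qed

locale homogeneous_weight =
  fixes N :: "real^'n \<Rightarrow> real" and p :: real
  assumes homogeneous: "homogeneous_space N" and p_pos: "0 < p" and p_less: "p < real CARD('n)"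
begin

definition w :: "real^'n \<Rightarrow> real" where "w x = N x powr (- p)"

lemma N_continuous: "continuous_on UNIV N" and N_scaleR: "N (t *\<^sub>R x) = \<bar>t\<bar> * N x" and N_pos: "x \<noteq> 0 \<Longrightarrow> 0 < N x"
  using homogeneous by (auto simp: homogeneous_space_def)

lemma N_nonneg: "0 \<le> N x"
  using N_pos[of x] N_scaleR[of 0 x] by (cases "x = 0") auto

lemma w_measurable [measurable]: "w \<in> borel_measurable borel"
proof -
  have [measurable]: "N \<in> borel_measurable borel" by (intro borel_measurable_continuous_onI N_continuous)
  show ?thesis unfolding w_def by measurable
qed

lemma w_nonneg: "0 \<le> w x" by (simp add: w_def)

lemma w_scaleR: "w (t *\<^sub>R x) = \<bar>t\<bar> powr (- p) * w x"
  by (simp add: w_def N_scaleR powr_mult N_nonneg)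

text \<open>Compactness gives N a positive minimum on the unit sphere and homogeneity spreads it to
  all x; the negative exponent turns this lower bound on N into an upper bound on w.\<close>

lemma w_bound: obtains c where "0 < c" "\<And>x. w x \<le> c * norm x powr (- p)"
proof -
  have "sphere (0::real^'n) 1 \<noteq> {}" by simp
  then obtain x0 where x0: "x0 \<in> sphere 0 1" "\<And>x. x \<in> sphere 0 1 \<Longrightarrow> N x0 \<le> N x"
    using continuous_attains_inf[OF compact_sphere _ continuous_on_subset[OF N_continuous subset_UNIV], of 0 1] by blast
  have pos: "0 < N x0" using x0(1) by (intro N_pos) auto
  have "w x \<le> N x0 powr (- p) * norm x powr (- p)" for x
  proof (cases "x = 0")
    case True then show ?thesis using N_scaleR[of 0 0] by (simp add: w_def)
  next
    case False
    have "N x = norm x * N (x /\<^sub>R norm x)" using N_scaleR[of "norm x" "x /\<^sub>R norm x"] False by simp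
    also have "\<dots> \<ge> norm x * N x0" using False by (intro mult_left_mono x0) auto
    finally have "w x \<le> (norm x * N x0) powr (- p)"
      unfolding w_def using False pos p_pos by (intro powr_mono2') auto
    then show ?thesis using pos by (simp add: powr_mult less_imp_le mult.commute)
  qed
  then show ?thesis using pos by (intro that[of "N x0 powr (- p)"]) auto
qed

text \<open>The factor |x|^(-e) serves the perturbed weights, with e = 0 giving w itself. The
  singularity has total order p + e < n, and the decay of \<phi> takes care of infinity.\<close>

lemma integrable_w_decay:
  fixes \<phi> :: "real^'n \<Rightarrow> 'b::{banach, second_countable_topology, real_normed_field}"
  assumes e: "0 \<le> e" "p + e < real CARD('n)" and [measurable]: "\<phi> \<in> borel_measurable borel"
    and C: "\<And>x. (1 + norm x) ^ (2 * CARD('n)) * norm (\<phi> x) \<le> C"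
  shows "integrable lborel (\<lambda>x. of_real (w x * norm x powr (- e)) * \<phi> x)"
proof -
  obtain c where c: "0 < c" "\<And>x. w x \<le> c * norm x powr (- p)" using w_bound by blast
  show ?thesis
  proof (rule Bochner_Integration.integrable_bound)
    show "integrable lborel (\<lambda>x::real^'n. (c * C) * (norm x powr (- (p + e)) * (1 / (1 + norm x) ^ (2 * CARD('n)))))"
      by (intro integrable_mult_right integrable_norm_powr_decay) (use e p_pos in auto)
    show "AE x in lborel. norm (of_real (w x * norm x powr (- e)) * \<phi> x) \<le> norm ((c * C) * (norm x powr (- (p + e)) * (1 / (1 + norm x) ^ (2 * CARD('n)))))"
    proof (rule AE_I2)
      fix x :: "real^'n"
      have "0 < (1 + norm x) ^ (2 * CARD('n))" by (simp add: add_pos_nonneg)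
      then have 1: "norm (\<phi> x) \<le> C * (1 / (1 + norm x) ^ (2 * CARD('n)))"
        using C[of x] by (simp add: field_simps)
      have "norm (of_real (w x * norm x powr (- e)) * \<phi> x) \<le> w x * norm x powr (- e) * norm (\<phi> x)"
        by (simp add: w_nonneg norm_mult)
      also have "\<dots> \<le> (c * norm x powr (- p)) * norm x powr (- e) * (C * (1 / (1 + norm x) ^ (2 * CARD('n))))"
        by (intro mult_mono c 1) (auto simp: w_nonneg less_imp_le[OF c(1)])
      also have "\<dots> = (c * C) * (norm x powr (- (p + e)) * (1 / (1 + norm x) ^ (2 * CARD('n))))"
        using powr_add[of "norm x" "- p" "- e"] by simp
      finally show "norm (of_real (w x * norm x powr (- e)) * \<phi> x) \<le> norm ((c * C) * (norm x powr (- (p + e)) * (1 / (1 + norm x) ^ (2 * CARD('n)))))"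
        by (rule order_trans) (simp only: real_norm_def abs_ge_self)
    qed
  qed measurable
qed

text \<open>At the origin \<open>norm x powr 0\<close> is 0 and not 1, so there the identity rests
  on \<open>w 0 = 0\<close>.\<close>

lemma w_norm_powr_0: "w x * norm x powr (- 0) = w x"
  using N_scaleR[of 0 x] by (cases "x = 0") (auto simp: w_def)

lemma integrable_w_schwartz:
  assumes e: "0 \<le> e" "p + e < real CARD('n)" and \<phi>: "schwartz \<phi>"
  shows "integrable lborel (\<lambda>x. complex_of_real (w x * norm x powr (- e)) * \<phi> x)"
proof -
  obtain C where "\<And>x. (1 + norm x) ^ (2 * CARD('n)) * norm (\<phi> x) \<le> C" using schwartz_decay[OF \<phi>] by blast
  then show ?thesis by (intro integrable_w_decay e schwartz_measurable \<phi>)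
qed

lemma integrable_w_gauss: 
  assumes e: "0 \<le> e" "p + e < real CARD('n)"
  shows "integrable lborel (\<lambda>x. w x * norm x powr (- e) * gauss x)"
  using integrable_w_schwartz[OF e schwartz_gauss] unfolding of_real_mult[symmetric] complex_of_real_integrable_eq .

section \<open>The weight as a tempered distribution and its positivity\<close>

abbreviation T :: "(real^'n \<Rightarrow> complex) \<Rightarrow> complex" where
  "T \<equiv> function_distribution (\<lambda>x. N x powr (- p))"

lemma T_eq: "T \<phi> = (LINT x|lborel. complex_of_real (w x) * \<phi> x)"
  by (simp add: function_distribution_def w_def)

lemma integrable_T: "schwartz \<phi> \<Longrightarrow> integrable lborel (\<lambda>x. complex_of_real (w x) * \<phi> x)"
  using integrable_w_schwartz[of 0 \<phi>] p_less unfolding w_norm_powr_0 by simp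

lemma tempered_T: "tempered_distribution T"
  unfolding tempered_distribution_def
proof (intro conjI allI impI exI)
  fix \<phi> \<psi> :: "real^'n \<Rightarrow> complex" assume "schwartz \<phi>" "schwartz \<psi>"
  then show "T (\<lambda>x. \<phi> x + \<psi> x) = T \<phi> + T \<psi>"
    using integrable_T by (simp add: T_eq distrib_left)
next
  fix c \<phi> assume "schwartz (\<phi> :: real^'n \<Rightarrow> complex)"
  have "(\<lambda>x. complex_of_real (w x) * (c * \<phi> x)) = (\<lambda>x. c * (complex_of_real (w x) * \<phi> x))" by auto
  then show "T (\<lambda>x. c * \<phi> x) = c * T \<phi>" by (simp add: T_eq)
next
  \<comment> \<open>The final \<open>show\<close> supplies the witnesses: order 2 n, and as constant
    the integral of \<open>w x * d x\<close>. The seminorm of the empty list alone dominates, and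
    the remaining terms of the sum are nonnegative.\<close>
  let ?m = "2 * CARD('n)"
  define d where "d x = 1 / (1 + norm x) ^ ?m" for x :: "real^'n"
  have d0: "0 < (1 + norm x) ^ ?m" for x :: "real^'n" by (simp add: add_pos_nonneg)
  have [measurable]: "d \<in> borel_measurable borel" unfolding d_def by measurable
  have "integrable lborel (\<lambda>x. of_real (w x * norm x powr (- 0)) * d x)"
    by (rule integrable_w_decay[where C = 1]) (use p_less d0 in \<open>auto simp: d_def less_imp_neq[symmetric] less_imp_le\<close>)
  then have di: "integrable lborel (\<lambda>x. w x * d x)" unfolding w_norm_powr_0 by simp
  fix \<phi> :: "real^'n \<Rightarrow> complex" assume \<phi>: "schwartz \<phi>"
  have bdd: "bdd_above (range (\<lambda>x. (1 + norm x) ^ ?m * cmod (iterated_partial is \<phi> x)))" for "is"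
  proof -
    obtain C where "\<And>x. (1 + norm x) ^ ?m * norm (iterated_partial is \<phi> x) \<le> C" using schwartz_bound[OF \<phi>] by blast
    then show ?thesis by (auto intro!: bdd_aboveI)
  qed
  have sn: "(1 + norm x) ^ ?m * cmod (iterated_partial is \<phi> x) \<le> schwartz_seminorm ?m is \<phi>" for "is" x
    unfolding schwartz_seminorm_def by (rule cSUP_upper[OF _ bdd]) simp
  have sn0: "0 \<le> schwartz_seminorm ?m is \<phi>" for "is"
    by (rule order_trans[OF _ sn[of 0]]) simp
  have fin: "finite {is :: 'n list. length is \<le> ?m}"
    using finite_lists_length_le[of "UNIV :: 'n set" ?m] by simp
  have "cmod (T \<phi>) \<le> (LINT x|lborel. w x * d x * schwartz_seminorm ?m [] \<phi>)"
    unfolding T_eq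
  proof (rule Bochner_Integration.integral_norm_bound_integral[OF integrable_T[OF \<phi>]])
    show "integrable lborel (\<lambda>x. w x * d x * schwartz_seminorm ?m [] \<phi>)" using di by simp
    fix x
    have "cmod (\<phi> x) \<le> d x * schwartz_seminorm ?m [] \<phi>"
      using sn[of x "[]"] d0[of x] by (simp add: d_def field_simps)
    then show "norm (complex_of_real (w x) * \<phi> x) \<le> w x * d x * schwartz_seminorm ?m [] \<phi>"
      by (simp add: norm_mult w_nonneg mult_left_mono mult.assoc)
  qed
  also have "\<dots> = (LINT x|lborel. w x * d x) * schwartz_seminorm ?m [] \<phi>" by simp
  also have "\<dots> \<le> (LINT x|lborel. w x * d x) * (\<Sum>is | length is \<le> ?m. schwartz_seminorm ?m is \<phi>)"
  proof (rule mult_left_mono)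
    show "schwartz_seminorm ?m [] \<phi> \<le> (\<Sum>is | length is \<le> ?m. schwartz_seminorm ?m is \<phi>)"
      by (rule member_le_sum[OF _ _ fin]) (auto simp: sn0)
    show "0 \<le> (LINT x|lborel. w x * d x)"
      using d0 by (intro Bochner_Integration.integral_nonneg mult_nonneg_nonneg w_nonneg) (auto simp: d_def)
  qed
  finally show "cmod (T \<phi>) \<le> (LINT x|lborel. w x * d x) * (\<Sum>is | length is \<le> ?m. schwartz_seminorm ?m is \<phi>)" .
qed

lemma embeds_imp_positive_definite:
  assumes "embeds_in_L_neg N p"
  shows "positive_definite_distribution T"
  unfolding positive_definite_distribution_def
proof (intro conjI allI impI tempered_T)
  fix \<phi> :: "real^'n \<Rightarrow> complex" assume \<phi>: "schwartz \<phi>"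
  let ?\<psi> = "\<lambda>x. cnj (\<phi> (- x))"
  have \<psi>: "schwartz ?\<psi>" by (rule schwartz_cnj_uminus[OF \<phi>])
  obtain \<gamma> :: "(real^'n) measure" where \<gamma>: "\<And>\<phi>. schwartz \<phi> \<Longrightarrow>
      (LINT x|lborel. complex_of_real (N x powr (- p)) * \<phi> x) =
           (LINT \<xi>|\<gamma>. (LINT t|lborel. complex_of_real (\<bar>t\<bar> powr (p - 1)) * fourier_transform \<phi> (t *\<^sub>R \<xi>)))"
    using assms unfolding embeds_in_L_neg_def by blast
  have "T (convolution \<phi> ?\<psi>) = (LINT \<xi>|\<gamma>. (LINT t|lborel. complex_of_real (\<bar>t\<bar> powr (p - 1)) * fourier_transform (convolution \<phi> ?\<psi>) (t *\<^sub>R \<xi>)))"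
    unfolding function_distribution_def by (rule \<gamma>[OF schwartz_convolution[OF \<phi> \<psi>]])
  also have "\<dots> = (LINT \<xi>|\<gamma>. (LINT t|lborel. complex_of_real (\<bar>t\<bar> powr (p - 1) * (cmod (fourier_transform \<phi> (t *\<^sub>R \<xi>)))\<^sup>2)))"
    by (simp add: fourier_convolution[OF \<phi> \<psi>] fourier_cnj_uminus[OF \<phi>] complex_norm_square del: of_real_power)
  also have "\<dots> = complex_of_real (LINT \<xi>|\<gamma>. (LINT t|lborel. \<bar>t\<bar> powr (p - 1) * (cmod (fourier_transform \<phi> (t *\<^sub>R \<xi>)))\<^sup>2))"
    unfolding integral_complex_of_real ..
  \<comment> \<open>A Bochner integral of a nonnegative function is nonnegative even if it diverges,
    since its value is then 0 by convention.\<close>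
  also have "\<dots> \<in> \<real>\<^sub>\<ge>\<^sub>0"
    unfolding nonneg_Reals_of_real_iff by (intro Bochner_Integration.integral_nonneg) auto
  finally show "T (convolution \<phi> ?\<psi>) \<in> \<real>\<^sub>\<ge>\<^sub>0" .
qed

lemma fourier_w_gauss_nonneg:
  assumes "positive_definite_distribution T"
  shows "fourier_transform (\<lambda>x. complex_of_real (w x * gauss x)) \<xi> \<in> \<real>\<^sub>\<ge>\<^sub>0"
proof -
  \<comment> \<open>The frequency -\<xi> matches the sign in the kernel exp (-i (x, \<xi>)) of the
    transform.\<close>
  let ?\<phi> = "modulated_gauss 1 (- \<xi>)" and ?c = "sqrt (2 * pi) ^ CARD('n) / 2 ^ CARD('n)"
  have "T (convolution ?\<phi> (\<lambda>x. cnj (?\<phi> (- x)))) \<in> \<real>\<^sub>\<ge>\<^sub>0"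
    using assms schwartz_modulated_gauss[of 1 "- \<xi>"] by (simp add: positive_definite_distribution_def)
  also have "T (convolution ?\<phi> (\<lambda>x. cnj (?\<phi> (- x)))) =
    (LINT x|lborel. complex_of_real ?c * (complex_of_real (w x * gauss x) * exp (- \<i> * complex_of_real (x \<bullet> \<xi>))))"
    unfolding T_eq convolution_modulated_gauss by (intro Bochner_Integration.integral_cong) auto
  also have "\<dots> = complex_of_real ?c * fourier_transform (\<lambda>x. complex_of_real (w x * gauss x)) \<xi>"
    unfolding fourier_transform_def by (rule integral_mult_right_zero)
  finally show ?thesis
    by (rule nonneg_Reals_cancel) simp
qed

end

subsection \<open>Weak compactness via a space-filling curve\<close>

text \<open>Schoenberg's curve. The function below is continuous and 2-periodic, vanishes on \<open>[0, 1/3]\<close> and is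
  \<open>1\<close> on \<open>[2/3, 1]\<close>; evaluated at \<open>3 ^ k * t\<close> it reads off the \<open>k\<close>-th digit of a Cantor number \<open>t\<close>.\<close>

definition digit_fun :: "real \<Rightarrow> real" where
  "digit_fun u = max 0 (min 1 (1 / 2 - cos (pi * u)))"

lemma digit_fun_bounds: "0 \<le> digit_fun u" "digit_fun u \<le> 1"
  by (auto simp: digit_fun_def)

lemma digit_fun_continuous: "continuous_on A digit_fun"
  unfolding digit_fun_def by (intro continuous_intros)

lemma digit_fun_periodic: "digit_fun (2 * real m + u) = digit_fun u"
proof -
  have "cos (pi * (2 * real m + u)) = cos (pi * u + 2 * real m * pi)" by (simp add: algebra_simps)
  also have "\<dots> = cos (pi * u)" by (simp add: cos_add)
  finally show ?thesis by (simp add: digit_fun_def)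
qed

lemma digit_fun_0:
  assumes "0 \<le> u" "u \<le> 1 / 3" shows "digit_fun u = 0"
proof -
  have "cos (pi / 3) \<le> cos (pi * u)"
    using assms by (intro cos_monotone_0_pi_le) (auto simp: mult_left_le)
  then show ?thesis by (simp add: digit_fun_def cos_60)
qed

lemma digit_fun_1:
  assumes "2 / 3 \<le> u" "u \<le> 1" shows "digit_fun u = 1"
proof -
  have "cos (pi * u) \<le> cos (2 * pi / 3)"
    using assms by (intro cos_monotone_0_pi_le) (auto simp: mult_left_le)
  then show ?thesis by (simp add: digit_fun_def cos_120)
qed

text \<open>The number is the sum of 2 a_j / 3^(j+1). Multiplying by 3^k moves the first k digits
  before the point, where, all being 0 or 2, they form an even integer that 2-periodicity discards;
  the tail lies in [0, 1/3] or [2/3, 1] according to a_k.\<close>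

lemma cantor_number:
  fixes a :: "nat \<Rightarrow> bool"
  obtains t where "0 \<le> t" "t \<le> 1" "\<And>k. digit_fun (3 ^ k * t) = of_bool (a k)"
proof -
  define c where "c j = 2 * of_bool (a j) / (3::real) ^ (j + 1)" for j
  have c0: "0 \<le> c j" for j by (simp add: c_def)
  have geo: "(\<lambda>j. 2 / 3 ^ (j + 1)) sums (1::real)"
    using sums_mult[OF geometric_sums[of "1/3::real"], of "2/3"] by (simp add: power_divide mult.commute)
  have le: "c j \<le> 2 / 3 ^ (j + 1)" for j by (simp add: c_def)
  have summ: "summable c"
    by (rule summable_comparison_test'[OF sums_summable[OF geo], of 0]) (use le c0 in auto)
  define v where "v k = (\<Sum>m. 2 * of_bool (a (m + k)) / (3::real) ^ (m + 1))" for k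
  have summv: "summable (\<lambda>m. 2 * of_bool (a (m + k)) / (3::real) ^ (m + 1))" for k
    by (rule summable_comparison_test'[OF sums_summable[OF geo], of 0]) auto
  have v0: "0 \<le> v k" for k unfolding v_def by (intro suminf_nonneg summv) auto
  have v1: "v k \<le> 1" for k
    unfolding v_def using suminf_le[OF _ summv sums_summable[OF geo]] sums_unique[OF geo] by auto
  have vrec: "v k = 2 * of_bool (a k) / 3 + v (Suc k) / 3" for k
  proof -
    have "v k = (\<Sum>m. 2 * of_bool (a (Suc m + k)) / (3::real) ^ (Suc m + 1)) + 2 * of_bool (a (0 + k)) / 3 ^ (0 + 1)"
      unfolding v_def by (subst suminf_split_head[OF summv]) simp
    also have "(\<Sum>m. 2 * of_bool (a (Suc m + k)) / (3::real) ^ (Suc m + 1)) = v (Suc k) / 3"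
      unfolding v_def using suminf_divide[OF summv[of "Suc k"], of 3] by (simp add: field_simps)
    finally show ?thesis by simp
  qed
  have main: "3 ^ k * v 0 = 2 * real (\<Sum>j<k. of_bool (a j) * 3 ^ (k - 1 - j)) + v k" for k
  proof (induction k)
    case (Suc k)
    have "(\<Sum>j<k. of_bool (a j) * 3 ^ (Suc k - 1 - j)) = 3 * (\<Sum>j<k. of_bool (a j) * 3 ^ (k - 1 - j) :: nat)"
      unfolding sum_distrib_left
    proof (rule sum.cong[OF refl])
      fix j assume "j \<in> {..<k}"
      then have "Suc k - 1 - j = Suc (k - 1 - j)" by auto
      then show "of_bool (a j) * 3 ^ (Suc k - 1 - j) = 3 * (of_bool (a j) * 3 ^ (k - 1 - j) :: nat)" by simp
    qed
    then have "2 * real (\<Sum>j<Suc k. of_bool (a j) * 3 ^ (Suc k - 1 - j)) + v (Suc k) = 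
       3 * (2 * real (\<Sum>j<k. of_bool (a j) * 3 ^ (k - 1 - j))) + 2 * of_bool (a k) + v (Suc k)"
      by (simp only: sum.lessThan_Suc) simp
    moreover have "2 * of_bool (a k) + v (Suc k) = 3 * v k" using vrec[of k] by simp
    ultimately show ?case using Suc by simp
  qed simp
  have "digit_fun (3 ^ k * v 0) = of_bool (a k)" for k
  proof -
    have "digit_fun (3 ^ k * v 0) = digit_fun (v k)" unfolding main by (rule digit_fun_periodic)
    also have "\<dots> = of_bool (a k)"
      using vrec[of k] v0[of "Suc k"] v1[of "Suc k"] v0[of k] v1[of k] by (cases "a k") (auto intro!: digit_fun_0 digit_fun_1)
    finally show ?thesis .
  qed
  then show ?thesis using that[of "v 0"] v0 v1 by blast
qed

text \<open>Iteration of the doubling map: \<open>r k\<close> is the fractional part of 2^k y,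
  \<open>b k\<close> records whether it has reached 1/2, and the partial sum of length m misses y by
  \<open>r m / 2 ^ m\<close>. The strict bound y < 1 makes y its own fractional part at the
  start.\<close>

lemma binary_expansion:
  fixes y :: real
  assumes "0 \<le> y" "y < 1"
  obtains b :: "nat \<Rightarrow> bool" where "(\<lambda>k. of_bool (b k) / 2 ^ Suc k) sums y"
proof -
  define r where "r k = frac (2 ^ k * y)" for k
  define b where "b k \<longleftrightarrow> 1 / 2 \<le> r k" for k
  have rrec: "r (Suc k) = 2 * r k - of_bool (b k)" for k
  proof -
    have "r (Suc k) = frac (2 * r k + of_int (2 * \<lfloor>2 ^ k * y\<rfloor>))"
      unfolding r_def by (simp add: frac_def algebra_simps)
    also have "\<dots> = frac (2 * r k)" by (simp only: frac_add_of_int_right)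
    also have "\<dots> = 2 * r k - of_bool (b k)"
    proof -
      have "0 \<le> r k" "r k < 1" by (auto simp: r_def frac_lt_1)
      then show ?thesis unfolding b_def by (intro frac_unique_iff[THEN iffD2] conjI) auto
    qed
    finally show ?thesis .
  qed
  have part: "(\<Sum>k<m. of_bool (b k) / 2 ^ Suc k) = y - r m / 2 ^ m" for m
  proof (induction m)
    case 0
    have "frac y = y" using assms by (simp add: frac_eq)
    then show ?case by (simp add: r_def)
  next
    case (Suc m)
    then show ?case by (simp add: rrec field_simps)
  qed
  have "(\<lambda>m. y - r m / 2 ^ m) \<longlonglongrightarrow> y - 0"
  proof (intro tendsto_diff tendsto_const)
    show "(\<lambda>m. r m / 2 ^ m) \<longlonglongrightarrow> 0"
    proof (rule tendsto_sandwich[of "\<lambda>_. 0" _ _ "\<lambda>m. (1/2) ^ m"])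
      show "\<forall>\<^sub>F m in sequentially. r m / 2 ^ m \<le> (1 / 2) ^ m"
        using frac_lt_1[of "2 ^ m * y" for m] by (intro always_eventually allI) (simp add: r_def power_divide divide_right_mono less_imp_le)
      show "(\<lambda>m. (1 / 2 :: real) ^ m) \<longlonglongrightarrow> 0" by (rule LIMSEQ_realpow_zero) auto
    qed (auto simp: r_def)
  qed
  then have "(\<lambda>k. of_bool (b k) / 2 ^ Suc k) sums y"
    unfolding sums_def part by simp
  then show ?thesis by (rule that)
qed

text \<open>Coordinate i reads the digits in positions congruent to \<open>idx i\<close> modulo n
  and uses them as binary digits, so one Cantor number prescribes all coordinates independently.
  Continuity follows from the Weierstrass test, the k-th term being at most 2^(-k-1).\<close>

lemma space_filling_curve:
  obtains F :: "real \<Rightarrow> real^'n" where "continuous_on UNIV F"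
    "\<And>y. (\<And>i. 0 \<le> y $ i \<and> y $ i < 1) \<Longrightarrow> \<exists>t. 0 \<le> t \<and> t \<le> 1 \<and> F t = y"
proof -
  let ?n = "CARD('n)"
  obtain idx :: "'n \<Rightarrow> nat" where idx: "bij_betw idx UNIV {0..<?n}"
    using ex_bij_betw_finite_nat[of "UNIV :: 'n set"] by auto
  have idx_less: "idx i < ?n" for i using idx by (auto simp: bij_betw_def)
  define f where "f i k t = digit_fun (3 ^ (?n * k + idx i) * t) / 2 ^ Suc k" for i k and t :: real
  define F where "F t = (\<chi> i. \<Sum>k. f i k t)" for t
  have "continuous_on UNIV (\<lambda>t. \<Sum>k. f i k t)" for i
  proof (rule uniform_limit_theorem)
    have "uniform_limit UNIV (\<lambda>m t. \<Sum>k<m. f i k t) (\<lambda>t. \<Sum>k. f i k t) sequentially"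
    proof (rule Weierstrass_m_test)
      show "norm (f i k t) \<le> (1/2) ^ Suc k" for k t
        using digit_fun_bounds[of "3 ^ (?n * k + idx i) * t"] by (simp add: f_def power_divide divide_right_mono)
      show "summable (\<lambda>k. (1 / 2 :: real) ^ Suc k)"
        by (intro summable_Suc_iff[THEN iffD2] summable_geometric) auto
    qed
    then show "uniform_limit UNIV (\<lambda>m t. \<Sum>k<m. f i k t) (\<lambda>t. \<Sum>k. f i k t) sequentially" .
    show "\<forall>\<^sub>F m in sequentially. continuous_on UNIV (\<lambda>t. \<Sum>k<m. f i k t)"
      unfolding f_def by (intro always_eventually allI continuous_on_sum continuous_on_divide continuous_on_const
          continuous_on_compose2[OF digit_fun_continuous[of UNIV]] continuous_intros) auto
  qed auto
  then have "continuous_on UNIV F"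
    unfolding F_def by (intro continuous_on_vec_lambda)
  moreover have "\<exists>t. 0 \<le> t \<and> t \<le> 1 \<and> F t = y" if y: "\<And>i. 0 \<le> y $ i \<and> y $ i < 1" for y
  proof -
    have "\<forall>i. \<exists>b :: nat \<Rightarrow> bool. (\<lambda>k. of_bool (b k) / 2 ^ Suc k) sums (y $ i)"
      using binary_expansion y by metis
    then obtain b where b: "\<And>i. (\<lambda>k. of_bool (b i k) / 2 ^ Suc k) sums (y $ i)" by metis
    \<comment> \<open>The digit sequences of the coordinates are interleaved: the remainder of j
      selects the coordinate, the quotient the binary place.\<close>
    define a where "a j = b (inv_into UNIV idx (j mod ?n)) (j div ?n)" for j
    have a: "a (?n * k + idx i) = b i k" for i k
      using idx_less[of i] idx by (simp add: a_def bij_betw_def inv_into_f_f)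
    obtain t where t: "0 \<le> t" "t \<le> 1" "\<And>k. digit_fun (3 ^ k * t) = of_bool (a k)"
      using cantor_number[of a] by blast
    have "F t $ i = y $ i" for i
      using sums_unique[OF b[of i]] by (simp add: F_def f_def t(3) a)
    then show ?thesis using t by (auto simp: vec_eq_iff)
  qed
  ultimately show ?thesis using that by blast
qed

lemma compact_continuous_image_of_interval:
  fixes K :: "(real^'n) set"
  assumes K: "compact K"
  obtains G :: "real \<Rightarrow> real^'n" where "continuous_on UNIV G" "compact (range G)"
    "\<And>y. y \<in> K \<Longrightarrow> \<exists>t\<in>{0..1}. G t = y"
proof -
  obtain F :: "real \<Rightarrow> real^'n" where F: "continuous_on UNIV F"
    "\<And>y. (\<And>i. 0 \<le> y $ i \<and> y $ i < 1) \<Longrightarrow> \<exists>t. 0 \<le> t \<and> t \<le> 1 \<and> F t = y"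
    using space_filling_curve by blast
  obtain B where B: "0 < B" "\<And>y. y \<in> K \<Longrightarrow> norm y \<le> B"
    using compact_imp_bounded[OF K] by (auto simp: bounded_pos)
  \<comment> \<open>Points of K have coordinates in [-B, B], which the inverse affine map sends into
    [1/4, 3/4], safely inside the half-open cube that F covers. Clamping t to [0, 1] makes the range
    of G compact.\<close>
  define G where "G t = (4 * B) *\<^sub>R F (max 0 (min 1 t)) - (\<chi> i. 2 * B)" for t
  have cont: "continuous_on UNIV G"
    unfolding G_def by (intro continuous_intros continuous_on_compose2[OF F(1)]) auto
  have "range G \<subseteq> G ` {0..1}"
  proof safe
    fix t :: real
    have "G t = G (max 0 (min 1 t))" by (simp add: G_def)
    then show "G t \<in> G ` {0..1}" by (rule image_eqI) auto
  qed
  then have "range G = G ` {0..1}" by auto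
  then have "compact (range G)"
    using compact_continuous_image[OF continuous_on_subset[OF cont] compact_Icc, of 0 1] by simp
  moreover have "\<exists>t\<in>{0..1}. G t = y" if y: "y \<in> K" for y
  proof -
    define z where "z = (y + (\<chi> i. 2 * B)) /\<^sub>R (4 * B)"
    have "0 \<le> z $ i \<and> z $ i < 1" for i
    proof -
      have "\<bar>y $ i\<bar> \<le> B" using component_le_norm_cart[of y i] B(2)[OF y] by linarith
      then have "0 \<le> y $ i + 2 * B" "y $ i + 2 * B < 4 * B" using B(1) by (auto simp: abs_le_iff)
      then show ?thesis using B(1) by (simp add: z_def field_simps)
    qed
    then obtain t where t: "0 \<le> t" "t \<le> 1" "F t = z" using F(2) by blast
    then have "G t = y" using B(1) by (simp add: G_def z_def)
    then show ?thesis using t by auto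
  qed
  ultimately show ?thesis using that cont by blast
qed

text \<open>The section picks the least parameter mapped to y. Its sublevel sets within K are then
  traces on K of images of compact intervals, hence closed, and this gives measurability.\<close>

lemma borel_section:
  fixes G :: "real \<Rightarrow> 'a::euclidean_space"
  assumes G: "continuous_on UNIV G" and K: "compact K" and onto: "\<And>y. y \<in> K \<Longrightarrow> \<exists>t\<in>{0..1}. G t = y"
  obtains s where "s \<in> borel_measurable borel" "\<And>y. 0 \<le> s y \<and> s y \<le> 1" "\<And>y. y \<in> K \<Longrightarrow> G (s y) = y"
proof -
  define s where "s y = (if y \<in> K then Inf {t \<in> {0..1}. G t = y} else 0)" for y
  have s: "s y \<in> {t \<in> {0..1}. G t = y}" "\<And>t. t \<in> {0..1} \<Longrightarrow> G t = y \<Longrightarrow> s y \<le> t" if y: "y \<in> K" for y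
  proof -
    let ?S = "{t \<in> {0..1}. G t = y}"
    have "closed ({0..1} \<inter> G -` {y})"
      using continuous_closed_preimage[OF continuous_on_subset[OF G] closed_atLeastAtMost closed_singleton, of 0 1 y] by simp
    also have "{0..1} \<inter> G -` {y} = ?S" by auto
    finally have "closed ?S" .
    moreover have "?S \<noteq> {}" using onto[OF y] by auto
    moreover have bdd: "bdd_below ?S" by (auto intro: bdd_belowI[of _ 0])
    ultimately have "Inf ?S \<in> ?S" by (intro closed_contains_Inf)
    then show "s y \<in> ?S" using y by (simp add: s_def)
    show "s y \<le> t" if "t \<in> {0..1}" "G t = y" for t
      using cInf_lower[OF _ bdd, of t] that y by (simp add: s_def)
  qed
  have cl: "closed K" using K by (rule compact_imp_closed)
  have "{y \<in> space borel. s y \<le> a} \<in> sets borel" for a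
  proof -
    have "{y \<in> K. s y \<le> a} = K \<inter> G ` ({0..1} \<inter> {..a})"
    proof safe
      fix y assume "y \<in> K" "s y \<le> a"
      then show "y \<in> G ` ({0..1} \<inter> {..a})" using s(1)[of y] by (intro image_eqI[of _ _ "s y"]) auto
    next
      fix t assume "G t \<in> K" "t \<in> {0..1}" "t \<le> a"
      then show "s (G t) \<le> a" using s(2)[of "G t" t] by simp
    qed
    moreover have "compact ({0..1} \<inter> {..a})" by (intro compact_Int_closed compact_Icc closed_atMost)
    then have "closed (G ` ({0..1} \<inter> {..a}))"
      by (intro compact_imp_closed compact_continuous_image continuous_on_subset[OF G]) auto
    ultimately have 1: "{y \<in> K. s y \<le> a} \<in> sets borel" using cl by (simp add: borel_closed)
    have "{y \<in> space borel. s y \<le> a} = {y \<in> K. s y \<le> a} \<union> (if 0 \<le> a then - K else {})"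
      by (auto simp: s_def)
    also have "\<dots> \<in> sets borel" using 1 cl by (intro sets.Un) (auto intro: borel_closed)
    finally show ?thesis .
  qed
  then have "s \<in> borel_measurable borel" by (simp add: borel_measurable_iff_le)
  moreover have "0 \<le> s y \<and> s y \<le> 1" for y using s(1)[of y] by (cases "y \<in> K") (auto simp: s_def)
  moreover have "G (s y) = y" if "y \<in> K" for y using s(1)[OF that] by simp
  ultimately show ?thesis using that by blast
qed

text \<open>The measures travel to the line by s and the limit returns by G. Since G (s x) = x on K,
  integrating h against \<open>P k\<close> is integrating the bounded continuous function h o G
  against the image; s is merely Borel, but only the continuous G meets the limit. Continuity of h
  is demanded on K alone because ray integrals are singular at the origin.\<close>

lemma weak_compactness_on_compact:
  fixes P :: "nat \<Rightarrow> (real^'n) measure"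
  assumes prob: "\<And>k. prob_space (P k)" and sets [measurable_cong]: "\<And>k. sets (P k) = sets borel"
    and K: "compact K" and AEK: "\<And>k. AE x in P k. x \<in> K"
  obtains r Q where "strict_mono (r :: nat \<Rightarrow> nat)" "prob_space Q" "sets Q = sets borel" "AE x in Q. x \<in> K"
    "\<And>h :: real^'n \<Rightarrow> complex. h \<in> borel_measurable borel \<Longrightarrow> continuous_on K h \<Longrightarrow> (\<lambda>k. LINT x|P (r k). h x) \<longlonglongrightarrow> (LINT x|Q. h x)"
proof -
  obtain G :: "real \<Rightarrow> real^'n" where G: "continuous_on UNIV G" "compact (range G)" "\<And>y. y \<in> K \<Longrightarrow> \<exists>t\<in>{0..1}. G t = y"
    using compact_continuous_image_of_interval[OF K] by blast
  obtain s where s [measurable]: "s \<in> borel_measurable borel" and s01: "\<And>y. 0 \<le> s y \<and> s y \<le> 1" and Gs: "\<And>y. y \<in> K \<Longrightarrow> G (s y) = y"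
    using borel_section[OF G(1) K G(3)] by blast
  have [measurable]: "G \<in> borel_measurable borel" by (intro borel_measurable_continuous_onI G)
  define \<mu> where "\<mu> k = distr (P k) borel s" for k
  have sP: "s \<in> P k \<rightarrow>\<^sub>M borel" for k by measurable
  have rd: "real_distribution (\<mu> k)" for k
    unfolding real_distribution_def real_distribution_axioms_def \<mu>_def
    using prob_space.prob_space_distr[OF prob sP] by simp
  have "tight \<mu>"
    unfolding tight_def
  proof (intro conjI allI impI rd)
    fix \<epsilon> :: real assume "0 < \<epsilon>"
    \<comment> \<open>The images live on [0, 1]; tightness is formulated with intervals open on the
      left, so the left end is -1 rather than 0.\<close>
    have "measure (\<mu> k) {-1<..1} = 1" for k
    proof -
      have "s -` {-1<..1} \<inter> space (P k) = space (P k)"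
        using s01 less_le_trans[of "-1" 0 "s y" for y] by auto
      then show ?thesis
        unfolding \<mu>_def using prob_space.prob_space[OF prob] by (subst measure_distr[OF sP]) auto
    qed
    then show "\<exists>a b. a < b \<and> (\<forall>n. 1 - \<epsilon> < measure (\<mu> n) {a<..b})"
      using \<open>0 < \<epsilon>\<close> by (intro exI[of _ "-1"] exI[of _ 1]) auto
  qed
  then obtain r M where r: "strict_mono (r :: nat \<Rightarrow> nat)" and M: "real_distribution M" and wc: "weak_conv_m (\<mu> \<circ> id \<circ> r) M"
    using tight_imp_convergent_subsubsequence[of \<mu> id] by (auto simp: strict_mono_id)
  interpret M: real_distribution M by (rule M)
  define Q where "Q = distr M borel G"
  have GM: "G \<in> M \<rightarrow>\<^sub>M borel" by measurable
  have conv: "(\<lambda>k. LINT x|P (r k). h x) \<longlonglongrightarrow> (LINT x|Q. h x)" if h: "continuous_on UNIV h" for h :: "real^'n \<Rightarrow> complex"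
  proof -
    have [measurable]: "h \<in> borel_measurable borel" by (intro borel_measurable_continuous_onI h)
    have "compact (h ` range G)" by (intro compact_continuous_image G continuous_on_subset[OF h]) auto
    then obtain B where "\<And>z. z \<in> h ` range G \<Longrightarrow> norm z \<le> B"
      using compact_imp_bounded bounded_iff by metis
    then have B: "norm (h (G t)) \<le> B" for t by auto
    have "continuous_on UNIV (\<lambda>t. h (G t))" by (rule continuous_on_compose2[OF h G(1)]) auto
    then have "isCont (\<lambda>t. h (G t)) t" for t by (simp add: continuous_on_eq_continuous_at)
    then have "(\<lambda>k. LINT t|(\<mu> \<circ> id \<circ> r) k. h (G t)) \<longlonglongrightarrow> (LINT t|M. h (G t))"
      by (intro weak_conv_imp_integral_bdd_continuous_conv[OF _ M wc _ B]) (auto simp: rd)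
    moreover have "(LINT t|(\<mu> \<circ> id \<circ> r) k. h (G t)) = (LINT x|P (r k). h x)" for k
    proof -
      have "(LINT t|(\<mu> \<circ> id \<circ> r) k. h (G t)) = (LINT x|P (r k). h (G (s x)))"
        by (simp add: \<mu>_def integral_distr)
      also have "\<dots> = (LINT x|P (r k). h x)"
        by (rule integral_cong_AE) (use AEK[of "r k"] Gs in \<open>auto elim!: eventually_mono\<close>)
      finally show ?thesis .
    qed
    moreover have "(LINT t|M. h (G t)) = (LINT x|Q. h x)"
      by (simp add: Q_def integral_distr)
    ultimately show ?thesis by simp
  qed
  have Q: "prob_space Q" unfolding Q_def by (rule M.prob_space_distr[OF GM])
  have Qs [measurable_cong]: "sets Q = sets borel" by (simp add: Q_def)
  have Kne: "K \<noteq> {}"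
  proof
    assume "K = {}"
    with AEK[of 0] have "AE x in P 0. False" by simp
    then show False using prob_space.AE_False[OF prob] by blast
  qed
  have "AE x in Q. x \<in> K"
  proof -
    \<comment> \<open>The distance to K, truncated at 1 to stay bounded, is a continuous test
      function that vanishes almost surely under every \<open>P k\<close>; hence its integral under
      the limit is 0.\<close>
    let ?d = "\<lambda>x. min 1 (infdist x K)"
    have dc: "continuous_on UNIV ?d" by (intro continuous_intros)
    have [measurable]: "?d \<in> borel_measurable borel" by (intro borel_measurable_continuous_onI dc)
    have "(\<lambda>k. LINT x|P (r k). complex_of_real (?d x)) \<longlonglongrightarrow> (LINT x|Q. complex_of_real (?d x))"
      by (intro conv continuous_on_of_real dc)
    moreover have "(LINT x|P (r k). complex_of_real (?d x)) = (LINT x|P (r k). 0)" for k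
      by (rule integral_cong_AE) (use AEK[of "r k"] in \<open>auto elim!: eventually_mono\<close>)
    ultimately have "(LINT x|Q. complex_of_real (?d x)) = 0"
      by (simp add: LIMSEQ_const_iff)
    then have "(LINT x|Q. ?d x) = 0" by simp
    moreover interpret Q: prob_space Q by (rule Q)
    have "integrable Q ?d"
      by (rule Q.integrable_const_bound[where B = 1]) (auto simp: infdist_nonneg)
    ultimately have "AE x in Q. ?d x = 0"
      by (subst (asm) integral_nonneg_eq_0_iff_AE) (auto simp: infdist_nonneg)
    then show ?thesis
      by eventually_elim (use in_closed_iff_infdist_zero[OF compact_imp_closed[OF K] Kne] in \<open>auto simp: min_def split: if_splits\<close>)
  qed
  then have QK: "AE x in Q. x \<in> K" .
  have "(\<lambda>k. LINT x|P (r k). h x) \<longlonglongrightarrow> (LINT x|Q. h x)"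
    if [measurable]: "h \<in> borel_measurable borel" and h: "continuous_on K h" for h :: "real^'n \<Rightarrow> complex"
  proof -
    \<comment> \<open>Tietze's theorem replaces h by a function continuous on the whole space; all
      measures being carried by K, no integral changes.\<close>
    obtain g where g: "continuous_on UNIV g" "\<And>x. x \<in> K \<Longrightarrow> g x = h x"
      using Tietze_unbounded[OF h, of UNIV] K by (auto simp: compact_imp_closed)
    have [measurable]: "g \<in> borel_measurable borel" by (intro borel_measurable_continuous_onI g)
    have "(LINT x|P (r k). g x) = (LINT x|P (r k). h x)" for k
      by (rule integral_cong_AE) (use AEK[of "r k"] g(2) in \<open>auto elim!: eventually_mono\<close>)
    moreover have "(LINT x|Q. g x) = (LINT x|Q. h x)"
      by (rule integral_cong_AE) (use QK g(2) in \<open>auto elim!: eventually_mono\<close>)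
    ultimately show ?thesis using conv[OF g(1)] by simp
  qed
  with that[OF r Q Qs QK] show ?thesis by blast
qed

subsection \<open>Integrals along rays\<close>

text \<open>Defined for all vectors and not only for unit ones, so that it can be evaluated at an
  unnormalised frequency; away from the origin it is homogeneous of degree -a.\<close>

definition ray_integral :: "(real^'n \<Rightarrow> complex) \<Rightarrow> real \<Rightarrow> real^'n \<Rightarrow> complex" where
  "ray_integral \<phi> a \<theta> = (LINT t|lborel. complex_of_real (\<bar>t\<bar> powr (a - 1)) * fourier_transform \<phi> (t *\<^sub>R \<theta>))"

lemma ray_integral_measurable:
  assumes "schwartz \<phi>"
  shows "ray_integral \<phi> a \<in> borel_measurable borel"
proof -
  have [measurable]: "fourier_transform \<phi> \<in> borel_measurable borel" by (rule fourier_schwartz_measurable[OF assms])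
  show ?thesis unfolding ray_integral_def by measurable
qed

lemma ray_integral_minus: "ray_integral \<phi> a (- \<theta>) = ray_integral \<phi> a \<theta>"
  using integral_homogeneous_scale[of "-1" a "\<lambda>t. fourier_transform \<phi> (t *\<^sub>R \<theta>)"] by (simp add: ray_integral_def)

lemma ray_integral_homogeneous:
  fixes \<xi> :: "real^'n"
  assumes "\<xi> \<noteq> 0"
  shows "ray_integral \<phi> a \<xi> = complex_of_real (norm \<xi> powr (- a)) * ray_integral \<phi> a (\<xi> /\<^sub>R norm \<xi>)"
proof -
  have k: "(t * norm \<xi>) *\<^sub>R (\<xi> /\<^sub>R norm \<xi>) = t *\<^sub>R \<xi>" for t using assms by simp
  show ?thesis
    using integral_homogeneous_scale[of "norm \<xi>" a "\<lambda>t. fourier_transform \<phi> (t *\<^sub>R (\<xi> /\<^sub>R norm \<xi>))"] assms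
    unfolding ray_integral_def k abs_norm_cancel norm_eq_zero by blast
qed

text \<open>The type argument conveys the dimension, which t alone does not determine. The order 2 n
  exceeds every exponent a < n of the ray integrals.\<close>

definition ray_weight :: "'n::finite itself \<Rightarrow> real \<Rightarrow> real" where
  "ray_weight _ t = (1 + \<bar>t\<bar>) powr (- real (2 * CARD('n)))"

lemma integrable_ray_weight:
  fixes n :: "'n::finite itself"
  assumes "0 < a" "a < real CARD('n)"
  shows "integrable lborel (\<lambda>t. \<bar>t\<bar> powr (a - 1) * ray_weight n t)"
  unfolding ray_weight_def by (rule integrable_abs_powr_decay) (use assms in auto)

text \<open>One majorant for all directions at once; it yields continuity on the sphere, uniform
  convergence in the exponent and the Fubini bounds.\<close>

lemma fourier_ray_bound:
  fixes \<phi> :: "real^'n \<Rightarrow> complex"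
  assumes "schwartz \<phi>"
  obtains C where "0 \<le> C" "\<And>t \<theta>. norm \<theta> = 1 \<Longrightarrow> norm (fourier_transform \<phi> (t *\<^sub>R \<theta>)) \<le> C * ray_weight TYPE('n) t"
proof -
  obtain C where C: "0 \<le> C" "\<And>\<xi>. (1 + norm \<xi>) ^ (2 * CARD('n)) * norm (fourier_transform \<phi> \<xi>) \<le> C"
    using fourier_decay[OF assms] by metis
  have "norm (fourier_transform \<phi> (t *\<^sub>R \<theta>)) \<le> C * ray_weight TYPE('n) t" if "norm \<theta> = 1" for t \<theta>
  proof -
    have "(1 + \<bar>t\<bar>) ^ (2 * CARD('n)) * norm (fourier_transform \<phi> (t *\<^sub>R \<theta>)) \<le> C"
      using C(2)[of "t *\<^sub>R \<theta>"] that by simp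
    moreover have "0 < (1 + \<bar>t\<bar>) ^ (2 * CARD('n))" by (simp add: add_pos_nonneg)
    ultimately have "norm (fourier_transform \<phi> (t *\<^sub>R \<theta>)) \<le> C / (1 + \<bar>t\<bar>) ^ (2 * CARD('n))"
      by (simp add: pos_le_divide_eq mult.commute)
    also have "\<dots> = C * ray_weight TYPE('n) t"
      unfolding ray_weight_def powr_minus by (subst powr_realpow) (auto simp: divide_inverse)
    finally show ?thesis .
  qed
  then show ?thesis using C that by blast
qed

lemma ray_weight_measurable [measurable]: "ray_weight n \<in> borel_measurable borel"
  unfolding ray_weight_def by measurable

lemma integrable_ray:
  fixes \<phi> :: "real^'n \<Rightarrow> complex"
  assumes \<phi>: "schwartz \<phi>" and a: "0 < a" "a < real CARD('n)" and \<theta>: "norm \<theta> = 1"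
  shows "integrable lborel (\<lambda>t. complex_of_real (\<bar>t\<bar> powr (a - 1)) * fourier_transform \<phi> (t *\<^sub>R \<theta>))"
proof -
  obtain C where C: "0 \<le> C" "\<And>t \<theta>. norm \<theta> = 1 \<Longrightarrow> norm (fourier_transform \<phi> (t *\<^sub>R \<theta>)) \<le> C * ray_weight TYPE('n) t"
    using fourier_ray_bound[OF \<phi>] by blast
  have [measurable]: "fourier_transform \<phi> \<in> borel_measurable borel" by (rule fourier_schwartz_measurable[OF \<phi>])
  show ?thesis
  proof (rule Bochner_Integration.integrable_bound)
    show "integrable lborel (\<lambda>t. C * (\<bar>t\<bar> powr (a - 1) * ray_weight TYPE('n) t))"
      by (intro integrable_mult_right integrable_ray_weight a)
    show "AE t in lborel. norm (complex_of_real (\<bar>t\<bar> powr (a - 1)) * fourier_transform \<phi> (t *\<^sub>R \<theta>)) \<le> norm (C * (\<bar>t\<bar> powr (a - 1) * ray_weight TYPE('n) t))"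
      using mult_left_mono[OF C(2)[OF \<theta>], of "\<bar>t\<bar> powr (a - 1)" for t] C(1)
      by (intro AE_I2) (simp add: norm_mult abs_mult ray_weight_def mult_ac)
  qed measurable
qed

lemma ray_integral_continuous:
  fixes \<phi> :: "real^'n \<Rightarrow> complex"
  assumes \<phi>: "schwartz \<phi>" and a: "0 < a" "a < real CARD('n)"
  shows "continuous_on (sphere 0 1) (ray_integral \<phi> a)"
  unfolding continuous_on_sequentially
proof (intro allI impI ballI, elim conjE)
  fix X \<theta> assume \<theta>: "\<theta> \<in> sphere 0 1" and XS: "\<forall>k. X k \<in> sphere (0::real^'n) 1" and X: "X \<longlonglongrightarrow> \<theta>"
  obtain C where C: "0 \<le> C" "\<And>t \<theta>. norm \<theta> = 1 \<Longrightarrow> norm (fourier_transform \<phi> (t *\<^sub>R \<theta>)) \<le> C * ray_weight TYPE('n) t"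
    using fourier_ray_bound[OF \<phi>] by blast
  have [measurable]: "fourier_transform \<phi> \<in> borel_measurable borel" by (rule fourier_schwartz_measurable[OF \<phi>])
  have "(\<lambda>k. ray_integral \<phi> a (X k)) \<longlonglongrightarrow> ray_integral \<phi> a \<theta>"
    unfolding ray_integral_def
  proof (rule integral_dominated_convergence[where w = "\<lambda>t. C * (\<bar>t\<bar> powr (a - 1) * ray_weight TYPE('n) t)"])
    show "integrable lborel (\<lambda>t. C * (\<bar>t\<bar> powr (a - 1) * ray_weight TYPE('n) t))"
      by (intro integrable_mult_right integrable_ray_weight a)
    show "AE t in lborel. norm (complex_of_real (\<bar>t\<bar> powr (a - 1)) * fourier_transform \<phi> (t *\<^sub>R X k)) \<le> C * (\<bar>t\<bar> powr (a - 1) * ray_weight TYPE('n) t)" for k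
      using mult_left_mono[OF C(2)[of "X k"], of "\<bar>t\<bar> powr (a - 1)" for t] XS
      by (intro AE_I2) (simp add: norm_mult mult_ac)
    have fc: "isCont (fourier_transform \<phi>) z" for z
      using fourier_continuous[OF schwartz_integrable[OF \<phi>]] by (simp add: continuous_on_eq_continuous_at)
    show "AE t in lborel. (\<lambda>k. complex_of_real (\<bar>t\<bar> powr (a - 1)) * fourier_transform \<phi> (t *\<^sub>R X k)) \<longlonglongrightarrow> complex_of_real (\<bar>t\<bar> powr (a - 1)) * fourier_transform \<phi> (t *\<^sub>R \<theta>)"
      by (intro AE_I2 tendsto_mult tendsto_const isCont_tendsto_compose[OF fc] tendsto_scaleR X)
  qed measurable
  then show "(ray_integral \<phi> a \<circ> X) \<longlonglongrightarrow> ray_integral \<phi> a \<theta>" by (simp add: comp_def)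
qed

text \<open>Constancy on the sphere makes the Gaussian the test function that recovers the total
  mass of a measure there, however the mass is spread.\<close>

lemma ray_integral_gauss:
  fixes \<theta> :: "real^'n"
  assumes "norm \<theta> = 1"
  shows "ray_integral (\<lambda>x. complex_of_real (gauss x)) a \<theta> = complex_of_real (sqrt (2 * pi) ^ CARD('n) * gauss_moment a)"
proof -
  have "ray_integral (\<lambda>x. complex_of_real (gauss x)) a \<theta> = 
    (LINT t|lborel. complex_of_real (sqrt (2 * pi) ^ CARD('n) * (\<bar>t\<bar> powr (a - 1) * exp (- t\<^sup>2 / 2))))"
    unfolding ray_integral_def fourier_gauss
    by (intro Bochner_Integration.integral_cong refl) (use assms in \<open>simp add: gauss_def\<close>)
  also have "\<dots> = complex_of_real (sqrt (2 * pi) ^ CARD('n) * gauss_moment a)"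
    unfolding integral_complex_of_real gauss_moment_def by simp
  finally show ?thesis .
qed

text \<open>The smaller exponent dominates for t at most 1 and the larger one beyond, so a single
  integrable majorant serves a whole interval of exponents.\<close>

lemma abs_powr_le_sum:
  fixes t :: real
  assumes "0 \<le> t" "b \<le> c" "c \<le> d"
  shows "t powr c \<le> t powr b + t powr d"
proof (cases "t \<le> 1")
  case True
  show ?thesis
  proof (cases "t = 0")
    case False
    have "t powr c \<le> t powr b" using True False assms by (intro powr_mono') auto
    then show ?thesis by (simp add: add_increasing2)
  qed simp
next
  case False
  have "t powr c \<le> t powr d" using False assms by (intro powr_mono) auto
  then show ?thesis by (simp add: add_increasing)
qed

text \<open>Uniformity in the direction is wanted because the measures vary together with the
  exponent. It comes from \<open>fourier_ray_bound\<close>: the bound \<open>D k\<close> on the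
  difference does not involve \<theta>.\<close>

lemma ray_integral_uniform_limit:
  fixes \<phi> :: "real^'n \<Rightarrow> complex"
  assumes \<phi>: "schwartz \<phi>" and a: "0 < a" "b < real CARD('n)"
    and \<epsilon>: "\<And>k. 0 \<le> \<epsilon> k" "\<And>k. a + \<epsilon> k \<le> b" "\<epsilon> \<longlonglongrightarrow> 0"
  shows "uniform_limit (sphere 0 1) (\<lambda>k. ray_integral \<phi> (a + \<epsilon> k)) (ray_integral \<phi> a) sequentially"
proof -
  obtain C where C: "0 \<le> C" "\<And>t \<theta>. norm \<theta> = 1 \<Longrightarrow> norm (fourier_transform \<phi> (t *\<^sub>R \<theta>)) \<le> C * ray_weight TYPE('n) t"
    using fourier_ray_bound[OF \<phi>] by blast
  have ab: "a \<le> b" using \<epsilon>(1,2)[of 0] by linarith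
  have ak: "0 < a + \<epsilon> k" "a + \<epsilon> k < real CARD('n)" for k using \<epsilon>(1,2)[of k] a by linarith+
  define d where "d k t = \<bar>\<bar>t\<bar> powr (a + \<epsilon> k - 1) - \<bar>t\<bar> powr (a - 1)\<bar> * (C * ray_weight TYPE('n) t)" for k t
  define D where "D k = integral\<^sup>L lborel (d k)" for k
  have rw0: "0 \<le> ray_weight TYPE('n) t" for t by (simp add: ray_weight_def)
  have [measurable]: "d k \<in> borel_measurable borel" for k unfolding d_def by measurable
  define W where "W t = C * (2 * (\<bar>t\<bar> powr (a - 1) * ray_weight TYPE('n) t) + \<bar>t\<bar> powr (b - 1) * ray_weight TYPE('n) t)" for t
  have W: "integrable lborel W"
    unfolding W_def by (intro integrable_mult_right Bochner_Integration.integrable_add integrable_ray_weight) (use a ab in auto)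
  have dW: "norm (d k t) \<le> W t" for k t
  proof -
    have "\<bar>t\<bar> powr (a + \<epsilon> k - 1) \<le> \<bar>t\<bar> powr (a - 1) + \<bar>t\<bar> powr (b - 1)"
      by (rule abs_powr_le_sum) (use \<epsilon>(1,2)[of k] in auto)
    then have 1: "\<bar>\<bar>t\<bar> powr (a + \<epsilon> k - 1) - \<bar>t\<bar> powr (a - 1)\<bar> \<le> 2 * \<bar>t\<bar> powr (a - 1) + \<bar>t\<bar> powr (b - 1)"
      using powr_ge_zero[of "\<bar>t\<bar>" "a - 1"] powr_ge_zero[of "\<bar>t\<bar>" "a + \<epsilon> k - 1"] by linarith
    have "norm (d k t) = d k t" using C(1) rw0[of t] by (simp add: d_def abs_mult)
    also have "\<dots> \<le> (2 * \<bar>t\<bar> powr (a - 1) + \<bar>t\<bar> powr (b - 1)) * (C * ray_weight TYPE('n) t)"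
      unfolding d_def by (rule mult_right_mono[OF 1]) (use C(1) rw0[of t] in auto)
    also have "\<dots> = W t" by (simp add: W_def algebra_simps)
    finally show ?thesis .
  qed
  have di: "integrable lborel (d k)" for k
    by (rule Bochner_Integration.integrable_bound[OF W]) (use dW order_trans[OF dW abs_ge_self] in \<open>auto simp: real_norm_def[symmetric] simp del: real_norm_def intro!: AE_I2\<close>)
  have "D \<longlonglongrightarrow> (LINT t|(lborel::real measure). 0)"
    unfolding D_def
  proof (rule integral_dominated_convergence[OF _ _ W])
    show "AE t in lborel. (\<lambda>k. d k t) \<longlonglongrightarrow> 0"
    proof (rule AE_lborel_nonzeroI)
      fix t :: real assume "t \<noteq> 0"
      have "(\<lambda>k. \<bar>t\<bar> powr (a + \<epsilon> k - 1)) \<longlonglongrightarrow> \<bar>t\<bar> powr (a + 0 - 1)"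
        by (intro tendsto_powr tendsto_intros \<epsilon>) (use \<open>t \<noteq> 0\<close> in auto)
      then have "(\<lambda>k. \<bar>t\<bar> powr (a + \<epsilon> k - 1) - \<bar>t\<bar> powr (a - 1)) \<longlonglongrightarrow> 0"
        by (simp add: LIM_zero)
      then show "(\<lambda>k. d k t) \<longlonglongrightarrow> 0"
        unfolding d_def by (intro tendsto_mult_left_zero tendsto_rabs_zero)
    qed
    show "AE t in lborel. norm (d k t) \<le> W t" for k using dW by simp
  qed auto
  then have D0: "D \<longlonglongrightarrow> 0" by simp
  have bound: "dist (ray_integral \<phi> (a + \<epsilon> k) \<theta>) (ray_integral \<phi> a \<theta>) \<le> D k" if \<theta>: "\<theta> \<in> sphere 0 1" for k \<theta>
  proof -
    have n: "norm \<theta> = 1" using \<theta> by simp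
    have i1: "integrable lborel (\<lambda>t. complex_of_real (\<bar>t\<bar> powr (a + \<epsilon> k - 1)) * fourier_transform \<phi> (t *\<^sub>R \<theta>))"
      by (rule integrable_ray[OF \<phi> ak n])
    have i2: "integrable lborel (\<lambda>t. complex_of_real (\<bar>t\<bar> powr (a - 1)) * fourier_transform \<phi> (t *\<^sub>R \<theta>))"
      by (rule integrable_ray[OF \<phi> a(1) _ n]) (use a ab in linarith)
    have "ray_integral \<phi> (a + \<epsilon> k) \<theta> - ray_integral \<phi> a \<theta> = 
      (LINT t|lborel. complex_of_real (\<bar>t\<bar> powr (a + \<epsilon> k - 1)) * fourier_transform \<phi> (t *\<^sub>R \<theta>) - complex_of_real (\<bar>t\<bar> powr (a - 1)) * fourier_transform \<phi> (t *\<^sub>R \<theta>))"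
      unfolding ray_integral_def using i1 i2 by simp
    also have "norm \<dots> \<le> D k"
      unfolding D_def
    proof (rule Bochner_Integration.integral_norm_bound_integral[OF Bochner_Integration.integrable_diff[OF i1 i2] di])
      fix t
      have "norm (complex_of_real (\<bar>t\<bar> powr (a + \<epsilon> k - 1)) * fourier_transform \<phi> (t *\<^sub>R \<theta>) - complex_of_real (\<bar>t\<bar> powr (a - 1)) * fourier_transform \<phi> (t *\<^sub>R \<theta>))
        = \<bar>\<bar>t\<bar> powr (a + \<epsilon> k - 1) - \<bar>t\<bar> powr (a - 1)\<bar> * norm (fourier_transform \<phi> (t *\<^sub>R \<theta>))"
        unfolding left_diff_distrib[symmetric] norm_mult of_real_diff[symmetric] norm_of_real ..
      also have "\<dots> \<le> d k t" unfolding d_def by (intro mult_left_mono C(2) n) auto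
      finally show "norm (complex_of_real (\<bar>t\<bar> powr (a + \<epsilon> k - 1)) * fourier_transform \<phi> (t *\<^sub>R \<theta>) - complex_of_real (\<bar>t\<bar> powr (a - 1)) * fourier_transform \<phi> (t *\<^sub>R \<theta>)) \<le> d k t" .
    qed
    finally show ?thesis by (simp add: dist_norm)
  qed
  show ?thesis
  proof (rule uniform_limitI)
    fix e :: real assume "0 < e"
    with D0 have "\<forall>\<^sub>F k in sequentially. D k < e" by (rule order_tendstoD(2))
    then show "\<forall>\<^sub>F k in sequentially. \<forall>\<theta>\<in>sphere 0 1. dist (ray_integral \<phi> (a + \<epsilon> k) \<theta>) (ray_integral \<phi> a \<theta>) < e"
      by eventually_elim (use bound in \<open>blast intro: le_less_trans\<close>)
  qed
qed

section \<open>Averages of Gaussians over dilations\<close>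

lemma gauss_scaleR: "gauss (s *\<^sub>R x) = exp (- (s * norm x)\<^sup>2 / 2)"
  by (simp add: gauss_def power_mult_distrib)

text \<open>Stated in the extended nonnegative reals so that Tonelli applies before any finiteness
  is known. It is used in both directions: to create a power of the norm, and to resolve one into
  Gaussians.\<close>

lemma nn_integral_gauss_ray:
  fixes h :: "real^'n \<Rightarrow> ennreal"
  assumes [measurable]: "h \<in> borel_measurable borel" and a: "0 < a"
  shows "(\<integral>\<^sup>+s. \<integral>\<^sup>+x. ennreal (\<bar>s\<bar> powr (a - 1)) * (h x * ennreal (gauss (s *\<^sub>R x))) \<partial>lborel \<partial>lborel)
     = ennreal (gauss_moment a) * (\<integral>\<^sup>+x. h x * ennreal (norm x powr (- a)) \<partial>lborel)"
proof -
  have "(\<integral>\<^sup>+s. \<integral>\<^sup>+x. ennreal (\<bar>s\<bar> powr (a - 1)) * (h x * ennreal (gauss (s *\<^sub>R x))) \<partial>lborel \<partial>lborel) =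
    (\<integral>\<^sup>+x. \<integral>\<^sup>+s. ennreal (\<bar>s\<bar> powr (a - 1)) * (h x * ennreal (gauss (s *\<^sub>R x))) \<partial>lborel \<partial>lborel)"
    by (rule lborel_pair.Fubini') measurable
  also have "\<dots> = (\<integral>\<^sup>+x. ennreal (gauss_moment a) * (h x * ennreal (norm x powr (- a))) \<partial>lborel)"
  proof (rule nn_integral_cong_AE, rule AE_lborel_nonzeroI)
    fix x :: "real^'n" assume x: "x \<noteq> 0"
    have "(\<integral>\<^sup>+s. ennreal (\<bar>s\<bar> powr (a - 1)) * (h x * ennreal (gauss (s *\<^sub>R x))) \<partial>lborel) =
      (\<integral>\<^sup>+s. h x * (ennreal (\<bar>s\<bar> powr (a - 1)) * ennreal (exp (- (s * norm x)\<^sup>2 / 2))) \<partial>lborel)"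
      by (simp add: gauss_scaleR mult_ac)
    also have "\<dots> = h x * (\<integral>\<^sup>+s. ennreal (\<bar>s\<bar> powr (a - 1)) * ennreal (exp (- (s * norm x)\<^sup>2 / 2)) \<partial>lborel)"
      by (rule nn_integral_cmult) measurable
    also have "(\<integral>\<^sup>+s. ennreal (\<bar>s\<bar> powr (a - 1)) * ennreal (exp (- (s * norm x)\<^sup>2 / 2)) \<partial>lborel) = 
      ennreal (norm x powr (- a)) * ennreal (gauss_moment a)"
      using nn_integral_homogeneous_scale[of "norm x" "\<lambda>t. ennreal (exp (- t\<^sup>2 / 2))" a] x
      unfolding nn_integral_gauss_moment[OF a, symmetric] by simp
    finally show "(\<integral>\<^sup>+s. ennreal (\<bar>s\<bar> powr (a - 1)) * (h x * ennreal (gauss (s *\<^sub>R x))) \<partial>lborel) = 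
      ennreal (gauss_moment a) * (h x * ennreal (norm x powr (- a)))" by (simp add: mult_ac)
  qed
  also have "\<dots> = ennreal (gauss_moment a) * (\<integral>\<^sup>+x. h x * ennreal (norm x powr (- a)) \<partial>lborel)"
    by (rule nn_integral_cmult) measurable
  finally show ?thesis .
qed

lemma integral_gauss_ray:
  assumes "x \<noteq> 0"
  shows "(LINT s|lborel. complex_of_real (\<bar>s\<bar> powr (a - 1)) * complex_of_real (gauss (s *\<^sub>R x))) = complex_of_real (norm x powr (- a) * gauss_moment a)"
proof -
  have "(LINT s|lborel. complex_of_real (\<bar>s\<bar> powr (a - 1)) * complex_of_real (gauss (s *\<^sub>R x))) = 
     complex_of_real (norm x powr (- a)) * (LINT t|lborel. complex_of_real (\<bar>t\<bar> powr (a - 1)) * complex_of_real (exp (- t\<^sup>2 / 2)))"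
    using integral_homogeneous_scale[of "norm x" a "\<lambda>t. complex_of_real (exp (- t\<^sup>2 / 2))"] assms by (simp add: gauss_scaleR)
  also have "(LINT t|lborel. complex_of_real (\<bar>t\<bar> powr (a - 1)) * complex_of_real (exp (- t\<^sup>2 / 2))) = complex_of_real (gauss_moment a)"
    unfolding gauss_moment_def of_real_mult[symmetric] by (rule integral_complex_of_real)
  finally show ?thesis by simp
qed

subsection \<open>The spectral density\<close>

context homogeneous_weight
begin

text \<open>The argument -\<xi> yields the kernel exp (i (x, \<xi>)) of the inversion formula. The
  real part gives a real function in any case; under positive definiteness the imaginary part is 0
  and nothing is lost.\<close>

definition spectral :: "real^'n \<Rightarrow> real" where
  "spectral \<xi> = Re (fourier_transform (\<lambda>x. complex_of_real (w x * gauss x)) (- \<xi>))"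

lemma spectral_measurable [measurable]: "spectral \<in> borel_measurable borel"
proof -
  have [measurable]: "fourier_transform (\<lambda>x. complex_of_real (w x * gauss x)) \<in> borel_measurable borel"
    by (rule fourier_measurable) measurable
  show ?thesis unfolding spectral_def by measurable
qed

lemma integrable_w_gauss_0: "integrable lborel (\<lambda>x. w x * gauss x)"
  using integrable_w_gauss[of 0] p_less unfolding w_norm_powr_0 by simp

lemma integrable_w_dilated_gauss:
  assumes "s \<noteq> 0"
  shows "integrable lborel (\<lambda>x. w x * gauss (s *\<^sub>R x))"
proof -
  have "(\<lambda>x. w x * gauss (s *\<^sub>R x)) = (\<lambda>x. \<bar>s\<bar> powr p * (w (0 + s *\<^sub>R x) * gauss (0 + s *\<^sub>R x)))"
  proof (rule ext)
    fix x
    have "\<bar>s\<bar> powr p * \<bar>s\<bar> powr (- p) = 1" using assms by (simp flip: powr_add)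
    then show "w x * gauss (s *\<^sub>R x) = \<bar>s\<bar> powr p * (w (0 + s *\<^sub>R x) * gauss (0 + s *\<^sub>R x))"
      by (simp add: w_scaleR mult.assoc[symmetric])
  qed
  moreover have "integrable lborel (\<lambda>x. w (0 + s *\<^sub>R x) * gauss (0 + s *\<^sub>R x))"
    using integrable_w_gauss_0 by (subst lborel_integral_affine(1)[OF assms, of "\<lambda>x. w x * gauss x"]) auto
  ultimately show ?thesis by simp
qed

lemma nn_integral_w_schwartz_finite:
  assumes e: "0 \<le> e" "p + e < real CARD('n)" and \<phi>: "schwartz \<phi>"
  shows "(\<integral>\<^sup>+x. ennreal (w x * norm (\<phi> x)) * ennreal (norm x powr (- e)) \<partial>lborel) < \<infinity>"
proof -
  have "(\<integral>\<^sup>+x. ennreal (norm (complex_of_real (w x * norm x powr (- e)) * \<phi> x)) \<partial>lborel) < \<infinity>"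
    using integrable_w_schwartz[OF e \<phi>] by (simp add: integrable_iff_bounded)
  also have "(\<lambda>x. ennreal (norm (complex_of_real (w x * norm x powr (- e)) * \<phi> x))) = 
      (\<lambda>x. ennreal (w x * norm (\<phi> x)) * ennreal (norm x powr (- e)))"
    by (rule ext) (simp add: norm_mult w_nonneg ennreal_mult[symmetric] mult_ac)
  finally show ?thesis .
qed

context
  assumes pd: "positive_definite_distribution T"
begin

lemma spectral_nonneg: "0 \<le> spectral \<xi>"
  and spectral_eq: "complex_of_real (spectral \<xi>) = (LINT x|lborel. complex_of_real (w x * gauss x) * exp (\<i> * complex_of_real (x \<bullet> \<xi>)))"
proof -
  have "fourier_transform (\<lambda>x. complex_of_real (w x * gauss x)) (- \<xi>) \<in> \<real>\<^sub>\<ge>\<^sub>0"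
    by (rule fourier_w_gauss_nonneg[OF pd])
  then show "0 \<le> spectral \<xi>" and "complex_of_real (spectral \<xi>) = (LINT x|lborel. complex_of_real (w x * gauss x) * exp (\<i> * complex_of_real (x \<bullet> \<xi>)))"
    by (auto simp: spectral_def fourier_transform_def nonneg_Reals_def)
qed

lemma spectral_bound: "spectral \<xi> \<le> (LINT x|lborel. w x * gauss x)"
proof -
  have "spectral \<xi> \<le> norm (fourier_transform (\<lambda>x. complex_of_real (w x * gauss x)) (- \<xi>))"
    unfolding spectral_def by (rule complex_Re_le_cmod)
  also have "\<dots> \<le> (LINT x|lborel. norm (complex_of_real (w x * gauss x)))" by (rule norm_fourier_le)
  also have "\<dots> = (LINT x|lborel. w x * gauss x)"
    by (intro Bochner_Integration.integral_cong) (simp_all add: norm_mult w_nonneg)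
  finally show ?thesis .
qed

text \<open>Insert the inversion formula for \<phi> and exchange the integrals. By homogeneity w(x)
  gauss(s x) is |s|^p times the function w gauss evaluated at s x, so the inner transform is
  \<open>spectral\<close> at \<eta> / s up to powers of |s|; the substitution \<eta> = s \<xi>
  absorbs the Jacobian.\<close>

lemma dilated_parseval:
  assumes \<phi>: "schwartz \<phi>" and s: "s \<noteq> 0"
  shows "complex_of_real ((2 * pi) ^ CARD('n)) * (LINT x|lborel. complex_of_real (w x * gauss (s *\<^sub>R x)) * \<phi> x)
    = complex_of_real (\<bar>s\<bar> powr p) * (LINT \<xi>|lborel. complex_of_real (spectral \<xi>) * fourier_transform \<phi> (s *\<^sub>R \<xi>))"
proof -
  let ?n = "CARD('n)"
  have [measurable]: "\<phi> \<in> borel_measurable borel" "fourier_transform \<phi> \<in> borel_measurable borel"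
    by (rule schwartz_measurable[OF \<phi>], rule fourier_schwartz_measurable[OF \<phi>])
  define g where "g \<eta> x = complex_of_real (w x * gauss (s *\<^sub>R x)) * exp (\<i> * complex_of_real (x \<bullet> \<eta>)) * fourier_transform \<phi> \<eta>" for \<eta> x
  have spp: "\<bar>s\<bar> powr p * \<bar>s\<bar> powr (- p) = 1" using s by (simp flip: powr_add)
  have inner: "(LINT x|lborel. g \<eta> x) = complex_of_real (\<bar>s\<bar> powr p / \<bar>s\<bar> ^ ?n) * (complex_of_real (spectral (\<eta> /\<^sub>R s)) * fourier_transform \<phi> \<eta>)" for \<eta>
  proof -
    let ?h = "\<lambda>x. complex_of_real (w x * gauss x) * exp (\<i> * complex_of_real (x \<bullet> (\<eta> /\<^sub>R s)))"
    have "(LINT x|lborel. g \<eta> x) = (LINT x|lborel. complex_of_real (\<bar>s\<bar> powr p) * ?h (0 + s *\<^sub>R x) * fourier_transform \<phi> \<eta>)"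
    proof (intro Bochner_Integration.integral_cong refl)
      fix x
      have 1: "(0 + s *\<^sub>R x) \<bullet> (\<eta> /\<^sub>R s) = x \<bullet> \<eta>" using s by simp
      have 2: "\<bar>s\<bar> powr p * w (0 + s *\<^sub>R x) = w x"
        using spp by (simp add: w_scaleR mult.assoc[symmetric])
      show "g \<eta> x = complex_of_real (\<bar>s\<bar> powr p) * ?h (0 + s *\<^sub>R x) * fourier_transform \<phi> \<eta>"
        unfolding g_def 1 2[symmetric] by simp
    qed
    also have "\<dots> = complex_of_real (\<bar>s\<bar> powr p) * (LINT x|lborel. ?h (0 + s *\<^sub>R x)) * fourier_transform \<phi> \<eta>"
      by (simp only: integral_mult_left_zero integral_mult_right_zero)
    also have "(LINT x|lborel. ?h (0 + s *\<^sub>R x)) = (LINT x|lborel. ?h x) /\<^sub>R \<bar>s\<bar> ^ ?n"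
      by (subst lborel_integral_affine(2)[OF s, of ?h 0]) auto
    also have "(LINT x|lborel. ?h x) = complex_of_real (spectral (\<eta> /\<^sub>R s))" by (rule spectral_eq[symmetric])
    finally show ?thesis by (simp add: scaleR_conv_of_real divide_inverse)
  qed
  have "(LINT \<eta>|lborel. LINT x|lborel. g \<eta> x) = (LINT x|lborel. LINT \<eta>|lborel. g \<eta> x)"
  proof (rule lborel_swap_integrals_dominated(1)[where a = "\<lambda>\<eta>. norm (fourier_transform \<phi> \<eta>)" and b = "\<lambda>x. w x * gauss (s *\<^sub>R x)"])
    show "(\<lambda>(x, y). g x y) \<in> borel_measurable (borel \<Otimes>\<^sub>M borel)" unfolding g_def by measurable
    show "norm (g \<eta> x) \<le> norm (fourier_transform \<phi> \<eta>) * (w x * gauss (s *\<^sub>R x))" for \<eta> x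
      by (simp add: g_def norm_mult norm_exp_eq_Re w_nonneg)
  qed (use fourier_schwartz_integrable[OF \<phi>] integrable_w_dilated_gauss[OF s] in auto)
  also have "(LINT x|lborel. LINT \<eta>|lborel. g \<eta> x) = (LINT x|lborel. complex_of_real ((2 * pi) ^ ?n) * (complex_of_real (w x * gauss (s *\<^sub>R x)) * \<phi> x))"
  proof (intro Bochner_Integration.integral_cong refl)
    fix x
    have "(LINT \<eta>|lborel. g \<eta> x) = (LINT \<eta>|lborel. complex_of_real (w x * gauss (s *\<^sub>R x)) * (fourier_transform \<phi> \<eta> * exp (\<i> * complex_of_real (x \<bullet> \<eta>))))"
      by (intro Bochner_Integration.integral_cong refl) (simp add: g_def mult_ac)
    also have "\<dots> = complex_of_real (w x * gauss (s *\<^sub>R x)) * (complex_of_real ((2 * pi) ^ ?n) * \<phi> x)"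
      unfolding integral_mult_right_zero fourier_inversion[OF \<phi>] ..
    finally show "(LINT \<eta>|lborel. g \<eta> x) = complex_of_real ((2 * pi) ^ ?n) * (complex_of_real (w x * gauss (s *\<^sub>R x)) * \<phi> x)"
      by (simp only: mult_ac)
  qed
  also have "\<dots> = complex_of_real ((2 * pi) ^ ?n) * (LINT x|lborel. complex_of_real (w x * gauss (s *\<^sub>R x)) * \<phi> x)"
    by (rule integral_mult_right_zero)
  finally have 1: "(LINT \<eta>|lborel. LINT x|lborel. g \<eta> x) = complex_of_real ((2 * pi) ^ ?n) * (LINT x|lborel. complex_of_real (w x * gauss (s *\<^sub>R x)) * \<phi> x)" .
  have "(LINT \<eta>|lborel. LINT x|lborel. g \<eta> x) = complex_of_real (\<bar>s\<bar> powr p / \<bar>s\<bar> ^ ?n) * (LINT \<eta>|lborel. complex_of_real (spectral (\<eta> /\<^sub>R s)) * fourier_transform \<phi> \<eta>)"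
    unfolding inner by (rule integral_mult_right_zero)
  also have "(LINT \<xi>|lborel. complex_of_real (spectral \<xi>) * fourier_transform \<phi> (s *\<^sub>R \<xi>)) = 
     (LINT \<eta>|lborel. complex_of_real (spectral (\<eta> /\<^sub>R s)) * fourier_transform \<phi> \<eta>) /\<^sub>R \<bar>s\<bar> ^ ?n"
    using lborel_integral_affine(2)[OF s, of "\<lambda>\<eta>. complex_of_real (spectral (\<eta> /\<^sub>R s)) * fourier_transform \<phi> \<eta>" 0] s by simp
  then have "complex_of_real (\<bar>s\<bar> powr p / \<bar>s\<bar> ^ ?n) * (LINT \<eta>|lborel. complex_of_real (spectral (\<eta> /\<^sub>R s)) * fourier_transform \<phi> \<eta>) = 
     complex_of_real (\<bar>s\<bar> powr p) * (LINT \<xi>|lborel. complex_of_real (spectral \<xi>) * fourier_transform \<phi> (s *\<^sub>R \<xi>))"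
    by (simp add: scaleR_conv_of_real divide_inverse)
  finally show ?thesis using 1 by (simp only:)
qed

text \<open>The case of the Gaussian test function, whose transform contributes sqrt (2 pi)^n and
  cancels half of (2 pi)^n. All integrands are nonnegative, so the identity can be averaged over s
  before integrability of \<open>spectral\<close> against a power is known.\<close>

lemma nn_integral_spectral_gauss:
  assumes s: "s \<noteq> 0"
  shows "(\<integral>\<^sup>+\<xi>. ennreal (spectral \<xi>) * ennreal (gauss (s *\<^sub>R \<xi>)) \<partial>lborel) = 
    ennreal (sqrt (2 * pi) ^ CARD('n) * \<bar>s\<bar> powr (- p)) * (\<integral>\<^sup>+x. ennreal (w x * gauss x) * ennreal (gauss (s *\<^sub>R x)) \<partial>lborel)"
proof -
  let ?n = "CARD('n)" and ?q = "sqrt (2 * pi) ^ CARD('n)"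
  have q: "0 < ?q" by simp
  have q2: "?q * ?q = (2 * pi) ^ ?n" unfolding power_mult_distrib[symmetric] by simp
  have ig: "integrable lborel (\<lambda>x. gauss (s *\<^sub>R x :: real^'n))"
    using lborel_integral_affine(1)[OF s, of gauss 0] by simp
  have i1: "integrable lborel (\<lambda>\<xi>. spectral \<xi> * gauss (s *\<^sub>R \<xi>))"
  proof (rule Bochner_Integration.integrable_bound[OF integrable_mult_right[OF ig, of "LINT x|lborel. w x * gauss x"]])
    show "AE \<xi> in lborel. norm (spectral \<xi> * gauss (s *\<^sub>R \<xi>)) \<le> norm ((LINT x|lborel. w x * gauss x) * gauss (s *\<^sub>R \<xi>))"
    proof (rule AE_I2)
      fix \<xi>
      have "spectral \<xi> \<le> \<bar>LINT x|lborel. w x * gauss x\<bar>" using spectral_bound[of \<xi>] by linarith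
      then show "norm (spectral \<xi> * gauss (s *\<^sub>R \<xi>)) \<le> norm ((LINT x|lborel. w x * gauss x) * gauss (s *\<^sub>R \<xi>))"
        unfolding real_norm_def abs_mult abs_gauss using spectral_nonneg[of \<xi>] by (simp add: mult_right_mono less_imp_le)
    qed
  qed measurable
  have i2: "integrable lborel (\<lambda>x. w x * gauss x * gauss (s *\<^sub>R x))"
    by (rule Bochner_Integration.integrable_bound[OF integrable_w_gauss_0])
      (auto simp: abs_mult w_nonneg gauss_le_1 less_imp_le intro!: AE_I2 mult_left_le)
  have "complex_of_real ((2 * pi) ^ ?n) * (LINT x|lborel. complex_of_real (w x * gauss (s *\<^sub>R x)) * complex_of_real (gauss x))
    = complex_of_real (\<bar>s\<bar> powr p) * (LINT \<xi>|lborel. complex_of_real (spectral \<xi>) * fourier_transform (\<lambda>x. complex_of_real (gauss x)) (s *\<^sub>R \<xi>))"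
    by (rule dilated_parseval[OF schwartz_gauss s])
  also have "(LINT \<xi>|lborel. complex_of_real (spectral \<xi>) * fourier_transform (\<lambda>x. complex_of_real (gauss x)) (s *\<^sub>R \<xi>)) = 
      (LINT \<xi>|lborel. complex_of_real (?q * (spectral \<xi> * gauss (s *\<^sub>R \<xi>))))"
    by (intro Bochner_Integration.integral_cong) (auto simp: fourier_gauss)
  also have "\<dots> = complex_of_real (?q * (LINT \<xi>|lborel. spectral \<xi> * gauss (s *\<^sub>R \<xi>)))"
    unfolding integral_complex_of_real by simp
  also have "(LINT x|lborel. complex_of_real (w x * gauss (s *\<^sub>R x)) * complex_of_real (gauss x)) = complex_of_real (LINT x|lborel. w x * gauss x * gauss (s *\<^sub>R x))"
    unfolding integral_complex_of_real[symmetric] by (intro Bochner_Integration.integral_cong) auto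
  finally have "(2 * pi) ^ ?n * (LINT x|lborel. w x * gauss x * gauss (s *\<^sub>R x)) = \<bar>s\<bar> powr p * (?q * (LINT \<xi>|lborel. spectral \<xi> * gauss (s *\<^sub>R \<xi>)))"
    unfolding of_real_mult[symmetric] of_real_eq_iff .
  then have "?q * (?q * (LINT x|lborel. w x * gauss x * gauss (s *\<^sub>R x))) = ?q * (\<bar>s\<bar> powr p * (LINT \<xi>|lborel. spectral \<xi> * gauss (s *\<^sub>R \<xi>)))"
    unfolding q2[symmetric] by (simp only: mult_ac)
  then have "?q * (LINT x|lborel. w x * gauss x * gauss (s *\<^sub>R x)) = \<bar>s\<bar> powr p * (LINT \<xi>|lborel. spectral \<xi> * gauss (s *\<^sub>R \<xi>))"
    using q by simp
  then have "(LINT \<xi>|lborel. spectral \<xi> * gauss (s *\<^sub>R \<xi>)) = ?q * \<bar>s\<bar> powr (- p) * (LINT x|lborel. w x * gauss x * gauss (s *\<^sub>R x))"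
    using s by (simp add: powr_minus field_simps)
  moreover have "(\<integral>\<^sup>+\<xi>. ennreal (spectral \<xi>) * ennreal (gauss (s *\<^sub>R \<xi>)) \<partial>lborel) = ennreal (LINT \<xi>|lborel. spectral \<xi> * gauss (s *\<^sub>R \<xi>))"
    by (subst nn_integral_eq_integral[OF i1, symmetric]) (auto simp: ennreal_mult spectral_nonneg less_imp_le)
  moreover have "(\<integral>\<^sup>+x. ennreal (w x * gauss x) * ennreal (gauss (s *\<^sub>R x)) \<partial>lborel) = ennreal (LINT x|lborel. w x * gauss x * gauss (s *\<^sub>R x))"
    by (subst nn_integral_eq_integral[OF i2, symmetric]) (auto simp: ennreal_mult w_nonneg less_imp_le)
  ultimately show ?thesis
    by (simp only:) (rule ennreal_mult', simp)
qed

context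
  fixes e :: real
  assumes e: "0 < e" "p + e < real CARD('n)"
begin

text \<open>The power |\<xi>|^(-(p+e)) is resolved into Gaussians, each is moved to the x-side,
  where |s|^(p+e-1) |s|^(-p) = |s|^(e-1), and the average is reassembled into |x|^(-e). Here e > 0
  makes the moment of order e finite.\<close>

lemma nn_integral_spectral_finite: "(\<integral>\<^sup>+\<xi>. ennreal (spectral \<xi>) * ennreal (norm \<xi> powr (- (p + e))) \<partial>lborel) < \<infinity>"
proof -
  let ?q = "sqrt (2 * pi) ^ CARD('n)"
  have "ennreal (gauss_moment (p + e)) * (\<integral>\<^sup>+\<xi>. ennreal (spectral \<xi>) * ennreal (norm \<xi> powr (- (p + e))) \<partial>lborel) = 
    (\<integral>\<^sup>+s. \<integral>\<^sup>+\<xi>. ennreal (\<bar>s\<bar> powr (p + e - 1)) * (ennreal (spectral \<xi>) * ennreal (gauss (s *\<^sub>R \<xi>))) \<partial>lborel \<partial>lborel)"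
    by (rule nn_integral_gauss_ray[symmetric]) (use e p_pos in auto)
  also have "\<dots> = (\<integral>\<^sup>+s. ennreal ?q * (\<integral>\<^sup>+x. ennreal (\<bar>s\<bar> powr (e - 1)) * (ennreal (w x * gauss x) * ennreal (gauss (s *\<^sub>R x))) \<partial>lborel) \<partial>lborel)"
  proof (rule nn_integral_cong_AE, rule AE_lborel_nonzeroI)
    fix s :: real assume s: "s \<noteq> 0"
    have sp: "\<bar>s\<bar> powr (p + e - 1) * \<bar>s\<bar> powr (- p) = \<bar>s\<bar> powr (e - 1)" by (simp flip: powr_add)
    have "(\<integral>\<^sup>+\<xi>. ennreal (\<bar>s\<bar> powr (p + e - 1)) * (ennreal (spectral \<xi>) * ennreal (gauss (s *\<^sub>R \<xi>))) \<partial>lborel) = 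
      ennreal (\<bar>s\<bar> powr (p + e - 1)) * (\<integral>\<^sup>+\<xi>. ennreal (spectral \<xi>) * ennreal (gauss (s *\<^sub>R \<xi>)) \<partial>lborel)"
      by (rule nn_integral_cmult) measurable
    also have "\<dots> = ennreal (\<bar>s\<bar> powr (p + e - 1)) * (ennreal (?q * \<bar>s\<bar> powr (- p)) * (\<integral>\<^sup>+x. ennreal (w x * gauss x) * ennreal (gauss (s *\<^sub>R x)) \<partial>lborel))"
      unfolding nn_integral_spectral_gauss[OF s] ..
    also have "\<dots> = ennreal ?q * (ennreal (\<bar>s\<bar> powr (e - 1)) * (\<integral>\<^sup>+x. ennreal (w x * gauss x) * ennreal (gauss (s *\<^sub>R x)) \<partial>lborel))"
      unfolding sp[symmetric] by (simp add: ennreal_mult mult_ac)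
    also have "ennreal (\<bar>s\<bar> powr (e - 1)) * (\<integral>\<^sup>+x. ennreal (w x * gauss x) * ennreal (gauss (s *\<^sub>R x)) \<partial>lborel) = 
      (\<integral>\<^sup>+x. ennreal (\<bar>s\<bar> powr (e - 1)) * (ennreal (w x * gauss x) * ennreal (gauss (s *\<^sub>R x))) \<partial>lborel)"
      by (rule nn_integral_cmult[symmetric]) measurable
    finally show "(\<integral>\<^sup>+\<xi>. ennreal (\<bar>s\<bar> powr (p + e - 1)) * (ennreal (spectral \<xi>) * ennreal (gauss (s *\<^sub>R \<xi>))) \<partial>lborel) = 
       ennreal ?q * (\<integral>\<^sup>+x. ennreal (\<bar>s\<bar> powr (e - 1)) * (ennreal (w x * gauss x) * ennreal (gauss (s *\<^sub>R x))) \<partial>lborel)" .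
  qed
  also have "\<dots> = ennreal ?q * (\<integral>\<^sup>+s. \<integral>\<^sup>+x. ennreal (\<bar>s\<bar> powr (e - 1)) * (ennreal (w x * gauss x) * ennreal (gauss (s *\<^sub>R x))) \<partial>lborel \<partial>lborel)"
    by (rule nn_integral_cmult) measurable
  also have "\<dots> = ennreal ?q * (ennreal (gauss_moment e) * (\<integral>\<^sup>+x. ennreal (w x * gauss x) * ennreal (norm x powr (- e)) \<partial>lborel))"
    by (subst nn_integral_gauss_ray) (use e in auto)
  also have "\<dots> < \<infinity>"
    using nn_integral_w_schwartz_finite[OF _ e(2) schwartz_gauss] e(1) by (simp add: ennreal_mult_less_top)
  finally show ?thesis
    using gauss_moment_pos[of "p + e"] p_pos e(1) by (auto simp: ennreal_mult_less_top)
qed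

lemma integrable_spectral_powr: "integrable lborel (\<lambda>\<xi>. spectral \<xi> * norm \<xi> powr (- (p + e)))"
proof (rule integrableI_bounded)
  show "(\<integral>\<^sup>+\<xi>. ennreal (norm (spectral \<xi> * norm \<xi> powr (- (p + e)))) \<partial>lborel) < \<infinity>"
    using nn_integral_spectral_finite by (simp add: abs_mult spectral_nonneg ennreal_mult)
qed measurable

lemma spectral_identity:
  assumes \<phi>: "schwartz \<phi>"
  shows "complex_of_real ((2 * pi) ^ CARD('n) * gauss_moment e) * (LINT x|lborel. complex_of_real (w x * norm x powr (- e)) * \<phi> x)
    = (LINT \<xi>|lborel. complex_of_real (spectral \<xi> * norm \<xi> powr (- (p + e))) * ray_integral \<phi> (p + e) (\<xi> /\<^sub>R norm \<xi>))"
proof -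
  let ?n = "CARD('n)" and ?c = "complex_of_real ((2 * pi) ^ CARD('n))"
  have [measurable]: "\<phi> \<in> borel_measurable borel" "fourier_transform \<phi> \<in> borel_measurable borel"
    by (rule schwartz_measurable[OF \<phi>], rule fourier_schwartz_measurable[OF \<phi>])
  have a: "0 < p + e" using p_pos e by simp
  \<comment> \<open>g is the x-side and k the frequency side. For fixed nonzero s their inner
    integrals agree up to (2 pi)^n by \<open>dilated_parseval\<close>; the rest is Fubini in s on
    each side separately.\<close>
  define g where "g s x = complex_of_real (\<bar>s\<bar> powr (e - 1)) * (complex_of_real (w x * gauss (s *\<^sub>R x)) * \<phi> x)" for s x
  define k where "k \<xi> s = complex_of_real (\<bar>s\<bar> powr (p + e - 1)) * (complex_of_real (spectral \<xi>) * fourier_transform \<phi> (s *\<^sub>R \<xi>))" for \<xi> s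
  have gm: "(\<lambda>(x, y). g x y) \<in> borel_measurable (borel \<Otimes>\<^sub>M borel)" unfolding g_def by measurable
  have km: "(\<lambda>(x, y). k x y) \<in> borel_measurable (borel \<Otimes>\<^sub>M borel)" unfolding k_def by measurable
  have "(\<integral>\<^sup>+s. \<integral>\<^sup>+x. ennreal (norm (g s x)) \<partial>lborel \<partial>lborel) = 
     (\<integral>\<^sup>+s. \<integral>\<^sup>+x. ennreal (\<bar>s\<bar> powr (e - 1)) * (ennreal (w x * norm (\<phi> x)) * ennreal (gauss (s *\<^sub>R x))) \<partial>lborel \<partial>lborel)"
    by (intro nn_integral_cong) (simp add: g_def norm_mult w_nonneg ennreal_mult less_imp_le mult_ac)
  also have "\<dots> = ennreal (gauss_moment e) * (\<integral>\<^sup>+x. ennreal (w x * norm (\<phi> x)) * ennreal (norm x powr (- e)) \<partial>lborel)"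
    by (rule nn_integral_gauss_ray) (use e in auto)
  also have "\<dots> < \<infinity>" using nn_integral_w_schwartz_finite[OF _ e(2) \<phi>] e(1) by (simp add: ennreal_mult_less_top)
  finally have gfin: "(\<integral>\<^sup>+s. \<integral>\<^sup>+x. ennreal (norm (g s x)) \<partial>lborel \<partial>lborel) < \<infinity>" .
  obtain C where C: "0 \<le> C" "\<And>t \<theta>. norm \<theta> = 1 \<Longrightarrow> norm (fourier_transform \<phi> (t *\<^sub>R \<theta>)) \<le> C * ray_weight TYPE('n) t"
    using fourier_ray_bound[OF \<phi>] by blast
  \<comment> \<open>J dominates the absolute ray integrals of \<phi> in all unit directions;
    rescaling by \<open>norm \<xi>\<close> then bounds the integral along \<xi> by |\<xi>|^(-(p+e))
    J.\<close>
  define J where "J = (\<integral>\<^sup>+t. ennreal (\<bar>t\<bar> powr (p + e - 1)) * ennreal (C * ray_weight TYPE('n) t) \<partial>lborel)"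
  have rw0: "0 \<le> ray_weight TYPE('n) t" for t by (simp add: ray_weight_def)
  have "J = (\<integral>\<^sup>+t. ennreal (norm (C * (\<bar>t\<bar> powr (p + e - 1) * ray_weight TYPE('n) t))) \<partial>lborel)"
    unfolding J_def by (intro nn_integral_cong) (simp add: rw0 C(1) abs_mult ennreal_mult mult_ac)
  also have "\<dots> < \<infinity>"
    using integrable_mult_right[OF integrable_ray_weight[OF a e(2)], of C] unfolding integrable_iff_bounded by (rule conjunct2)
  finally have J: "J < \<infinity>" .
  have "(\<integral>\<^sup>+\<xi>. \<integral>\<^sup>+s. ennreal (norm (k \<xi> s)) \<partial>lborel \<partial>lborel) \<le> (\<integral>\<^sup>+\<xi>. ennreal (spectral \<xi>) * ennreal (norm \<xi> powr (- (p + e))) * J \<partial>lborel)"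
  proof (rule nn_integral_mono_AE, rule AE_lborel_nonzeroI)
    fix \<xi> :: "real^'n" assume \<xi>: "\<xi> \<noteq> 0"
    have "(\<integral>\<^sup>+s. ennreal (norm (k \<xi> s)) \<partial>lborel) \<le> (\<integral>\<^sup>+s. ennreal (spectral \<xi>) * (ennreal (\<bar>s\<bar> powr (p + e - 1)) * ennreal (C * ray_weight TYPE('n) (s * norm \<xi>))) \<partial>lborel)"
    proof (rule nn_integral_mono)
      fix s :: real
      have "norm (fourier_transform \<phi> ((s * norm \<xi>) *\<^sub>R (\<xi> /\<^sub>R norm \<xi>))) \<le> C * ray_weight TYPE('n) (s * norm \<xi>)"
        by (rule C(2)) (use \<xi> in simp)
      also have "(s * norm \<xi>) *\<^sub>R (\<xi> /\<^sub>R norm \<xi>) = s *\<^sub>R \<xi>" using \<xi> by simp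
      finally have "norm (k \<xi> s) \<le> spectral \<xi> * (\<bar>s\<bar> powr (p + e - 1) * (C * ray_weight TYPE('n) (s * norm \<xi>)))"
        using spectral_nonneg[of \<xi>] unfolding k_def norm_mult norm_of_real
        by (subst mult.left_commute) (auto intro!: mult_left_mono)
      then show "ennreal (norm (k \<xi> s)) \<le> ennreal (spectral \<xi>) * (ennreal (\<bar>s\<bar> powr (p + e - 1)) * ennreal (C * ray_weight TYPE('n) (s * norm \<xi>)))"
        by (simp add: ennreal_mult[symmetric] spectral_nonneg C(1) rw0 ennreal_leI)
    qed
    also have "\<dots> = ennreal (spectral \<xi>) * (\<integral>\<^sup>+s. ennreal (\<bar>s\<bar> powr (p + e - 1)) * ennreal (C * ray_weight TYPE('n) (s * norm \<xi>)) \<partial>lborel)"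
      by (rule nn_integral_cmult) measurable
    also have "(\<integral>\<^sup>+s. ennreal (\<bar>s\<bar> powr (p + e - 1)) * ennreal (C * ray_weight TYPE('n) (s * norm \<xi>)) \<partial>lborel) = ennreal (norm \<xi> powr (- (p + e))) * J"
      using nn_integral_homogeneous_scale[of "norm \<xi>" "\<lambda>t. ennreal (C * ray_weight TYPE('n) t)" "p + e"] \<xi> by (simp add: J_def)
    finally show "(\<integral>\<^sup>+s. ennreal (norm (k \<xi> s)) \<partial>lborel) \<le> ennreal (spectral \<xi>) * ennreal (norm \<xi> powr (- (p + e))) * J"
      by (simp only: mult.assoc)
  qed
  also have "\<dots> = (\<integral>\<^sup>+\<xi>. ennreal (spectral \<xi>) * ennreal (norm \<xi> powr (- (p + e))) \<partial>lborel) * J"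
    by (rule nn_integral_multc) measurable
  also have "\<dots> < \<infinity>" using nn_integral_spectral_finite J by (simp add: ennreal_mult_less_top)
  finally have kfin: "(\<integral>\<^sup>+\<xi>. \<integral>\<^sup>+s. ennreal (norm (k \<xi> s)) \<partial>lborel \<partial>lborel) < \<infinity>" .
  have "?c * (LINT s|lborel. LINT x|lborel. g s x) = (LINT s|lborel. ?c * (LINT x|lborel. g s x))" by simp
  also have "\<dots> = (LINT s|lborel. LINT \<xi>|lborel. k \<xi> s)"
  proof (rule integral_cong_AE)
    show "AE s in lborel. ?c * (LINT x|lborel. g s x) = (LINT \<xi>|lborel. k \<xi> s)"
    proof (rule AE_lborel_nonzeroI)
      fix s :: real assume s: "s \<noteq> 0"
      have sp: "\<bar>s\<bar> powr (e - 1) * \<bar>s\<bar> powr p = \<bar>s\<bar> powr (p + e - 1)" by (simp add: algebra_simps flip: powr_add)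
      have "?c * (LINT x|lborel. g s x) = complex_of_real (\<bar>s\<bar> powr (e - 1)) * (?c * (LINT x|lborel. complex_of_real (w x * gauss (s *\<^sub>R x)) * \<phi> x))"
        unfolding g_def integral_mult_right_zero by (simp only: mult_ac)
      also have "\<dots> = complex_of_real (\<bar>s\<bar> powr (p + e - 1)) * (LINT \<xi>|lborel. complex_of_real (spectral \<xi>) * fourier_transform \<phi> (s *\<^sub>R \<xi>))"
        unfolding dilated_parseval[OF \<phi> s] sp[symmetric] by simp
      also have "\<dots> = (LINT \<xi>|lborel. k \<xi> s)" unfolding k_def by (rule integral_mult_right_zero[symmetric])
      finally show "?c * (LINT x|lborel. g s x) = (LINT \<xi>|lborel. k \<xi> s)" .
    qed
    show "(\<lambda>s. ?c * (LINT x|lborel. g s x)) \<in> borel_measurable lborel" unfolding g_def by measurable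
    show "(\<lambda>s. LINT \<xi>|lborel. k \<xi> s) \<in> borel_measurable lborel" unfolding k_def by measurable
  qed
  also have "\<dots> = (LINT \<xi>|lborel. LINT s|lborel. k \<xi> s)" by (rule lborel_swap_integrals(1)[OF km kfin, symmetric])
  also have "\<dots> = (LINT \<xi>|lborel. complex_of_real (spectral \<xi> * norm \<xi> powr (- (p + e))) * ray_integral \<phi> (p + e) (\<xi> /\<^sub>R norm \<xi>))"
  proof (rule integral_cong_AE)
    show "AE \<xi> in lborel. (LINT s|lborel. k \<xi> s) = complex_of_real (spectral \<xi> * norm \<xi> powr (- (p + e))) * ray_integral \<phi> (p + e) (\<xi> /\<^sub>R norm \<xi>)"
    proof (rule AE_lborel_nonzeroI)
      fix \<xi> :: "real^'n" assume \<xi>: "\<xi> \<noteq> 0"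
      have "(LINT s|lborel. k \<xi> s) = (LINT s|lborel. complex_of_real (spectral \<xi>) * (complex_of_real (\<bar>s\<bar> powr (p + e - 1)) * fourier_transform \<phi> (s *\<^sub>R \<xi>)))"
        unfolding k_def by (intro Bochner_Integration.integral_cong refl) (simp only: mult_ac)
      also have "\<dots> = complex_of_real (spectral \<xi>) * ray_integral \<phi> (p + e) \<xi>"
        unfolding ray_integral_def by (rule integral_mult_right_zero)
      finally show "(LINT s|lborel. k \<xi> s) = complex_of_real (spectral \<xi> * norm \<xi> powr (- (p + e))) * ray_integral \<phi> (p + e) (\<xi> /\<^sub>R norm \<xi>)"
        unfolding ray_integral_homogeneous[OF \<xi>, of \<phi> "p + e"] by simp
    qed
    have [measurable]: "ray_integral \<phi> (p + e) \<in> borel_measurable borel" by (rule ray_integral_measurable[OF \<phi>])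
    show "(\<lambda>\<xi>. LINT s|lborel. k \<xi> s) \<in> borel_measurable lborel" unfolding k_def by measurable
    show "(\<lambda>\<xi>. complex_of_real (spectral \<xi> * norm \<xi> powr (- (p + e))) * ray_integral \<phi> (p + e) (\<xi> /\<^sub>R norm \<xi>)) \<in> borel_measurable lborel" by measurable
  qed
  finally have 1: "?c * (LINT s|lborel. LINT x|lborel. g s x) = 
    (LINT \<xi>|lborel. complex_of_real (spectral \<xi> * norm \<xi> powr (- (p + e))) * ray_integral \<phi> (p + e) (\<xi> /\<^sub>R norm \<xi>))" .
  have "(LINT s|lborel. LINT x|lborel. g s x) = (LINT x|lborel. LINT s|lborel. g s x)" by (rule lborel_swap_integrals(1)[OF gm gfin])
  also have "\<dots> = (LINT x|lborel. complex_of_real (gauss_moment e) * (complex_of_real (w x * norm x powr (- e)) * \<phi> x))"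
  proof (rule integral_cong_AE)
    show "AE x in lborel. (LINT s|lborel. g s x) = complex_of_real (gauss_moment e) * (complex_of_real (w x * norm x powr (- e)) * \<phi> x)"
    proof (rule AE_lborel_nonzeroI)
      fix x :: "real^'n" assume x: "x \<noteq> 0"
      have "(LINT s|lborel. g s x) = (LINT s|lborel. (complex_of_real (w x) * \<phi> x) * (complex_of_real (\<bar>s\<bar> powr (e - 1)) * complex_of_real (gauss (s *\<^sub>R x))))"
        unfolding g_def by (intro Bochner_Integration.integral_cong refl) simp
      also have "\<dots> = (complex_of_real (w x) * \<phi> x) * complex_of_real (norm x powr (- e) * gauss_moment e)"
        unfolding integral_mult_right_zero integral_gauss_ray[OF x] ..
      finally show "(LINT s|lborel. g s x) = complex_of_real (gauss_moment e) * (complex_of_real (w x * norm x powr (- e)) * \<phi> x)" by simp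
    qed
    show "(\<lambda>x. LINT s|lborel. g s x) \<in> borel_measurable lborel" unfolding g_def by measurable
  qed measurable
  also have "\<dots> = complex_of_real (gauss_moment e) * (LINT x|lborel. complex_of_real (w x * norm x powr (- e)) * \<phi> x)"
    by (rule integral_mult_right_zero)
  finally show ?thesis using 1 by (simp add: mult.assoc)
qed

end

end

end

subsection \<open>Symmetrisation on the sphere\<close>

text \<open>A two-point factor, counting measure on the booleans, selects the identity or the
  antipode. The image of the product is Q plus its reflection, of total mass 2, hence the density c
  / 2; even integrands do not see the choice.\<close>

lemma symmetric_measure_on_sphere:
  fixes Q :: "(real^'n) measure"
  assumes Q: "prob_space Q" and sets_Q [measurable_cong]: "sets Q = sets borel"
    and AE_S: "AE x in Q. x \<in> sphere 0 1" and c: "0 \<le> c"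
  obtains \<gamma> :: "(real^'n) measure" where
    "sets \<gamma> = sets (restrict_space borel (sphere 0 1))" "finite_measure \<gamma>"
    "\<And>A. A \<in> sets \<gamma> \<Longrightarrow> emeasure \<gamma> (uminus ` A) = emeasure \<gamma> A"
    "\<And>\<Psi> :: real^'n \<Rightarrow> complex. \<Psi> \<in> borel_measurable borel \<Longrightarrow> bounded (\<Psi> ` sphere 0 1) \<Longrightarrow> (\<And>x. \<Psi> (- x) = \<Psi> x) \<Longrightarrow>
       (LINT x|\<gamma>. \<Psi> x) = complex_of_real c * (LINT x|Q. \<Psi> x)"
proof -
  interpret Q: prob_space Q by (rule Q)
  define S where "S = sphere (0::real^'n) 1"
  have S_borel [measurable]: "S \<in> sets borel" by (simp add: S_def borel_closed)
  define R where "R = restrict_space Q S"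
  define RS where "RS = restrict_space (borel :: (real^'n) measure) S"
  define B where "B = count_space (UNIV :: bool set)"
  define f where "f = (\<lambda>(b, x::real^'n). if b then x else - x)"
  have sets_R: "sets R = sets RS" unfolding R_def RS_def by (rule sets_restrict_space_cong[OF sets_Q])
  have space_R: "space R = S" using sets_eq_imp_space_eq[OF sets_Q] by (simp add: R_def space_restrict_space)
  have space_RS: "space RS = S" by (simp add: RS_def space_restrict_space)
  interpret R: finite_measure R
    unfolding R_def using S_borel sets_Q by (intro finite_measure_restrict_space) (simp_all add: Q.finite_measure_axioms)
  interpret B: finite_measure B unfolding B_def by (rule finite_measure_count_space) simp
  interpret BR: pair_sigma_finite B R ..
  interpret BRf: finite_measure "B \<Otimes>\<^sub>M R" by (rule finite_measure_pair_measure) unfold_locales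
  have snd_borel [measurable]: "snd \<in> B \<Otimes>\<^sub>M R \<rightarrow>\<^sub>M borel"
  proof -
    have "(\<lambda>x. x) \<in> R \<rightarrow>\<^sub>M (borel :: (real^'n) measure)"
      unfolding R_def by (rule measurable_restrict_space1) (simp add: measurable_ident_sets sets_Q)
    from measurable_compose[OF measurable_snd this] show ?thesis .
  qed
  have fst_B [measurable]: "fst \<in> B \<Otimes>\<^sub>M R \<rightarrow>\<^sub>M count_space UNIV" using measurable_fst[of B R] by (simp add: B_def)
  have "f \<in> B \<Otimes>\<^sub>M R \<rightarrow>\<^sub>M borel"
    unfolding f_def case_prod_beta by measurable
  then have f: "f \<in> B \<Otimes>\<^sub>M R \<rightarrow>\<^sub>M RS"
    unfolding RS_def by (intro measurable_restrict_space2) (auto simp: space_pair_measure space_R S_def f_def)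
  define \<gamma>0 where "\<gamma>0 = distr (B \<Otimes>\<^sub>M R) RS f"
  define \<gamma> where "\<gamma> = density \<gamma>0 (\<lambda>_. ennreal (c / 2))"
  have sets_\<gamma>: "sets \<gamma> = sets RS" by (simp add: \<gamma>_def \<gamma>0_def)
  have uminus_sets: "uminus ` A \<in> sets RS" if A: "A \<in> sets RS" for A
  proof -
    obtain A' where A': "A' \<in> sets borel" "A = S \<inter> A'" using A by (auto simp: RS_def sets_restrict_space)
    have "uminus ` A = S \<inter> (uminus -` A' \<inter> space borel)"
      unfolding A'(2) by (auto simp: S_def image_iff) (metis add.inverse_inverse mem_sphere_0 norm_minus_cancel IntI)
    moreover have "uminus -` A' \<inter> space borel \<in> sets (borel :: (real^'n) measure)"
      by (rule measurable_sets[OF _ A'(1)]) measurable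
    ultimately show ?thesis unfolding RS_def sets_restrict_space by blast
  qed
  have sub: "A \<subseteq> S" if "A \<in> sets RS" for A using sets.sets_into_space[OF that] by (simp add: space_RS)
  have em: "emeasure \<gamma> A = ennreal (c / 2) * (emeasure R A + emeasure R (uminus ` A))" if A: "A \<in> sets RS" for A
  proof -
    have "emeasure \<gamma>0 A = emeasure (B \<Otimes>\<^sub>M R) (f -` A \<inter> space (B \<Otimes>\<^sub>M R))"
      unfolding \<gamma>0_def by (rule emeasure_distr[OF f A])
    also have "\<dots> = (\<integral>\<^sup>+b. emeasure R (Pair b -` (f -` A \<inter> space (B \<Otimes>\<^sub>M R))) \<partial>B)"
      by (rule R.emeasure_pair_measure_alt[OF measurable_sets[OF f A]])
    also have "\<dots> = emeasure R (Pair True -` (f -` A \<inter> space (B \<Otimes>\<^sub>M R))) + emeasure R (Pair False -` (f -` A \<inter> space (B \<Otimes>\<^sub>M R)))"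
      unfolding B_def by (subst nn_integral_count_space_finite) (auto simp: UNIV_bool add.commute)
    also have "Pair True -` (f -` A \<inter> space (B \<Otimes>\<^sub>M R)) = A"
      using sub[OF A] by (auto simp: f_def space_pair_measure space_R B_def)
    also have "Pair False -` (f -` A \<inter> space (B \<Otimes>\<^sub>M R)) = uminus ` A"
      using sub[OF A] by (auto simp: f_def space_pair_measure space_R B_def S_def image_iff) (metis add.inverse_inverse)
    finally show ?thesis
      unfolding \<gamma>_def using A by (subst emeasure_density_const) (auto simp: \<gamma>0_def)
  qed
  have "emeasure \<gamma> (space \<gamma>) \<noteq> \<infinity>"
  proof -
    have "space \<gamma> \<in> sets RS" unfolding sets_\<gamma>[symmetric] by (rule sets.top)
    from em[OF this] show ?thesis by (simp add: ennreal_mult_eq_top_iff)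
  qed
  then have fin: "finite_measure \<gamma>" by (rule finite_measureI)
  have sym: "emeasure \<gamma> (uminus ` A) = emeasure \<gamma> A" if "A \<in> sets \<gamma>" for A
  proof -
    have A: "A \<in> sets RS" using that by (simp add: sets_\<gamma>)
    have "uminus ` uminus ` A = A" by (simp add: image_image)
    then show ?thesis by (simp add: em A uminus_sets add.commute)
  qed
  have int: "(LINT x|\<gamma>. \<Psi> x) = complex_of_real c * (LINT x|Q. \<Psi> x)"
    if m [measurable]: "\<Psi> \<in> borel_measurable borel" and bd: "bounded (\<Psi> ` sphere 0 1)" and ev: "\<And>x. \<Psi> (- x) = \<Psi> x"
    for \<Psi> :: "real^'n \<Rightarrow> complex"
  proof -
    obtain K where "\<forall>z\<in>\<Psi> ` sphere 0 1. norm z \<le> K" using bd unfolding bounded_iff by blast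
    then have K: "norm (\<Psi> x) \<le> K" if "x \<in> S" for x using that by (simp add: S_def)
    have mRS: "\<Psi> \<in> borel_measurable RS" unfolding RS_def by (rule measurable_restrict_space1[OF m])
    have ib: "integrable (B \<Otimes>\<^sub>M R) (\<lambda>z. \<Psi> (snd z))"
      by (rule BRf.integrable_const_bound[where B = K]) (auto simp: space_pair_measure space_R intro!: AE_I2 K)
    have "(LINT x|\<gamma>. \<Psi> x) = (c / 2) *\<^sub>R (LINT x|\<gamma>0. \<Psi> x)"
      unfolding \<gamma>_def using mRS c by (subst integral_density) (auto simp: \<gamma>0_def)
    also have "(LINT x|\<gamma>0. \<Psi> x) = (LINT z|(B \<Otimes>\<^sub>M R). \<Psi> (f z))"
      unfolding \<gamma>0_def by (rule integral_distr[OF f mRS])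
    also have "\<dots> = (LINT z|(B \<Otimes>\<^sub>M R). \<Psi> (snd z))"
      by (intro Bochner_Integration.integral_cong) (auto simp: f_def ev split: prod.split)
    also have "\<dots> = (LINT b|B. LINT x|R. \<Psi> x)"
      using BR.integral_fst'[OF ib] by simp
    also have "\<dots> = 2 * (LINT x|R. \<Psi> x)"
      unfolding B_def by (subst lebesgue_integral_count_space_finite) (auto simp: UNIV_bool)
    also have "(LINT x|R. \<Psi> x) = (LINT x|Q. indicator S x *\<^sub>R \<Psi> x)"
      unfolding R_def using S_borel sets_Q by (intro integral_restrict_space) (simp add: sets.Int)
    also have "\<dots> = (LINT x|Q. \<Psi> x)"
    proof (rule integral_cong_AE)
      show "AE x in Q. indicator S x *\<^sub>R \<Psi> x = \<Psi> x"
        using AE_S by eventually_elim (simp add: S_def)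
    qed measurable
    finally show ?thesis by (simp add: scaleR_conv_of_real)
  qed
  show ?thesis
    by (rule that[of \<gamma>]) (use sets_\<gamma> fin sym int in \<open>auto simp: RS_def S_def\<close>)
qed

subsection \<open>The limit measure\<close>

lemma bounded_ray_integral:
  fixes \<phi> :: "real^'n \<Rightarrow> complex"
  assumes "schwartz \<phi>" "0 < a" "a < real CARD('n)"
  shows "bounded (ray_integral \<phi> a ` sphere 0 1)"
  by (intro compact_imp_bounded compact_continuous_image ray_integral_continuous assms compact_sphere)

lemma integrable_ray_integral:
  fixes \<phi> :: "real^'n \<Rightarrow> complex"
  assumes \<phi>: "schwartz \<phi>" "0 < a" "a < real CARD('n)"
    and P: "prob_space P" and sets_P [measurable_cong]: "sets P = sets borel" and AE_S: "AE x in P. x \<in> sphere 0 1"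
  shows "integrable P (ray_integral \<phi> a)"
proof -
  interpret prob_space P by (rule P)
  have [measurable]: "ray_integral \<phi> a \<in> borel_measurable borel" by (rule ray_integral_measurable[OF \<phi>(1)])
  obtain K where "\<forall>z\<in>ray_integral \<phi> a ` sphere 0 1. norm z \<le> K"
    using bounded_ray_integral[OF \<phi>] unfolding bounded_iff by blast
  then have "norm (ray_integral \<phi> a x) \<le> K" if "x \<in> sphere 0 1" for x using that by simp
  then show ?thesis
    by (intro integrable_const_bound[where B = K]) (use AE_S in \<open>auto elim!: eventually_mono\<close>)
qed

text \<open>Total mass one turns uniform closeness of integrands into closeness of integrals,
  however the measures move; so the integrand may be frozen at its limit v before weak convergence
  is used.\<close>

lemma tendsto_integral_uniform_perturbation:
  fixes u :: "nat \<Rightarrow> 'a \<Rightarrow> 'b::{banach, second_countable_topology}"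
  assumes P: "\<And>k. prob_space (P k)" and AE_S: "\<And>k. AE x in P k. x \<in> S"
    and iu: "\<And>k. integrable (P k) (u k)" and iv: "\<And>k. integrable (P k) v"
    and unif: "uniform_limit S u v sequentially" and lim: "(\<lambda>k. LINT x|P k. v x) \<longlonglongrightarrow> l"
  shows "(\<lambda>k. LINT x|P k. u k x) \<longlonglongrightarrow> l"
proof -
  have "(\<lambda>k. (LINT x|P k. u k x) - (LINT x|P k. v x)) \<longlonglongrightarrow> 0"
  proof (rule tendstoI)
    fix e :: real assume "0 < e"
    then have "\<forall>\<^sub>F k in sequentially. \<forall>x\<in>S. dist (u k x) (v x) < e / 2"
      using unif by (intro uniform_limitD) auto
    then show "\<forall>\<^sub>F k in sequentially. dist ((LINT x|P k. u k x) - (LINT x|P k. v x)) 0 < e"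
    proof eventually_elim
      case (elim k)
      interpret prob_space "P k" by (rule P)
      have "norm ((LINT x|P k. u k x) - (LINT x|P k. v x)) = norm (LINT x|P k. u k x - v x)"
        using iu iv by simp
      also have "\<dots> \<le> (LINT x|P k. norm (u k x - v x))" by (rule integral_norm_bound)
      also have "\<dots> \<le> (LINT x|P k. e / 2)"
        by (rule integral_mono_AE) (use iu iv AE_S[of k] elim in \<open>auto simp: dist_norm less_imp_le elim!: eventually_mono\<close>)
      also have "\<dots> = e / 2" by (simp add: prob_space)
      finally show ?case using \<open>0 < e\<close> by simp
    qed
  qed
  from tendsto_add[OF this lim] show ?thesis by simp
qed

context homogeneous_weight
begin

text \<open>Ensures that the measure built from \<open>spectral\<close> has nonzero mass and can be
  normalised.\<close>

lemma integral_w_gauss_pos: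
  assumes e: "0 \<le> e" "p + e < real CARD('n)"
  shows "0 < (LINT x|lborel. w x * norm x powr (- e) * gauss x)"
proof -
  have "(LINT x|lborel. w x * norm x powr (- e) * gauss x) \<noteq> 0"
  proof
    assume "(LINT x|lborel. w x * norm x powr (- e) * gauss x) = 0"
    then have "AE x in lborel. w x * norm x powr (- e) * gauss x = 0"
      using integrable_w_gauss[OF e] by (subst (asm) integral_nonneg_eq_0_iff_AE) (auto simp: w_nonneg less_imp_le)
    moreover have "AE x in lborel. x \<noteq> (0::real^'n)" by (rule AE_lborel_singleton)
    ultimately have "AE x in (lborel :: (real^'n) measure). False"
    proof eventually_elim
      case (elim x)
      then show False using N_pos[of x] less_imp_neq[OF gauss_pos[of x]] by (auto simp: w_def)
    qed
    then show False
      using emeasure_eq_0_AE[of "\<lambda>_. True" "lborel :: (real^'n) measure"] by simp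
  qed
  moreover have "0 \<le> (LINT x|lborel. w x * norm x powr (- e) * gauss x)"
    by (intro Bochner_Integration.integral_nonneg) (auto simp: w_nonneg less_imp_le)
  ultimately show ?thesis by simp
qed

lemma perturbed_embedding:
  assumes pd: "positive_definite_distribution T" and e: "0 < e" "p + e < real CARD('n)"
  obtains P \<kappa> where "prob_space P" "sets P = sets (borel :: (real^'n) measure)" "AE x in P. x \<in> sphere 0 1" "0 \<le> \<kappa>"
    "\<And>\<phi>. schwartz \<phi> \<Longrightarrow> (LINT x|lborel. complex_of_real (w x * norm x powr (- e)) * \<phi> x) =
       complex_of_real \<kappa> * (LINT \<theta>|P. ray_integral \<phi> (p + e) \<theta>)"
proof -
  define G where "G \<xi> = spectral \<xi> * norm \<xi> powr (- (p + e))" for \<xi>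
  define I where "I = (LINT \<xi>|lborel. G \<xi>)"
  have G0: "0 \<le> G \<xi>" for \<xi> using spectral_nonneg[OF pd] by (simp add: G_def)
  have [measurable]: "G \<in> borel_measurable borel" unfolding G_def by measurable
  have Gi: "integrable lborel G" unfolding G_def by (rule integrable_spectral_powr[OF pd e])
  have si: "complex_of_real ((2 * pi) ^ CARD('n) * gauss_moment e) * (LINT x|lborel. complex_of_real (w x * norm x powr (- e)) * \<phi> x)
    = (LINT \<xi>|lborel. complex_of_real (G \<xi>) * ray_integral \<phi> (p + e) (\<xi> /\<^sub>R norm \<xi>))" if "schwartz \<phi>" for \<phi>
    unfolding G_def by (rule spectral_identity[OF pd e that])
  have M: "0 < (2 * pi) ^ CARD('n) * gauss_moment e" using gauss_moment_pos[OF e(1)] by simp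
  \<comment> \<open>Zero mass would annihilate the right side of \<open>si\<close> for every test
    function; the Gaussian contradicts this.\<close>
  have "I \<noteq> 0"
  proof
    assume "I = 0"
    then have AE0: "AE \<xi> in lborel. G \<xi> = 0"
      unfolding I_def using Gi G0 by (subst (asm) integral_nonneg_eq_0_iff_AE) auto
    have [measurable]: "ray_integral (\<lambda>x::real^'n. complex_of_real (gauss x)) (p + e) \<in> borel_measurable borel"
      by (rule ray_integral_measurable[OF schwartz_gauss])
    have "(LINT \<xi>|lborel. complex_of_real (G \<xi>) * ray_integral (\<lambda>x. complex_of_real (gauss x)) (p + e) (\<xi> /\<^sub>R norm \<xi>)) = (LINT \<xi>|(lborel :: (real^'n) measure). 0)"
      by (rule integral_cong_AE) (use AE0 in \<open>auto elim!: eventually_mono\<close>)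
    then have "(LINT x|lborel. complex_of_real (w x * norm x powr (- e)) * complex_of_real (gauss x)) = 0"
      using si[OF schwartz_gauss] less_imp_neq[OF gauss_moment_pos[OF e(1)]] by (simp del: of_real_mult)
    then have "(LINT x|lborel. w x * norm x powr (- e) * gauss x) = 0"
      unfolding of_real_mult[symmetric] integral_complex_of_real by simp
    then show False using integral_w_gauss_pos[of e] e by simp
  qed
  moreover have "0 \<le> I" unfolding I_def using G0 by (intro Bochner_Integration.integral_nonneg) auto
  ultimately have I: "0 < I" by simp
  define D where "D = density lborel (\<lambda>\<xi>. ennreal (G \<xi> / I))"
  define dir where "dir \<xi> = \<xi> /\<^sub>R norm \<xi>" for \<xi> :: "real^'n"
  define P where "P = distr D borel dir"
  have dirm: "dir \<in> D \<rightarrow>\<^sub>M borel" unfolding D_def dir_def by measurable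
  have "prob_space D"
  proof (rule prob_spaceI)
    have "emeasure D (space D) = (\<integral>\<^sup>+\<xi>. ennreal (G \<xi> / I) \<partial>lborel)"
      unfolding D_def by (simp add: emeasure_density)
    also have "\<dots> = ennreal (LINT \<xi>|lborel. G \<xi> / I)"
      by (rule nn_integral_eq_integral) (use Gi G0 I in auto)
    also have "\<dots> = 1" using I by (simp add: I_def[symmetric])
    finally show "emeasure D (space D) = 1" .
  qed
  then have P: "prob_space P" unfolding P_def by (rule prob_space.prob_space_distr[OF _ dirm])
  \<comment> \<open>At the origin \<open>dir\<close> has the value 0, off the sphere, but the origin
    is a null set.\<close>
  have "AE \<xi> in D. dir \<xi> \<in> sphere 0 1"
    unfolding D_def
  proof (subst AE_density)
    show "AE \<xi> in lborel. 0 < ennreal (G \<xi> / I) \<longrightarrow> dir \<xi> \<in> sphere 0 1"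
      by (rule AE_mp[OF AE_lborel_singleton[of 0]]) (auto simp: dir_def)
  qed measurable
  then have PS: "AE x in P. x \<in> sphere 0 1"
    unfolding P_def by (subst AE_distr_iff[OF dirm]) (auto simp: borel_closed)
  \<comment> \<open>\<kappa> restores the mass I lost by normalising and divides by the constant of
    \<open>spectral_identity\<close>.\<close>
  define \<kappa> where "\<kappa> = I / ((2 * pi) ^ CARD('n) * gauss_moment e)"
  have "(LINT x|lborel. complex_of_real (w x * norm x powr (- e)) * \<phi> x) =
       complex_of_real \<kappa> * (LINT \<theta>|P. ray_integral \<phi> (p + e) \<theta>)" if \<phi>: "schwartz \<phi>" for \<phi>
  proof -
    have [measurable]: "ray_integral \<phi> (p + e) \<in> borel_measurable borel" by (rule ray_integral_measurable[OF \<phi>])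
    have "(LINT \<theta>|P. ray_integral \<phi> (p + e) \<theta>) = (LINT \<xi>|D. ray_integral \<phi> (p + e) (dir \<xi>))"
      unfolding P_def by (rule integral_distr[OF dirm]) measurable
    also have "\<dots> = (LINT \<xi>|lborel. (G \<xi> / I) *\<^sub>R ray_integral \<phi> (p + e) (dir \<xi>))"
      unfolding D_def by (rule integral_density) (use G0 I in \<open>auto simp: dir_def\<close>)
    also have "\<dots> = (LINT \<xi>|lborel. complex_of_real (1 / I) * (complex_of_real (G \<xi>) * ray_integral \<phi> (p + e) (dir \<xi>)))"
      by (intro Bochner_Integration.integral_cong) (auto simp: scaleR_conv_of_real)
    also have "\<dots> = complex_of_real (1 / I) * (complex_of_real ((2 * pi) ^ CARD('n) * gauss_moment e) * (LINT x|lborel. complex_of_real (w x * norm x powr (- e)) * \<phi> x))"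
      unfolding integral_mult_right_zero dir_def si[OF \<phi>] ..
    finally have "complex_of_real \<kappa> * (LINT \<theta>|P. ray_integral \<phi> (p + e) \<theta>) = 
      complex_of_real (\<kappa> * (1 / I) * ((2 * pi) ^ CARD('n) * gauss_moment e)) * (LINT x|lborel. complex_of_real (w x * norm x powr (- e)) * \<phi> x)"
      by simp
    also have "\<kappa> * (1 / I) * ((2 * pi) ^ CARD('n) * gauss_moment e) = 1"
      using I gauss_moment_pos[OF e(1)] by (simp add: \<kappa>_def)
    finally show ?thesis by simp
  qed
  moreover have "0 \<le> \<kappa>" unfolding \<kappa>_def using I M by (intro divide_nonneg_pos) auto
  ultimately show ?thesis using that[OF P _ PS] by (simp add: P_def)
qed

text \<open>Powers with exponents between 0 and -d are dominated by 1 + |x|^(-d), and p + d < n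
  keeps this majorant integrable against w |\<phi>|.\<close>

lemma perturbed_T_tendsto:
  assumes \<phi>: "schwartz \<phi>" and \<epsilon>: "\<And>k. 0 \<le> \<epsilon> k" "\<And>k. \<epsilon> k \<le> d" "\<epsilon> \<longlonglongrightarrow> 0" and d: "p + d < real CARD('n)"
  shows "(\<lambda>k. LINT x|lborel. complex_of_real (w x * norm x powr (- \<epsilon> k)) * \<phi> x) \<longlonglongrightarrow> T \<phi>"
  unfolding T_eq
proof (rule integral_dominated_convergence)
  have [measurable]: "\<phi> \<in> borel_measurable borel" by (rule schwartz_measurable[OF \<phi>])
  show "(\<lambda>x. complex_of_real (w x) * \<phi> x) \<in> borel_measurable lborel" by measurable
  show "(\<lambda>x. complex_of_real (w x * norm x powr (- \<epsilon> k)) * \<phi> x) \<in> borel_measurable lborel" for k by measurable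
  have d0: "0 \<le> d" using \<epsilon>(1,2)[of 0] by linarith
  show "integrable lborel (\<lambda>x. norm (complex_of_real (w x) * \<phi> x) + norm (complex_of_real (w x * norm x powr (- d)) * \<phi> x))"
    by (intro Bochner_Integration.integrable_add integrable_norm integrable_T \<phi> integrable_w_schwartz d0 d)
  show "AE x in lborel. (\<lambda>k. complex_of_real (w x * norm x powr (- \<epsilon> k)) * \<phi> x) \<longlonglongrightarrow> complex_of_real (w x) * \<phi> x"
  proof (rule AE_lborel_nonzeroI)
    fix x :: "real^'n" assume x: "x \<noteq> 0"
    have h: "(\<lambda>k. norm x powr (- \<epsilon> k)) \<longlonglongrightarrow> norm x powr (- 0)"
      by (intro tendsto_powr tendsto_intros \<epsilon>) (use x in auto)
    have "(\<lambda>k. complex_of_real (w x * norm x powr (- \<epsilon> k)) * \<phi> x) \<longlonglongrightarrow> complex_of_real (w x * norm x powr (- 0)) * \<phi> x"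
      by (rule tendsto_mult[OF tendsto_of_real[OF tendsto_mult[OF tendsto_const h]] tendsto_const])
    then show "(\<lambda>k. complex_of_real (w x * norm x powr (- \<epsilon> k)) * \<phi> x) \<longlonglongrightarrow> complex_of_real (w x) * \<phi> x"
      using x by simp
  qed
  show "AE x in lborel. norm (complex_of_real (w x * norm x powr (- \<epsilon> k)) * \<phi> x) \<le> norm (complex_of_real (w x) * \<phi> x) + norm (complex_of_real (w x * norm x powr (- d)) * \<phi> x)" for k
  proof (rule AE_lborel_nonzeroI)
    fix x :: "real^'n" assume x: "x \<noteq> 0"
    have "norm x powr (- \<epsilon> k) \<le> norm x powr (- d) + norm x powr 0"
      by (rule abs_powr_le_sum) (use \<epsilon>(1,2)[of k] in auto)
    then have "norm x powr (- \<epsilon> k) \<le> 1 + norm x powr (- d)" using x by simp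
    then have "(w x * norm (\<phi> x)) * norm x powr (- \<epsilon> k) \<le> (w x * norm (\<phi> x)) * (1 + norm x powr (- d))"
      by (rule mult_left_mono) (simp add: w_nonneg)
    then show "norm (complex_of_real (w x * norm x powr (- \<epsilon> k)) * \<phi> x) \<le> norm (complex_of_real (w x) * \<phi> x) + norm (complex_of_real (w x * norm x powr (- d)) * \<phi> x)"
      by (simp add: norm_mult w_nonneg algebra_simps)
  qed
qed

lemma positive_definite_imp_embeds:
  assumes pd: "positive_definite_distribution T"
  shows "embeds_in_L_neg N p"
proof -
  \<comment> \<open>Half of the gap between p and n: all exponents p + \<open>\<epsilon> k\<close>
    then stay at most p + d < n, as the uniform majorants require.\<close>
  define d where "d = (real CARD('n) - p) / 2"
  have d: "0 < d" "p + d < real CARD('n)" using p_less by (auto simp: d_def field_simps)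
  define \<epsilon> where "\<epsilon> k = d * (1 / real (Suc k))" for k
  have \<epsilon>: "0 < \<epsilon> k" "\<epsilon> k \<le> d" for k using d(1) by (auto simp: \<epsilon>_def field_simps)
  have \<epsilon>n: "p + \<epsilon> k < real CARD('n)" for k using \<epsilon>(2)[of k] d(2) by linarith
  have \<epsilon>lim: "\<epsilon> \<longlonglongrightarrow> 0"
    using tendsto_mult[OF tendsto_const lim_1_over_n[THEN LIMSEQ_Suc], of d] unfolding \<epsilon>_def mult_zero_right .
  let ?ok = "\<lambda>k P \<kappa>. prob_space P \<and> sets P = sets (borel :: (real^'n) measure) \<and> (AE x in P. x \<in> sphere 0 1) \<and> 0 \<le> \<kappa> \<and>
    (\<forall>\<phi>. schwartz \<phi> \<longrightarrow> (LINT x|lborel. complex_of_real (w x * norm x powr (- \<epsilon> k)) * \<phi> x) =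
       complex_of_real \<kappa> * (LINT \<theta>|P. ray_integral \<phi> (p + \<epsilon> k) \<theta>))"
  have "\<exists>P \<kappa>. ?ok k P \<kappa>" for k
    by (rule perturbed_embedding[OF pd \<epsilon>(1) \<epsilon>n, of k]) blast
  then have "\<exists>P. \<forall>k. \<exists>\<kappa>. ?ok k (P k) \<kappa>" by (intro choice allI)
  then obtain P where "\<forall>k. \<exists>\<kappa>. ?ok k (P k) \<kappa>" ..
  from choice[OF this] obtain \<kappa> where ok: "\<And>k. ?ok k (P k) (\<kappa> k)" by blast
  have P: "prob_space (P k)" "sets (P k) = sets borel" "AE x in P k. x \<in> sphere 0 1" "0 \<le> \<kappa> k" for k
    using ok by auto
  have id: "(LINT x|lborel. complex_of_real (w x * norm x powr (- \<epsilon> k)) * \<phi> x) = complex_of_real (\<kappa> k) * (LINT \<theta>|P k. ray_integral \<phi> (p + \<epsilon> k) \<theta>)"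
    if "schwartz \<phi>" for \<phi> k using ok that by blast
  obtain r Q where r: "strict_mono (r :: nat \<Rightarrow> nat)" and Q: "prob_space Q" "sets Q = sets borel" "AE x in Q. x \<in> sphere (0::real^'n) 1"
    and wk: "\<And>h :: real^'n \<Rightarrow> complex. h \<in> borel_measurable borel \<Longrightarrow> continuous_on (sphere 0 1) h \<Longrightarrow> (\<lambda>k. LINT x|P (r k). h x) \<longlonglongrightarrow> (LINT x|Q. h x)"
    using weak_compactness_on_compact[of P "sphere 0 1", OF P(1,2) compact_sphere P(3)] by blast
  have \<epsilon>r: "(\<lambda>k. \<epsilon> (r k)) \<longlonglongrightarrow> 0" using LIMSEQ_subseq_LIMSEQ[OF \<epsilon>lim r] by (simp add: comp_def)
  define A where "A \<phi> k = (LINT \<theta>|P (r k). ray_integral \<phi> (p + \<epsilon> (r k)) \<theta>)" for \<phi> k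
  have Alim: "A \<phi> \<longlonglongrightarrow> (LINT \<theta>|Q. ray_integral \<phi> p \<theta>)" if \<phi>: "schwartz \<phi>" for \<phi>
    unfolding A_def
  proof (rule tendsto_integral_uniform_perturbation[where S = "sphere 0 1" and v = "ray_integral \<phi> p"])
    show "integrable (P (r k)) (ray_integral \<phi> (p + \<epsilon> (r k)))" for k
      by (rule integrable_ray_integral[OF \<phi> _ \<epsilon>n P(1,2,3)]) (use p_pos \<epsilon>(1)[of "r k"] in linarith)
    show "integrable (P (r k)) (ray_integral \<phi> p)" for k
      by (rule integrable_ray_integral[OF \<phi> p_pos p_less P(1,2,3)])
    show "uniform_limit (sphere 0 1) (\<lambda>k. ray_integral \<phi> (p + \<epsilon> (r k))) (ray_integral \<phi> p) sequentially"
      by (rule ray_integral_uniform_limit[OF \<phi> p_pos d(2) _ _ \<epsilon>r]) (use \<epsilon> less_imp_le in auto)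
    show "(\<lambda>k. LINT x|P (r k). ray_integral \<phi> p x) \<longlonglongrightarrow> (LINT \<theta>|Q. ray_integral \<phi> p \<theta>)"
      by (intro wk ray_integral_measurable ray_integral_continuous \<phi> p_pos p_less)
  qed (rule P)+
  have Tlim: "(\<lambda>k. complex_of_real (\<kappa> (r k)) * A \<phi> k) \<longlonglongrightarrow> T \<phi>" if \<phi>: "schwartz \<phi>" for \<phi>
    using perturbed_T_tendsto[OF \<phi>, of "\<lambda>k. \<epsilon> (r k)" d] \<epsilon> \<epsilon>r d(2) unfolding A_def id[OF \<phi>, symmetric]
    by (simp add: less_imp_le)
  \<comment> \<open>The Gaussian determines the masses: its integrals \<open>A ?g k\<close> tend to
    the nonzero constant \<open>?c\<close>, so dividing \<open>Tlim\<close> by them shows that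
    \<kappa> converges along the chosen subsequence.\<close>
  let ?g = "\<lambda>x::real^'n. complex_of_real (gauss x)" and ?c = "sqrt (2 * pi) ^ CARD('n) * gauss_moment p"
  have c: "?c \<noteq> 0" using gauss_moment_pos[OF p_pos] by simp
  have "(LINT \<theta>|Q. ray_integral ?g p \<theta>) = (LINT \<theta>|Q. complex_of_real ?c)"
  proof (rule integral_cong_AE)
    show "AE \<theta> in Q. ray_integral ?g p \<theta> = complex_of_real ?c"
      using Q(3) by eventually_elim (simp add: ray_integral_gauss)
    show "ray_integral ?g p \<in> borel_measurable Q"
      using ray_integral_measurable[OF schwartz_gauss] measurable_cong_sets[OF Q(2) refl] by blast
  qed simp
  also have "\<dots> = complex_of_real ?c" using prob_space.prob_space[OF Q(1)] by simp
  finally have Ag: "A ?g \<longlonglongrightarrow> complex_of_real ?c" using Alim[OF schwartz_gauss] by simp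
  define z where "z = T ?g / complex_of_real ?c"
  have "(\<lambda>k. complex_of_real (\<kappa> (r k)) * A ?g k / A ?g k) \<longlonglongrightarrow> z"
    unfolding z_def by (intro tendsto_divide Tlim schwartz_gauss Ag) (use c in \<open>simp del: of_real_mult\<close>)
  moreover have "\<forall>\<^sub>F k in sequentially. A ?g k \<noteq> 0"
    by (rule tendsto_imp_eventually_ne[OF Ag]) (use c in \<open>simp del: of_real_mult\<close>)
  then have "\<forall>\<^sub>F k in sequentially. complex_of_real (\<kappa> (r k)) * A ?g k / A ?g k = complex_of_real (\<kappa> (r k))"
    by eventually_elim simp
  ultimately have \<kappa>z: "(\<lambda>k. complex_of_real (\<kappa> (r k))) \<longlonglongrightarrow> z" by (rule Lim_transform_eventually)
  \<comment> \<open>The limit was found in the complex numbers; its real part is the limit of the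
    real masses.\<close>
  define c where "c = Re z"
  have \<kappa>c: "(\<lambda>k. \<kappa> (r k)) \<longlonglongrightarrow> c" unfolding c_def using tendsto_Re[OF \<kappa>z] by simp
  have c0: "0 \<le> c" by (rule LIMSEQ_le_const[OF \<kappa>c]) (use P(4) in auto)
  have T: "T \<phi> = complex_of_real c * (LINT \<theta>|Q. ray_integral \<phi> p \<theta>)" if \<phi>: "schwartz \<phi>" for \<phi>
    by (rule LIMSEQ_unique[OF Tlim[OF \<phi>] tendsto_mult[OF tendsto_of_real[OF \<kappa>c] Alim[OF \<phi>]]])
  \<comment> \<open>Nothing so far makes Q symmetric. Ray integrals are even, so passing to the
    symmetrised measure preserves the identity.\<close>
  obtain \<gamma> :: "(real^'n) measure" where \<gamma>: "sets \<gamma> = sets (restrict_space borel (sphere 0 1))" "finite_measure \<gamma>"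
    "\<And>A. A \<in> sets \<gamma> \<Longrightarrow> emeasure \<gamma> (uminus ` A) = emeasure \<gamma> A"
    and \<gamma>int: "\<And>\<Psi> :: real^'n \<Rightarrow> complex. \<Psi> \<in> borel_measurable borel \<Longrightarrow> bounded (\<Psi> ` sphere 0 1) \<Longrightarrow> (\<And>x. \<Psi> (- x) = \<Psi> x) \<Longrightarrow>
       (LINT x|\<gamma>. \<Psi> x) = complex_of_real c * (LINT x|Q. \<Psi> x)"
    using symmetric_measure_on_sphere[OF Q c0] by blast
  have "(LINT x|lborel. complex_of_real (N x powr (- p)) * \<phi> x) = (LINT \<xi>|\<gamma>. ray_integral \<phi> p \<xi>)" if \<phi>: "schwartz \<phi>" for \<phi>
    using T[OF \<phi>] \<gamma>int[OF ray_integral_measurable[OF \<phi>] bounded_ray_integral[OF \<phi> p_pos p_less] ray_integral_minus]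
    by (simp add: function_distribution_def)
  then show ?thesis
    unfolding embeds_in_L_neg_def ray_integral_def using \<gamma> by blast
qed

end

theorem theorem1:
  fixes N :: "real^'n \<Rightarrow> real" and p :: real
  assumes "homogeneous_space N"
    and "0 < p" and "p < real CARD('n)"
  shows "embeds_in_L_neg N p \<longleftrightarrow>
    positive_definite_distribution (function_distribution (\<lambda>x. N x powr (- p)))"
proof -
  interpret homogeneous_weight N p using assms by unfold_locales
  show ?thesis using embeds_imp_positive_definite positive_definite_imp_embeds by blast
qed

end
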